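(* Any $f\in S'(\mathbb R^n)$ can be represented as $$f=\sum_{\beta\in\mathbb N_0^n,\,j\in\mathbb N_0,\,m\in\mathbb Z^n}2^{jn}\big(f,k^\beta_{j,m}\big)\,\Phi^\beta_{j,m},$$ unconditional convergence being in $S'(\mathbb R^n)$.
   Context: Let $n\in\mathbb N$, $\mathbb N_0=\mathbb N\cup\{0\}$. $(f,\varphi)=f(\varphi)$ is the bilinear dual pairing of $S'(\mathbb R^n)$ and $S(\mathbb R^n)$. $\widehat\varphi(\xi)=(2\pi)^{-n/2}\int_{\mathbb R^n}e^{-ix\xi}\varphi(x)\,dx$, and $\varphi^\vee$ is the inverse Fourier transform. Quarks. Fix $J\in\mathbb N$ and a non-negative $C^\infty$ function $k$ on $\mathbb R^n$ with $\operatorname{supp}k\subset\{y\in\mathbb R^n:|y|<2^J,\ y_l>0\ \text{for } l=1,\dots,n\}$ and $\sum_{m\in\mathbb Z^n}k(x-m)=1$ for $x\in\mathbb R^n$. For $\beta\in\mathbb N_0^n$, $j\in\mathbb N_0$, $m\in\mathbb Z^n$, with $x^\beta=\prod_lx_l^{\beta_l}$, let $$k^\beta(x)=(2^{-J}x)^\beta k(x),\qquad k^\beta_{j,m}(x)=k^\beta(2^jx-m).$$ Let $\omega$ be a real $C^\infty$ function with $\operatorname{supp}\omega\subset(-\pi,\pi)^n$ and $\omega(x)=1$ if $|x|\le2$, and let $$\omega^\beta(x)=\frac{i^{|\beta|}2^{J|\beta|}}{(2\pi)^n\beta!}x^\beta\omega(x),\qquad \Omega^\beta(x)=\sum_{m\in\mathbb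 Z^n}(\omega^\beta)^\vee(m)e^{-imx}.$$ Let $\varphi_0$ be a non-negative $C^\infty$ function with $\varphi_0(x)=1$ if $|x|\le1$, $\varphi_0(x)=0$ if $|x|\ge3/2$, let $\varphi^0(x)=\varphi_0(x)-\varphi_0(2x)$, and let $\Phi^\beta_F,\Phi^\beta_M\in S(\mathbb R^n)$ be given by $(\Phi^\beta_F)^\vee=\varphi_0\Omega^\beta$, $(\Phi^\beta_M)^\vee=\varphi^0\Omega^\beta$. Put $\Phi^\beta_{0,m}(x)=\Phi^\beta_F(x-m)$ and $\Phi^\beta_{j,m}(x)=\Phi^\beta_M(2^jx-m)$ for $j\in\mathbb N$. *)

theory Defs
  imports "HOL-Analysis.Analysis"
begin

text \<open>Iterated partial derivatives are indexed by lists of directions, so that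
  \<open>iter_partial [i, j] f\<close> is the derivative of \<open>f\<close> first in direction \<open>j\<close>, then in
  direction \<open>i\<close>. For smooth functions the order is irrelevant.\<close>

definition partial :: "'n::finite \<Rightarrow> (real ^ 'n \<Rightarrow> 'b::real_normed_vector) \<Rightarrow> real ^ 'n \<Rightarrow> 'b" where
  "partial i f x = frechet_derivative f (at x) (axis i 1)"

primrec iter_partial ::
    "'n::finite list \<Rightarrow> (real ^ 'n \<Rightarrow> 'b::real_normed_vector) \<Rightarrow> real ^ 'n \<Rightarrow> 'b" where
  "iter_partial [] f = f"
| "iter_partial (i # is) f = partial i (iter_partial is f)"

definition smooth :: "(real ^ 'n::finite \<Rightarrow> 'b::real_normed_vector) \<Rightarrow> bool" where
  "smooth f \<longleftrightarrow> (\<forall>is. iter_partial is f differentiable_on UNIV)"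

definition schwartz :: "(real ^ 'n::finite \<Rightarrow> complex) \<Rightarrow> bool" where
  "schwartz \<phi> \<longleftrightarrow> smooth \<phi> \<and>
     (\<forall>K is. bounded (range (\<lambda>x. (1 + norm x) ^ K *\<^sub>R iter_partial is \<phi> x)))"

definition schwartz_norm :: "nat \<Rightarrow> nat \<Rightarrow> (real ^ 'n::finite \<Rightarrow> complex) \<Rightarrow> real" where
  "schwartz_norm K L \<phi> =
     (SUP x. (1 + norm x) ^ K * (\<Sum>is | length is \<le> L. norm (iter_partial is \<phi> x)))"

definition schwartz_topology :: "(real ^ 'n::finite \<Rightarrow> complex) topology" where
  "schwartz_topology = topology_generated_by
     {{\<psi>. schwartz \<psi> \<and> schwartz_norm K L (\<lambda>x. \<psi> x - \<phi> x) < \<epsilon>} | \<phi> K L \<epsilon>.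
        schwartz \<phi> \<and> \<epsilon> > 0}"

text \<open>A tempered distribution is a HOL function on all functions from \<open>real ^ 'n\<close> to
  \<open>complex\<close>; its values off the Schwartz space carry no meaning.\<close>

definition tempered :: "((real ^ 'n::finite \<Rightarrow> complex) \<Rightarrow> complex) \<Rightarrow> bool" where
  "tempered f \<longleftrightarrow>
     (\<forall>\<phi> \<psi>. schwartz \<phi> \<longrightarrow> schwartz \<psi> \<longrightarrow> f (\<lambda>x. \<phi> x + \<psi> x) = f \<phi> + f \<psi>) \<and>
     (\<forall>c \<phi>. schwartz \<phi> \<longrightarrow> f (\<lambda>x. c * \<phi> x) = c * f \<phi>) \<and>
     continuous_map schwartz_topology euclidean f"

text \<open>The pairing is bilinear: no complex conjugation.\<close>

definition regular_distribution ::
    "(real ^ 'n::finite \<Rightarrow> complex) \<Rightarrow> (real ^ 'n \<Rightarrow> complex) \<Rightarrow> complex" where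
  "regular_distribution g \<phi> = (LINT x|lborel. g x * \<phi> x)"

text \<open>Unconditional convergence of a series of tempered distributions in the topology of
  pointwise convergence on test functions (weak-* topology): the finite partial sums,
  directed by inclusion of index sets, converge.\<close>

definition tempered_has_sum ::
    "('i \<Rightarrow> (real ^ 'n::finite \<Rightarrow> complex) \<Rightarrow> complex) \<Rightarrow>
     ((real ^ 'n \<Rightarrow> complex) \<Rightarrow> complex) \<Rightarrow> bool" where
  "tempered_has_sum T f \<longleftrightarrow>
     (\<forall>\<phi>. schwartz \<phi> \<longrightarrow> ((\<lambda>i. T i \<phi>) has_sum f \<phi>) UNIV)"

text \<open>The normalisation belongs to the Fourier transform with factor \<open>(2\<pi>)\<^sup>-\<^sup>n\<^sup>/\<^sup>2\<close> and kernel
  \<open>exp (- \<i> x \<xi>)\<close>.\<close>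

definition inverse_fourier ::
    "(real ^ 'n::finite \<Rightarrow> complex) \<Rightarrow> real ^ 'n \<Rightarrow> complex" where
  "inverse_fourier \<phi> \<xi> =
     complex_of_real ((2 * pi) powr (- real CARD('n) / 2)) *
     (LINT x|lborel. exp (\<i> * complex_of_real (x \<bullet> \<xi>)) * \<phi> x)"

definition mi_abs :: "nat ^ 'n::finite \<Rightarrow> nat" where
  "mi_abs \<beta> = (\<Sum>l\<in>UNIV. \<beta> $ l)"

definition mi_fact :: "nat ^ 'n::finite \<Rightarrow> nat" where
  "mi_fact \<beta> = (\<Prod>l\<in>UNIV. fact (\<beta> $ l))"

definition mi_power :: "real ^ 'n::finite \<Rightarrow> nat ^ 'n \<Rightarrow> real" where
  "mi_power x \<beta> = (\<Prod>l\<in>UNIV. (x $ l) ^ (\<beta> $ l))"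

definition lattice_point :: "int ^ 'n::finite \<Rightarrow> real ^ 'n" where
  "lattice_point m = (\<chi> l. real_of_int (m $ l))"

definition quark ::
    "nat \<Rightarrow> (real ^ 'n::finite \<Rightarrow> real) \<Rightarrow> nat ^ 'n \<Rightarrow> real ^ 'n \<Rightarrow> real" where
  "quark J k \<beta> x = mi_power ((1 / 2 ^ J) *\<^sub>R x) \<beta> * k x"

text \<open>Complex-valued, so that a distribution can be applied to it.\<close>

definition quark_scaled ::
    "nat \<Rightarrow> (real ^ 'n::finite \<Rightarrow> real) \<Rightarrow> nat ^ 'n \<Rightarrow> nat \<Rightarrow> int ^ 'n \<Rightarrow> real ^ 'n \<Rightarrow> complex" where
  "quark_scaled J k \<beta> j m x = complex_of_real (quark J k \<beta> (2 ^ j *\<^sub>R x - lattice_point m))"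

definition omega_mi ::
    "nat \<Rightarrow> (real ^ 'n::finite \<Rightarrow> real) \<Rightarrow> nat ^ 'n \<Rightarrow> real ^ 'n \<Rightarrow> complex" where
  "omega_mi J \<omega> \<beta> x =
     \<i> ^ mi_abs \<beta> * 2 ^ (J * mi_abs \<beta>) /
       (complex_of_real ((2 * pi) ^ CARD('n)) * of_nat (mi_fact \<beta>)) *
     complex_of_real (mi_power x \<beta> * \<omega> x)"

definition Omega_mi ::
    "nat \<Rightarrow> (real ^ 'n::finite \<Rightarrow> real) \<Rightarrow> nat ^ 'n \<Rightarrow> real ^ 'n \<Rightarrow> complex" where
  "Omega_mi J \<omega> \<beta> x =
     (\<Sum>\<^sub>\<infinity>m\<in>UNIV. inverse_fourier (omega_mi J \<omega> \<beta>) (lattice_point m) *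
        exp (- \<i> * complex_of_real (lattice_point m \<bullet> x)))"

definition wavelet_scaled ::
    "(nat ^ 'n::finite \<Rightarrow> real ^ 'n \<Rightarrow> complex) \<Rightarrow> (nat ^ 'n \<Rightarrow> real ^ 'n \<Rightarrow> complex) \<Rightarrow>
     nat ^ 'n \<Rightarrow> nat \<Rightarrow> int ^ 'n \<Rightarrow> real ^ 'n \<Rightarrow> complex" where
  "wavelet_scaled \<Phi>\<^sub>F \<Phi>\<^sub>M \<beta> j m x =
     (if j = 0 then \<Phi>\<^sub>F \<beta> (x - lattice_point m)
      else \<Phi>\<^sub>M \<beta> (2 ^ j *\<^sub>R x - lattice_point m))"

end

theory Submission
  imports Defs "HOL-Probability.Probability"
begin

text \<open>
  The expansion of \<open>f\<close> is dual to an expansion of test functions. Write \<open>q\<close> for a scaled quark and \<open>d\<close>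
  for \<open>2 ^ (j n)\<close> times the pairing of the corresponding wavelet with a Schwartz function \<open>\<phi>\<close>. If
  \<open>\<phi> = \<Sum> d q\<close>, absolutely convergent in every Schwartz seminorm, then \<open>f\<close>, which is bounded by one of
  these seminorms, may be applied termwise, and \<open>f \<phi> = \<Sum> d (f q)\<close> is the assertion.

  The identity \<open>\<phi> = \<Sum> d q\<close>. By Fourier inversion (\<open>fourier_inversion\<close>) the number \<open>d\<close> is an integral
  over frequencies \<open>\<eta>\<close> of the Fourier transform of \<open>\<phi>\<close> against the inverse Fourier transform of the
  wavelet at \<open>\<xi> = 2\<^sup>-\<^sup>j \<eta>\<close> and the modulation \<open>exp (\<i> m \<cdot> \<xi>)\<close> (\<open>pairing_dilated\<close>). The function
  \<open>\<Omega>\<^sup>\<beta>\<close> is a Fourier series of \<open>\<omega>\<^sup>\<beta>\<close>, and where the cutoffs live \<open>\<omega> = 1\<close>, so \<open>\<Omega>\<^sup>\<beta>(\<xi>)\<close> is there a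
  multiple of \<open>\<xi>\<^sup>\<beta>\<close> (\<open>fourier_series\<close>, \<open>Omega_mi_eq\<close>). The quark contributes the monomial
  \<open>(2\<^sup>-\<^sup>J (2 ^ j x - m))\<^sup>\<beta>\<close>, and with the chosen constants the sum over \<open>\<beta>\<close> is the exponential series of
  \<open>exp (\<i> (2 ^ j x - m) \<cdot> \<xi>)\<close>. It cancels the modulation and leaves \<open>exp (\<i> x \<cdot> \<eta>)\<close>; the lattice point
  \<open>m\<close> then occurs only in \<open>k (2 ^ j x - m)\<close>, which sums to \<open>1\<close>. Finally the cutoffs telescope to \<open>1\<close> in
  the sum over \<open>j\<close>, and Fourier inversion returns \<open>\<phi> x\<close> (\<open>quark_expansion_pointwise\<close>).

  The convergence. Integration by parts in \<open>\<eta>\<close> makes \<open>d\<close> decay faster than any power of \<open>norm m\<close>. For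
  \<open>j \<ge> 1\<close> the cutoff lives where \<open>norm \<eta> \<ge> 2 ^ (j - 1)\<close>, so the rapid decay of the Fourier transform
  of \<open>\<phi>\<close> makes \<open>d\<close> decay faster than any power of \<open>2 ^ j\<close> (\<open>band_integral_bound\<close>). The seminorms of the
  quarks grow only polynomially in \<open>2 ^ j\<close>, \<open>norm m\<close> and \<open>mi_abs \<beta>\<close> (\<open>quark_scaled_bound\<close>), and the factor
  \<open>1 / \<beta>!\<close> in \<open>\<omega>\<^sup>\<beta>\<close> beats whatever grows exponentially in \<open>mi_abs \<beta>\<close> (\<open>weighted_summable\<close>).
\<close>

section \<open>Smooth functions and their iterated partial derivatives\<close>

lemma partial_eqI: "(f has_derivative D) (at x) \<Longrightarrow> partial i f x = D (axis i 1)"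
  unfolding partial_def by (simp add: frechet_derivative_at[symmetric])

lemma iter_partial_append: "iter_partial (xs @ ys) f = iter_partial xs (iter_partial ys f)"
  by (induction xs) auto

text \<open>
  Smoothness is a greatest fixed point: any property that implies differentiability and is inherited
  by partial derivatives consists of smooth functions. All closure properties of \<^const>\<open>smooth\<close>
  come from this rule, with the property "is of the form that the lemma asserts".
\<close>

lemma smooth_coinduct:
  assumes "P f" and "\<And>g x. P g \<Longrightarrow> g differentiable (at x)" and "\<And>g i. P g \<Longrightarrow> P (partial i g)"
  shows "smooth f"
proof -
  have "P (iter_partial is f)" for "is"
    by (induction "is") (auto intro: assms)
  then show ?thesis
    unfolding smooth_def differentiable_on_def by (auto intro: assms(2))
qed

lemma smooth_iter_partial: "smooth f \<Longrightarrow> smooth (iter_partial is f)"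
  unfolding smooth_def by (metis iter_partial_append)

lemma smooth_partial: "smooth f \<Longrightarrow> smooth (partial i f)"
  using smooth_iter_partial[of f "[i]"] by simp

lemma smooth_differentiable: "smooth f \<Longrightarrow> f differentiable (at x)"
  unfolding smooth_def differentiable_on_def by (metis UNIV_I iter_partial.simps(1))

lemma smooth_continuous_on: "smooth f \<Longrightarrow> continuous_on S f"
  by (meson continuous_at_imp_continuous_on differentiable_imp_continuous_within smooth_differentiable)

lemma smooth_measurable [measurable_dest]: "smooth f \<Longrightarrow> f \<in> borel_measurable borel"
  by (rule borel_measurable_continuous_onI) (rule smooth_continuous_on)

lemma partial_has_vector_derivative:
  fixes f :: "real^'n::finite \<Rightarrow> 'b::real_normed_vector"
  assumes "f differentiable (at (x + t *\<^sub>R axis i 1))"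
  shows "((\<lambda>s. f (x + s *\<^sub>R axis i 1)) has_vector_derivative partial i f (x + t *\<^sub>R axis i 1)) (at t)"
proof -
  let ?D = "frechet_derivative f (at (x + t *\<^sub>R axis i 1))"
  have D: "(f has_derivative ?D) (at (x + t *\<^sub>R axis i 1))"
    using assms frechet_derivative_works by blast
  interpret bounded_linear ?D using D by (rule has_derivative_bounded_linear)
  have "((\<lambda>s. x + s *\<^sub>R axis i 1) has_derivative (\<lambda>s. s *\<^sub>R axis i (1::real))) (at t)"
    by (auto intro!: derivative_eq_intros)
  from has_derivative_compose[OF this D]
  have "((\<lambda>s. f (x + s *\<^sub>R axis i 1)) has_derivative (\<lambda>s. ?D (s *\<^sub>R axis i 1))) (at t)" .
  then show ?thesis
    unfolding has_vector_derivative_def partial_def by (simp add: scaleR)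
qed

lemma difference_quotient_tendsto:
  fixes f :: "real^'n::finite \<Rightarrow> complex"
  assumes "f differentiable (at x)"
  shows "((\<lambda>t. (1 / t) *\<^sub>R (f (x + t *\<^sub>R axis l 1) - f x)) \<longlongrightarrow> partial l f x) (at 0)"
proof -
  let ?y = "\<lambda>r. x + r *\<^sub>R axis l 1"
  have "((\<lambda>r. f (?y r)) has_vector_derivative partial l f x) (at 0)"
    using partial_has_vector_derivative[of f x 0 l] assms by simp
  then have "((\<lambda>r. norm (f (?y r) - f x - r *\<^sub>R partial l f x) / norm r) \<longlongrightarrow> 0) (at 0)"
    unfolding has_vector_derivative_def has_derivative_at by simp
  moreover have "\<forall>\<^sub>F r in at 0. norm (f (?y r) - f x - r *\<^sub>R partial l f x) / norm r
      = norm ((1 / r) *\<^sub>R (f (?y r) - f x) - partial l f x)"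
  proof (rule eventually_at_filter[THEN iffD2], rule always_eventually, intro allI impI)
    fix r :: real assume r: "r \<noteq> 0"
    have "(1 / r) *\<^sub>R (f (?y r) - f x) - partial l f x = (1 / r) *\<^sub>R (f (?y r) - f x - r *\<^sub>R partial l f x)"
      using r by (simp add: scaleR_diff_right)
    then show "norm (f (?y r) - f x - r *\<^sub>R partial l f x) / norm r
      = norm ((1 / r) *\<^sub>R (f (?y r) - f x) - partial l f x)" by simp
  qed
  ultimately have "((\<lambda>r. norm ((1 / r) *\<^sub>R (f (?y r) - f x) - partial l f x)) \<longlongrightarrow> 0) (at 0)"
    by (rule Lim_transform_eventually)
  then have "((\<lambda>r. (1 / r) *\<^sub>R (f (?y r) - f x) - partial l f x) \<longlongrightarrow> 0) (at 0)"
    by (rule tendsto_norm_zero_cancel)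
  then show ?thesis by (rule LIM_zero_cancel)
qed

text \<open>
  The mean value inequality along a coordinate segment. It supplies the majorant when limits of
  difference quotients are exchanged with integrals or sums.
\<close>

lemma difference_quotient_le:
  fixes f :: "real^'n::finite \<Rightarrow> complex"
  assumes diff: "\<And>y. f differentiable (at y)" and B: "\<And>s. \<bar>s\<bar> \<le> \<bar>t\<bar> \<Longrightarrow> norm (partial l f (x + s *\<^sub>R axis l 1)) \<le> B"
    and t: "t \<noteq> 0"
  shows "norm ((1 / t) *\<^sub>R (f (x + t *\<^sub>R axis l 1) - f x)) \<le> B"
proof -
  have "norm (f (x + t *\<^sub>R axis l 1) - f (x + 0 *\<^sub>R axis l 1)) \<le> B * norm (t - 0)"
  proof (rule differentiable_bound[where S="closed_segment 0 t" and f="\<lambda>r. f (x + r *\<^sub>R axis l 1)"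
          and f'="\<lambda>r h. h *\<^sub>R partial l f (x + r *\<^sub>R axis l 1)"])
    fix r assume r: "r \<in> closed_segment 0 t"
    show "((\<lambda>r. f (x + r *\<^sub>R axis l 1)) has_derivative (\<lambda>h. h *\<^sub>R partial l f (x
        + r *\<^sub>R axis l 1))) (at r within closed_segment 0 t)"
      by (rule has_derivative_at_withinI[OF partial_has_vector_derivative[unfolded has_vector_derivative_def]]) (rule diff)
    have "\<bar>r\<bar> \<le> \<bar>t\<bar>" using r by (auto simp: closed_segment_eq_real_ivl split: if_splits)
    then show "onorm (\<lambda>h. h *\<^sub>R partial l f (x + r *\<^sub>R axis l 1)) \<le> B"
      by (intro onorm_le) (simp only: norm_scaleR real_norm_def, subst mult.commute, intro mult_right_mono B, auto)
  qed auto
  then show ?thesis using t unfolding norm_scaleR by (simp add: pos_divide_le_eq)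
qed

lemma partial_add:
  assumes "f differentiable (at x)" "g differentiable (at x)"
  shows "partial i (\<lambda>x. f x + g x) x = partial i f x + partial i g x"
  by (rule partial_eqI[THEN trans, OF has_derivative_add[OF
        assms[unfolded frechet_derivative_works]]]) (simp add: partial_def)

lemma partial_mult:
  fixes f g :: "real^'n::finite \<Rightarrow> 'b::real_normed_algebra"
  assumes "f differentiable (at x)" "g differentiable (at x)"
  shows "partial i (\<lambda>x. f x * g x) x = partial i f x * g x + f x * partial i g x"
  by (rule partial_eqI[THEN trans, OF has_derivative_mult[OF
        assms[unfolded frechet_derivative_works]]]) (simp add: partial_def)

lemma partial_bounded_linear:
  assumes "bounded_linear h" "f differentiable (at x)"
  shows "partial i (\<lambda>x. h (f x)) x = h (partial i f x)"
  by (rule partial_eqI[THEN trans, OF bounded_linear.has_derivative[OF assms(1)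
        assms(2)[unfolded frechet_derivative_works]]]) (simp add: partial_def)

lemma partial_affine:
  fixes f :: "real^'n::finite \<Rightarrow> 'b::real_normed_vector"
  assumes "f differentiable (at (c *\<^sub>R x + a))"
  shows "partial i (\<lambda>x. f (c *\<^sub>R x + a)) x = c *\<^sub>R partial i f (c *\<^sub>R x + a)"
proof -
  let ?D = "frechet_derivative f (at (c *\<^sub>R x + a))"
  have D: "(f has_derivative ?D) (at (c *\<^sub>R x + a))"
    using assms frechet_derivative_works by blast
  interpret bounded_linear ?D using D by (rule has_derivative_bounded_linear)
  have "((\<lambda>x. c *\<^sub>R x + a) has_derivative (\<lambda>h. c *\<^sub>R h)) (at x)"
    by (auto intro!: derivative_eq_intros)
  from has_derivative_compose[OF this D] show ?thesis
    by (subst partial_eqI) (auto simp: partial_def scaleR)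
qed

lemma differentiable_affine:
  fixes f :: "real^'n::finite \<Rightarrow> 'b::real_normed_vector"
  assumes "f differentiable (at (c *\<^sub>R x + a))"
  shows "(\<lambda>x. f (c *\<^sub>R x + a)) differentiable (at x)"
  using differentiable_compose[of f "\<lambda>x. c *\<^sub>R x + a" x UNIV] assms
  by (auto intro!: derivative_intros)

lemma smooth_const: "smooth (\<lambda>_::real^'n::finite. c :: 'b::real_normed_vector)"
proof (rule smooth_coinduct[where P = "\<lambda>f. \<exists>c. f = (\<lambda>_. c)"])
  fix g :: "real^'n \<Rightarrow> 'b" and i assume "\<exists>c. g = (\<lambda>_. c)"
  then obtain c where g: "g = (\<lambda>_. c)" by blast
  have "partial i g = (\<lambda>_. 0)" unfolding g
    by (rule ext, subst partial_eqI[OF has_derivative_const]) simp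
  then show "\<exists>c. partial i g = (\<lambda>_. c)" by blast
qed auto

lemma smooth_add:
  assumes "smooth f" "smooth g" shows "smooth (\<lambda>x. f x + g x)"
proof (rule smooth_coinduct[where P = "\<lambda>h. \<exists>f g. smooth f \<and> smooth g \<and> h = (\<lambda>x. f x + g x)"])
  show "\<exists>f' g'. smooth f' \<and> smooth g' \<and> (\<lambda>x. f x + g x) = (\<lambda>x. f' x + g' x)"
    using assms by blast
next
  fix h x assume "\<exists>f g. smooth f \<and> smooth g \<and> h = (\<lambda>x. f x + g x)"
  then show "h differentiable (at x)"
    by (auto intro!: differentiable_add intro: smooth_differentiable)
next
  fix h i assume "\<exists>f g. smooth f \<and> smooth g \<and> h = (\<lambda>x. f x + g x)"
  then obtain f g where "smooth f" "smooth g" "h = (\<lambda>x. f x + g x)" by blast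
  then have "partial i h = (\<lambda>x. partial i f x + partial i g x)"
    by (auto simp: partial_add smooth_differentiable)
  then show "\<exists>f g. smooth f \<and> smooth g \<and> partial i h = (\<lambda>x. f x + g x)"
    using \<open>smooth f\<close> \<open>smooth g\<close> smooth_partial by blast
qed

lemma smooth_bounded_linear:
  assumes "bounded_linear h" "smooth f" shows "smooth (\<lambda>x. h (f x))"
proof (rule smooth_coinduct[where P = "\<lambda>u. \<exists>f. smooth f \<and> u = (\<lambda>x. h (f x))"])
  show "\<exists>f'. smooth f' \<and> (\<lambda>x. h (f x)) = (\<lambda>x. h (f' x))"
    using assms by blast
next
  fix u x assume "\<exists>f. smooth f \<and> u = (\<lambda>x. h (f x))"
  then show "u differentiable (at x)"
    using differentiable_compose[of h _ x UNIV] bounded_linear_imp_differentiable[OF assms(1)]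
    by (auto simp: smooth_differentiable)
next
  fix u i assume "\<exists>f. smooth f \<and> u = (\<lambda>x. h (f x))"
  then obtain f where "smooth f" "u = (\<lambda>x. h (f x))" by blast
  then have "partial i u = (\<lambda>x. h (partial i f x))"
    by (auto simp: partial_bounded_linear[OF assms(1)] smooth_differentiable)
  then show "\<exists>f. smooth f \<and> partial i u = (\<lambda>x. h (f x))"
    using \<open>smooth f\<close> smooth_partial by blast
qed

lemma iter_partial_bounded_linear:
  assumes "bounded_linear h" "smooth f"
  shows "iter_partial is (\<lambda>x. h (f x)) = (\<lambda>x. h (iter_partial is f x))"
  by (induction "is") (auto simp: partial_bounded_linear[OF assms(1)] smooth_differentiable
      smooth_iter_partial assms)

lemma iter_partial_add:
  assumes "smooth f" "smooth g"
  shows "iter_partial is (\<lambda>x. f x + g x) = (\<lambda>x. iter_partial is f x + iter_partial is g x)"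
  by (induction "is") (auto simp: partial_add smooth_differentiable smooth_iter_partial assms)

lemma smooth_affine:
  assumes "smooth f" shows "smooth (\<lambda>x. f (c *\<^sub>R x + a))"
proof (rule smooth_coinduct[where P = "\<lambda>u. \<exists>f. smooth f \<and> u = (\<lambda>x. f (c *\<^sub>R x + a))"])
  show "\<exists>f'. smooth f' \<and> (\<lambda>x. f (c *\<^sub>R x + a)) = (\<lambda>x. f' (c *\<^sub>R x + a))"
    using assms by blast
next
  fix u x assume "\<exists>f. smooth f \<and> u = (\<lambda>x. f (c *\<^sub>R x + a))"
  then show "u differentiable (at x)"
    by (auto intro: differentiable_affine smooth_differentiable)
next
  fix u i assume "\<exists>f. smooth f \<and> u = (\<lambda>x. f (c *\<^sub>R x + a))"
  then obtain f where f: "smooth f" "u = (\<lambda>x. f (c *\<^sub>R x + a))" by blast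
  then have "partial i u = (\<lambda>x. (\<lambda>x. c *\<^sub>R partial i f x) (c *\<^sub>R x + a))"
    by (auto simp: partial_affine smooth_differentiable)
  moreover have "smooth (\<lambda>x. c *\<^sub>R partial i f x)"
    by (rule smooth_bounded_linear[OF bounded_linear_scaleR_right smooth_partial[OF f(1)]])
  ultimately show "\<exists>f. smooth f \<and> partial i u = (\<lambda>x. f (c *\<^sub>R x + a))" by blast
qed

lemma iter_partial_affine:
  assumes "smooth f"
  shows "iter_partial is (\<lambda>x. f (c *\<^sub>R x + a)) =
     (\<lambda>x. c ^ length is *\<^sub>R iter_partial is f (c *\<^sub>R x + a))"
proof (induction "is")
  case (Cons i "is")
  have s: "smooth (iter_partial is f)" by (rule smooth_iter_partial[OF assms])
  have "partial i (\<lambda>x. c ^ length is *\<^sub>R iter_partial is f (c *\<^sub>R x + a)) x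
      = c ^ length is *\<^sub>R partial i (\<lambda>x. iter_partial is f (c *\<^sub>R x + a)) x" for x
    by (intro partial_bounded_linear bounded_linear_scaleR_right differentiable_affine smooth_differentiable s)
  then show ?case
    unfolding iter_partial.simps Cons
    by (auto simp: partial_affine smooth_differentiable[OF s] mult.commute)
qed simp

text \<open>
  The product rule turns one product into a sum of two, so the class of single products is not stable
  under differentiation; this one is.
\<close>

inductive sum_of_products :: "(real^'n::finite \<Rightarrow> 'b::real_normed_algebra) \<Rightarrow> bool" where
  prod: "smooth u \<Longrightarrow> smooth v \<Longrightarrow> sum_of_products (\<lambda>x. u x * v x)"
| add: "sum_of_products f \<Longrightarrow> sum_of_products g \<Longrightarrow> sum_of_products (\<lambda>x. f x + g x)"

lemma smooth_mult:
  fixes f g :: "real^'n::finite \<Rightarrow> 'b::real_normed_algebra"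
  assumes "smooth f" "smooth g" shows "smooth (\<lambda>x. f x * g x)"
proof (rule smooth_coinduct[where P = sum_of_products])
  show "sum_of_products (\<lambda>x. f x * g x)" using assms by (rule prod)
next
  fix h :: "real^'n \<Rightarrow> 'b" and x assume "sum_of_products h"
  then show "h differentiable (at x)"
    by induction (auto intro!: differentiable_add differentiable_mult intro: smooth_differentiable)
next
  fix h :: "real^'n \<Rightarrow> 'b" and i assume "sum_of_products h"
  then have "sum_of_products (partial i h) \<and> (\<forall>x. h differentiable (at x))"
  proof induction
    case (prod u v)
    have "partial i (\<lambda>x. u x * v x) = (\<lambda>x. partial i u x * v x + u x * partial i v x)"
      using prod by (auto simp: partial_mult smooth_differentiable)
    then show ?case using prod
      by (auto intro!: sum_of_products.intros smooth_partial differentiable_mult intro: smooth_differentiable)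
  next
    case (add f g)
    have "partial i (\<lambda>x. f x + g x) = (\<lambda>x. partial i f x + partial i g x)"
      using add by (auto simp: partial_add)
    then show ?case using add
      by (auto intro!: sum_of_products.intros differentiable_add)
  qed
  then show "sum_of_products (partial i h)" by blast
qed

lemma smooth_cmult:
  fixes f :: "real^'n::finite \<Rightarrow> 'b::real_normed_algebra"
  shows "smooth f \<Longrightarrow> smooth (\<lambda>x. c * f x)"
  by (rule smooth_bounded_linear[OF bounded_linear_mult_right])

lemma iter_partial_cmult:
  fixes f :: "real^'n::finite \<Rightarrow> 'b::real_normed_algebra"
  shows "smooth f \<Longrightarrow> iter_partial is (\<lambda>x. c * f x) = (\<lambda>x. c * iter_partial is f x)"
  by (rule iter_partial_bounded_linear[OF bounded_linear_mult_right])

lemma smooth_diff: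
  fixes f :: "real^'n::finite \<Rightarrow> 'b::real_normed_vector"
  assumes "smooth f" "smooth g" shows "smooth (\<lambda>x. f x - g x)"
  using smooth_add[OF assms(1) smooth_bounded_linear[OF bounded_linear_minus[OF bounded_linear_ident] assms(2)]]
  by simp

lemma iter_partial_diff:
  assumes "smooth f" "smooth g"
  shows "iter_partial is (\<lambda>x. f x - g x) = (\<lambda>x. iter_partial is f x - iter_partial is g x)"
  using iter_partial_add[OF assms(1) smooth_bounded_linear[OF bounded_linear_minus[OF bounded_linear_ident] assms(2)]]
   iter_partial_bounded_linear[OF bounded_linear_minus[OF bounded_linear_ident] assms(2)]
  by simp

lemma smooth_sum:
  assumes "\<And>i. i \<in> I \<Longrightarrow> smooth (f i)" shows "smooth (\<lambda>x. \<Sum>i\<in>I. f i x)"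
  using assms by (induction I rule: infinite_finite_induct) (auto intro: smooth_const smooth_add)

lemma iter_partial_zero: "iter_partial is (\<lambda>x. 0) = (\<lambda>x. 0)"
  by (induction "is") (auto intro!: ext partial_eqI[THEN trans, OF has_derivative_const])

lemma iter_partial_sum:
  assumes "\<And>i. i \<in> I \<Longrightarrow> smooth (f i)"
  shows "iter_partial is (\<lambda>x. \<Sum>i\<in>I. f i x) = (\<lambda>x. \<Sum>i\<in>I. iter_partial is (f i) x)"
  using assms
proof (induction I rule: infinite_finite_induct)
  case (insert i I)
  then show ?case by (auto simp: iter_partial_add smooth_sum)
qed (auto simp: iter_partial_zero)

text \<open>
  Derivatives are local, so supports do not grow under differentiation.
\<close>

lemma iter_partial_eq_0:
  assumes "open S" "\<And>x. x \<in> S \<Longrightarrow> f x = 0" "x \<in> S"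
  shows "iter_partial is f x = 0"
  using assms(3)
proof (induction "is" arbitrary: x)
  case (Cons i "is")
  have "(iter_partial is f has_derivative (\<lambda>_. 0)) (at x)"
    by (rule has_derivative_transform_within_open[OF has_derivative_const[of 0] assms(1)])
      (use Cons in auto)
  then show ?case by (auto dest: partial_eqI)
qed (auto simp: assms)

lemma coordinate_has_derivative:
  "((\<lambda>x. complex_of_real (x $ l)) has_derivative (\<lambda>h. complex_of_real (h $ l))) (at x)"
  by (intro bounded_linear_imp_has_derivative bounded_linear_compose[OF bounded_linear_of_real] bounded_linear_vec_nth)

lemma partial_coordinate:
  "partial i (\<lambda>x. complex_of_real (x $ l)) = (\<lambda>_. if i = l then 1 else 0)"
  by (rule ext, rule partial_eqI[THEN trans, OF coordinate_has_derivative]) (simp add: axis_def)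

lemma smooth_coordinate: "smooth (\<lambda>x::real^'n::finite. complex_of_real (x $ l))"
proof (rule smooth_coinduct[where P = "\<lambda>f. f = (\<lambda>x. complex_of_real (x $ l)) \<or> smooth f"])
  fix g :: "real^'n \<Rightarrow> complex" and i
  assume "g = (\<lambda>x. complex_of_real (x $ l)) \<or> smooth g"
  moreover have "smooth (partial i (\<lambda>x::real^'n. complex_of_real (x $ l)))"
    unfolding partial_coordinate by (rule smooth_const)
  ultimately show "partial i g = (\<lambda>x. complex_of_real (x $ l)) \<or> smooth (partial i g)"
    using smooth_partial by auto
next
  fix g :: "real^'n \<Rightarrow> complex" and x
  assume "g = (\<lambda>x. complex_of_real (x $ l)) \<or> smooth g"
  then show "g differentiable (at x)"
    using coordinate_has_derivative smooth_differentiable unfolding differentiable_def by blast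
qed auto

text \<open>
  A derivative of order \<open>N\<close> of a product is a sum of \<open>2 ^ N\<close> products of derivatives of the factors.
  The bound is pointwise, so that the two factors may be controlled by quantities depending on the
  point, such as the decay of a Schwartz function.
\<close>

lemma leibniz_bound:
  fixes u v :: "real^'n::finite \<Rightarrow> complex"
  assumes "smooth u" "smooth v"
    and "\<And>is'. length is' \<le> length is \<Longrightarrow> norm (iter_partial is' u x) \<le> U"
    and "\<And>is'. length is' \<le> length is \<Longrightarrow> norm (iter_partial is' v x) \<le> V"
  shows "norm (iter_partial is (\<lambda>x. u x * v x) x) \<le> 2 ^ length is * (U * V)"
  using assms
proof (induction "is" arbitrary: u v rule: rev_induct)
  case Nil
  have u: "norm (u x) \<le> U" and v: "norm (v x) \<le> V" using Nil(3)[of "[]"] Nil(4)[of "[]"] by simp_all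
  have "norm (u x) * norm (v x) \<le> U * V"
    by (intro mult_mono u v order_trans[OF norm_ge_zero u] norm_ge_zero)
  then show ?case by (simp add: norm_mult)
next
  case (snoc i "is")
  have "partial i (\<lambda>x. u x * v x) = (\<lambda>x. partial i u x * v x + u x * partial i v x)"
    using snoc by (auto simp: partial_mult smooth_differentiable)
  then have *: "iter_partial (is @ [i]) (\<lambda>x. u x * v x) x =
      iter_partial is (\<lambda>x. partial i u x * v x) x + iter_partial is (\<lambda>x. u x * partial i v x) x"
    using snoc by (simp add: iter_partial_append iter_partial_add smooth_partial smooth_mult)
  have p: "norm (iter_partial is' (partial i u) x) \<le> U" "norm (iter_partial is' (partial i v) x) \<le> V"
    if "length is' \<le> length is" for is'
    using snoc(4)[of "is' @ [i]"] snoc(5)[of "is' @ [i]"] that by (auto simp: iter_partial_append)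
  have "norm (iter_partial is (\<lambda>x. partial i u x * v x) x) \<le> 2 ^ length is * (U * V)"
    by (rule snoc.IH) (simp_all add: snoc.prems p smooth_partial)
  moreover have "norm (iter_partial is (\<lambda>x. u x * partial i v x) x) \<le> 2 ^ length is * (U * V)"
    by (rule snoc.IH) (simp_all add: snoc.prems p smooth_partial)
  ultimately have "norm (iter_partial (is @ [i]) (\<lambda>x. u x * v x) x)
      \<le> 2 ^ length is * (U * V) + 2 ^ length is * (U * V)"
    unfolding * by (rule norm_triangle_mono)
  then show ?case by (simp add: mult_ac)
qed

definition monomial :: "nat^'n::finite \<Rightarrow> real^'n \<Rightarrow> complex" where
  "monomial \<beta> x = complex_of_real (mi_power x \<beta>)"

text \<open>
  The truncation at \<open>0\<close> is harmless: in the derivative of a monomial the lowered monomial carries the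
  factor \<open>\<beta> $ l\<close>.
\<close>

definition mi_lower :: "'n::finite \<Rightarrow> nat^'n \<Rightarrow> nat^'n" where
  "mi_lower l \<beta> = (\<chi> i. if i = l then \<beta> $ i - 1 else \<beta> $ i)"

lemma monomial_prod: "monomial \<beta> x = (\<Prod>l\<in>UNIV. complex_of_real (x $ l) ^ (\<beta> $ l))"
  unfolding monomial_def mi_power_def by simp

lemma monomial_has_derivative:
  "(monomial \<beta> has_derivative (\<lambda>h. \<Sum>l\<in>UNIV. complex_of_real (h $ l) * (of_nat (\<beta> $ l)
      * monomial (mi_lower l \<beta>) x))) (at x)"
proof -
  have m: "monomial (mi_lower l \<beta>) x = complex_of_real (x $ l) ^ (\<beta> $ l - 1)
      * (\<Prod>i\<in>UNIV - {l}. complex_of_real (x $ i) ^ (\<beta> $ i))" for l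
    unfolding monomial_prod by (subst prod.remove[of _ l]) (auto simp: mi_lower_def)
  have "((\<lambda>x. \<Prod>l\<in>UNIV. complex_of_real (x $ l) ^ (\<beta> $ l)) has_derivative
     (\<lambda>h. \<Sum>l\<in>UNIV. (of_nat (\<beta> $ l) * complex_of_real (h $ l) * complex_of_real (x $ l) ^ (\<beta> $ l - 1))
       * (\<Prod>i\<in>UNIV - {l}. complex_of_real (x $ i) ^ (\<beta> $ i)))) (at x)"
    by (rule has_derivative_prod) (rule has_derivative_power[OF coordinate_has_derivative])
  then show ?thesis
    unfolding monomial_prod[abs_def] m[unfolded monomial_prod] by (simp add: mult_ac)
qed

lemma partial_monomial: "partial l (monomial \<beta>) = (\<lambda>x. of_nat (\<beta> $ l) * monomial (mi_lower l \<beta>) x)"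
proof
  fix x
  show "partial l (monomial \<beta>) x = of_nat (\<beta> $ l) * monomial (mi_lower l \<beta>) x"
    by (subst partial_eqI[OF monomial_has_derivative])
      (simp add: axis_def if_distrib[of complex_of_real] if_distrib[of "\<lambda>x. x * _"] cong: if_cong)
qed

lemma monomial_differentiable: "monomial \<beta> differentiable (at x)"
  using monomial_has_derivative unfolding differentiable_def by blast

lemma smooth_monomial: "smooth (monomial \<beta>)"
proof (rule smooth_coinduct[where P = "\<lambda>f. \<exists>c \<beta>. f = (\<lambda>x. c * monomial \<beta> x)"])
  show "\<exists>c \<beta>'. monomial \<beta> = (\<lambda>x. c * monomial \<beta>' x)"
    by (rule exI[of _ 1], rule exI[of _ \<beta>]) auto
next
  fix g :: "real^'a \<Rightarrow> complex" and x
  assume "\<exists>c \<beta>. g = (\<lambda>x. c * monomial \<beta> x)"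
  then show "g differentiable (at x)"
    by (auto intro!: differentiable_mult differentiable_const monomial_differentiable)
next
  fix g :: "real^'a \<Rightarrow> complex" and i
  assume "\<exists>c \<beta>. g = (\<lambda>x. c * monomial \<beta> x)"
  then obtain c \<beta> where g: "g = (\<lambda>x. c * monomial \<beta> x)" by auto
  have "partial i g x = c * of_nat (\<beta> $ i) * monomial (mi_lower i \<beta>) x" for x
    using partial_bounded_linear[OF bounded_linear_mult_right monomial_differentiable, of i c \<beta> x]
    unfolding g partial_monomial by (simp add: mult.assoc)
  then show "\<exists>c \<beta>. partial i g = (\<lambda>x. c * monomial \<beta> x)" by blast
qed

lemma mi_abs_lower: "mi_abs (mi_lower l \<beta>) \<le> mi_abs \<beta>"
  unfolding mi_abs_def mi_lower_def by (rule sum_mono) auto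

lemma component_le_mi_abs: "\<beta> $ l \<le> mi_abs \<beta>"
  unfolding mi_abs_def by (rule member_le_sum) auto

lemma monomial_bound:
  assumes "1 \<le> R" "norm x \<le> R"
  shows "norm (monomial \<beta> x) \<le> R ^ mi_abs \<beta>"
proof -
  have "\<bar>x $ l\<bar> \<le> R" for l using component_le_norm_cart[of x l] assms by linarith
  then have "norm (monomial \<beta> x) \<le> (\<Prod>l\<in>UNIV. R ^ (\<beta> $ l))"
    unfolding monomial_prod prod_norm[symmetric] by (intro prod_mono) (auto simp: norm_power intro!: power_mono)
  then show ?thesis by (simp add: mi_abs_def power_sum)
qed

text \<open>
  Each derivative brings down one exponent, hence the polynomial factor in \<open>mi_abs \<beta>\<close>; against the
  \<open>\<beta>!\<close> in the denominator of the coefficients such growth does not matter.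
\<close>

lemma iter_partial_monomial_bound:
  assumes "1 \<le> R" "norm x \<le> R"
  shows "norm (iter_partial is (monomial \<beta>) x) \<le> real (1 + mi_abs \<beta>) ^ length is * R ^ mi_abs \<beta>"
proof (induction "is" arbitrary: \<beta> rule: rev_induct)
  case Nil
  then show ?case using monomial_bound[OF assms] by simp
next
  case (snoc i "is")
  have "iter_partial (is @ [i]) (monomial \<beta>) x = of_nat (\<beta> $ i) * iter_partial is (monomial (mi_lower i \<beta>)) x"
    by (simp add: iter_partial_append partial_monomial iter_partial_cmult smooth_monomial)
  then have "norm (iter_partial (is @ [i]) (monomial \<beta>) x) =
      real (\<beta> $ i) * norm (iter_partial is (monomial (mi_lower i \<beta>)) x)"
    by (simp add: norm_mult)
  also have "\<dots> \<le> real (1 + mi_abs \<beta>) * (real (1 + mi_abs (mi_lower i \<beta>)) ^ length is * R ^ mi_abs (mi_lower i \<beta>))"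
    using component_le_mi_abs[of \<beta> i] by (intro mult_mono snoc.IH) auto
  also have "\<dots> \<le> real (1 + mi_abs \<beta>) * (real (1 + mi_abs \<beta>) ^ length is * R ^ mi_abs \<beta>)"
    using mi_abs_lower[of i \<beta>] assms by (intro mult_left_mono mult_mono power_mono power_increasing) auto
  finally show ?case by simp
qed

section \<open>Integrals over Euclidean space\<close>

text \<open>
  Lebesgue measure on \<open>real ^ 'n\<close> is the image of the product measure indexed by the standard basis,
  which is in bijection with \<open>'n\<close>. This reduces integrals of functions that split into coordinates
  to one dimension.
\<close>

lemma lborel_prod:
  fixes f :: "'n::finite \<Rightarrow> real \<Rightarrow> 'b::{real_normed_field,banach,second_countable_topology}"
  assumes "\<And>l. integrable lborel (f l)"
  shows lborel_integrable_prod: "integrable lborel (\<lambda>x::real^'n. \<Prod>l\<in>UNIV. f l (x $ l))"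
    and lborel_integral_prod: "(LINT x|lborel. (\<Prod>l\<in>UNIV. f l ((x::real^'n) $ l)))
        = (\<Prod>l\<in>UNIV. integral\<^sup>L lborel (f l))"
proof -
  let ?B = "Basis :: (real^'n) set"
  let ?e = "\<lambda>l. axis l (1::real) :: real^'n"
  have B: "?B = range ?e" unfolding Basis_vec_def by auto
  have inj: "inj ?e" by (auto simp: inj_on_def axis_eq_axis)
  define F where "F = (\<lambda>b. f (inv ?e b))"
  have Fe: "F (?e l) = f l" for l by (simp add: F_def inv_f_f[OF inj])
  have coord: "(\<Sum>b\<in>?B. g b *\<^sub>R b) $ l = g (?e l)" for g l
    unfolding B by (subst sum.reindex[OF inj])
      (simp add: axis_def if_distrib cong: if_cong)
  have prodF: "(\<Prod>b\<in>?B. G b) = (\<Prod>l\<in>UNIV. G (?e l))" for G :: "_ \<Rightarrow> 'b"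
    unfolding B by (subst prod.reindex[OF inj]) simp
  have conv: "(\<Prod>l\<in>UNIV. f l ((\<Sum>b\<in>?B. g b *\<^sub>R b) $ l)) = (\<Prod>b\<in>?B. F b (g b))" for g
    unfolding coord prodF Fe ..
  have [measurable]: "f l \<in> borel_measurable borel" for l
    using borel_measurable_integrable[OF assms[of l]] by simp
  have meas[measurable]: "(\<lambda>x::real^'n. \<Prod>l\<in>UNIV. f l (x $ l)) \<in> borel_measurable borel"
  proof -
    have "(\<lambda>x::real^'n. x $ l) \<in> borel_measurable borel" for l
      by (rule borel_measurable_continuous_onI) (intro continuous_intros)
    then show ?thesis by measurable
  qed
  interpret product_sigma_finite "\<lambda>_::real^'n. lborel :: real measure"
    by standard
  have iF: "integrable lborel (F b)" for b unfolding F_def by (rule assms)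
  have 1: "integrable (\<Pi>\<^sub>M b\<in>?B. lborel) (\<lambda>x. \<Prod>b\<in>?B. F b (x b))"
    by (rule product_integrable_prod) (auto simp: iF)
  have 2: "(LINT x|(\<Pi>\<^sub>M b\<in>?B. lborel). (\<Prod>b\<in>?B. F b (x b))) = (\<Prod>b\<in>?B. integral\<^sup>L lborel (F b))"
    by (rule product_integral_prod) (auto simp: iF)
  have T: "(\<lambda>g. \<Sum>b\<in>?B. g b *\<^sub>R b) \<in> (\<Pi>\<^sub>M b\<in>?B. lborel) \<rightarrow>\<^sub>M borel"
    by measurable
  show "integrable lborel (\<lambda>x::real^'n. \<Prod>l\<in>UNIV. f l (x $ l))"
    by (subst lborel_eq, subst integrable_distr_eq[OF T meas]) (simp only: conv 1)
  show "(LINT x|lborel. (\<Prod>l\<in>UNIV. f l ((x::real^'n) $ l))) = (\<Prod>l\<in>UNIV. integral\<^sup>L lborel (f l))"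
    by (subst lborel_eq, subst integral_distr[OF T meas]) (simp only: conv 2, simp only: prodF Fe)
qed

lemma lborel_translation:
  fixes f :: "'a::euclidean_space \<Rightarrow> 'b::{banach,second_countable_topology}"
  assumes [measurable]: "f \<in> borel_measurable borel"
  shows lborel_integral_translation: "(LINT x|lborel. f (a + x)) = (LINT x|lborel. f x)"
    and lborel_integrable_translation: "integrable lborel (\<lambda>x. f (a + x)) \<longleftrightarrow> integrable lborel f"
  by (subst (2) lborel_distr_plus[symmetric, of a], subst integral_distr, simp_all)
    (subst (2) lborel_distr_plus[symmetric, of a], subst integrable_distr_eq, simp_all)

lemma lborel_scaling:
  fixes f :: "real^'n::finite \<Rightarrow> 'b::{banach,second_countable_topology}"
  assumes [measurable]: "f \<in> borel_measurable borel" and c: "c \<noteq> 0"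
  shows lborel_integral_scaling: "\<bar>c\<bar> ^ CARD('n) *\<^sub>R (LINT x|lborel. f (c *\<^sub>R x)) = (LINT x|lborel. f x)"
    and lborel_integrable_scaling: "integrable lborel (\<lambda>x. f (c *\<^sub>R x)) \<longleftrightarrow> integrable lborel f"
proof -
  have L: "lborel = density (distr lborel borel (\<lambda>x::real^'n. c *\<^sub>R x)) (\<lambda>_. \<bar>c\<bar> ^ CARD('n))"
    using lborel_affine[OF c, of "0::real^'n"] by simp
  show "\<bar>c\<bar> ^ CARD('n) *\<^sub>R (LINT x|lborel. f (c *\<^sub>R x)) = (LINT x|lborel. f x)"
    by (subst (2) L, subst integral_density) (auto simp: integral_distr)
  show "integrable lborel (\<lambda>x. f (c *\<^sub>R x)) \<longleftrightarrow> integrable lborel f"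
  proof -
    have *: "integrable lborel (\<lambda>x. \<bar>c\<bar> ^ CARD('n) *\<^sub>R f (c *\<^sub>R x)) \<Longrightarrow> integrable lborel (\<lambda>x. f (c *\<^sub>R x))"
      using integrable_scaleR_right[of "1 / \<bar>c\<bar> ^ CARD('n)" lborel "\<lambda>x. \<bar>c\<bar> ^ CARD('n) *\<^sub>R f (c *\<^sub>R x)"] c
      by simp
    show ?thesis
      by (subst (2) L, subst integrable_density) (use c * in \<open>auto simp: integrable_distr_eq\<close>)
  qed
qed

text \<open>
  The reference majorant: integrable over the space and summable over the lattice.
\<close>

definition decay :: "real^'n::finite \<Rightarrow> real" where
  "decay x = 1 / (1 + norm x) ^ (2 * CARD('n))"

lemma decay_pos: "decay x > 0" unfolding decay_def by (simp add: add_pos_nonneg)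

lemma decay_le: 
  assumes "(1 + norm (x::real^'n::finite)) ^ (2 * CARD('n)) * a \<le> C" shows "a \<le> C * decay x"
proof -
  have "0 < (1 + norm x) ^ (2 * CARD('n))" by (simp add: add_pos_nonneg)
  then show ?thesis using assms unfolding decay_def by (simp add: field_simps)
qed

text \<open>
  Comparison with a function that splits into coordinates makes both the integrability and the lattice
  summability of \<^const>\<open>decay\<close> one-dimensional statements.
\<close>

lemma decay_le_prod: "decay (x::real^'n::finite) \<le> (\<Prod>l\<in>UNIV. 1 / (1 + (x $ l)\<^sup>2))"
proof -
  have "decay x = (\<Prod>l\<in>(UNIV::'n set). 1 / (1 + norm x)\<^sup>2)"
    unfolding decay_def by (simp add: power_mult power_one_over)
  also have "\<dots> \<le> (\<Prod>l\<in>UNIV. 1 / (1 + (x $ l)\<^sup>2))"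
  proof (intro prod_mono conjI divide_left_mono)
    fix l
    have "(x $ l)\<^sup>2 \<le> (norm x)\<^sup>2" using component_le_norm_cart[of x l]
      by (metis abs_le_square_iff abs_norm_cancel)
    then show "1 + (x $ l)\<^sup>2 \<le> (1 + norm x)\<^sup>2"
      using norm_ge_zero[of x] unfolding power2_sum one_power2 by linarith
    show "0 < (1 + norm x)\<^sup>2 * (1 + (x $ l)\<^sup>2)"
      by (intro mult_pos_pos zero_less_power add_pos_nonneg) auto
  qed auto
  finally show ?thesis .
qed

lemma integrable_decay: "integrable lborel (decay :: real^'n::finite \<Rightarrow> real)"
proof -
  have 1: "integrable lborel (\<lambda>t::real. 1 / (1 + t\<^sup>2))"
    using integrable_inverse_1_plus_square by (simp add: set_integrable_def inverse_eq_divide)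
  have 2: "integrable lborel (\<lambda>x::real^'n. \<Prod>l\<in>UNIV. 1 / (1 + (x $ l)\<^sup>2))"
    by (rule lborel_integrable_prod[of "\<lambda>_ t. 1 / (1 + t\<^sup>2)"]) (rule 1)
  show ?thesis
  proof (rule Bochner_Integration.integrable_bound[OF 2])
    show "decay \<in> borel_measurable lborel" unfolding decay_def[abs_def] by measurable
    show "AE x in lborel. norm (decay x) \<le> norm (\<Prod>l\<in>UNIV. 1 / (1 + ((x::real^'n) $ l)\<^sup>2))"
      by (intro AE_I2, unfold real_norm_def, subst abs_of_pos[OF decay_pos])
        (rule order_trans[OF decay_le_prod abs_ge_self])
  qed
qed

lemma integrable_of_decay:
  fixes f :: "real^'n::finite \<Rightarrow> 'b::{banach,second_countable_topology}"
  assumes "f \<in> borel_measurable borel" "\<And>x. (1 + norm x) ^ (2 * CARD('n)) * norm (f x) \<le> C"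
  shows "integrable lborel f"
proof (rule Bochner_Integration.integrable_bound)
  show "integrable lborel (\<lambda>x::real^'n. C * decay x)" by (intro integrable_mult_right integrable_decay)
  show "AE x in lborel. norm (f x) \<le> norm (C * decay x)"
  proof (rule AE_I2)
    fix x
    have "norm (f x) \<le> C * decay x" using decay_le assms(2) by blast
    then show "norm (f x) \<le> norm (C * decay x)" by simp
  qed
qed (use assms in auto)

text \<open>
  Integration by parts without iterated integrals: the difference quotients of \<open>G\<close> have integral \<open>0\<close>
  by translation invariance, and they converge to the partial derivative under an integrable majorant.
\<close>

lemma integral_partial_eq_0:
  fixes G :: "real^'n::finite \<Rightarrow> complex"
  assumes diff: "\<And>x. G differentiable (at x)" and int: "integrable lborel G"
    and bound: "\<And>x. (1 + norm x) ^ (2 * CARD('n)) * norm (partial l G x) \<le> C"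
  shows "(LINT x|lborel. partial l G x) = 0"
proof -
  let ?e = "axis l (1::real) :: real^'n"
  (* A null sequence with values in (0, 1]; values at most 1 keep the shifted points within distance 1,
     where the decay is comparable. *)
  define t where "t = (\<lambda>k. 1 / real (Suc k))"
  have t: "0 < t k" "t k \<le> 1" for k unfolding t_def by auto
  have t0: "t \<longlonglongrightarrow> 0" unfolding t_def by (rule LIMSEQ_Suc[OF lim_1_over_n])
  define s where "s = (\<lambda>k x. (1 / t k) *\<^sub>R (G (t k *\<^sub>R ?e + x) - G x))"
  have [measurable]: "G \<in> borel_measurable borel"
    using borel_measurable_integrable[OF int] by simp
  have trans: "integrable lborel (\<lambda>x. G (a + x))" "(LINT x|lborel. G (a + x)) = (LINT x|lborel. G x)" for a
    using int by (auto simp: lborel_integral_translation lborel_integrable_translation)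
  have s0: "(LINT x|lborel. s k x) = 0" for k
    unfolding s_def using trans int by simp
  have s: "s k x = (1 / t k) *\<^sub>R (G (x + t k *\<^sub>R ?e) - G x)" for k x
    by (simp add: s_def add.commute)
  have "filterlim t (at 0) sequentially"
    unfolding filterlim_at using t0 t by (auto intro!: always_eventually simp: less_imp_neq[symmetric])
  then have lim: "(\<lambda>k. s k x) \<longlonglongrightarrow> partial l G x" for x
    unfolding s by (rule filterlim_compose[OF difference_quotient_tendsto[OF diff]])
  have bnd: "norm (s k x) \<le> 4 ^ CARD('n) * C * decay x" for k x
    unfolding s
  proof (rule difference_quotient_le[OF diff])
    fix r :: real assume r: "\<bar>r\<bar> \<le> \<bar>t k\<bar>"
    show "norm (partial l G (x + r *\<^sub>R ?e)) \<le> 4 ^ CARD('n) * C * decay x"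
    proof (rule decay_le)
      have "norm x \<le> norm (x + r *\<^sub>R ?e) + norm (r *\<^sub>R ?e)" by (metis add_diff_cancel norm_triangle_ineq4)
      moreover have "norm (r *\<^sub>R ?e) \<le> 1" using r t[of k] by simp
      moreover have "1 + a \<le> 2 * (1 + b)" if "a \<le> b + c" "c \<le> 1" "0 \<le> b" for a b c :: real
        using that by argo
      ultimately have "1 + norm x \<le> 2 * (1 + norm (x + r *\<^sub>R ?e))"
        using norm_ge_zero by blast
      then have "(1 + norm x) ^ (2 * CARD('n)) \<le> (2 * (1 + norm (x + r *\<^sub>R ?e))) ^ (2 * CARD('n))"
        by (intro power_mono) auto
      also have "\<dots> = 4 ^ CARD('n) * (1 + norm (x + r *\<^sub>R ?e)) ^ (2 * CARD('n))"
        by (subst power_mult_distrib) (simp add: power_mult)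
      finally have "(1 + norm x) ^ (2 * CARD('n)) * norm (partial l G (x + r *\<^sub>R ?e))
        \<le> 4 ^ CARD('n) * ((1 + norm (x + r *\<^sub>R ?e)) ^ (2 * CARD('n)) * norm (partial l G (x + r *\<^sub>R ?e)))"
        by (simp add: mult_right_mono flip: mult.assoc)
      also have "\<dots> \<le> 4 ^ CARD('n) * C" by (intro mult_left_mono bound) auto
      finally show "(1 + norm x) ^ (2 * CARD('n)) * norm (partial l G (x + r *\<^sub>R ?e)) \<le> 4 ^ CARD('n) * C" .
    qed
  qed (use t[of k] in simp)
  have m1[measurable]: "s k \<in> borel_measurable lborel" for k unfolding s_def by measurable
  have m2: "partial l G \<in> borel_measurable lborel"
    by (rule borel_measurable_LIMSEQ_metric[OF m1 lim])
  have "(\<lambda>k. LINT x|lborel. s k x) \<longlonglongrightarrow> (LINT x|lborel. partial l G x)"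
    by (rule integral_dominated_convergence[where w="\<lambda>x. 4 ^ CARD('n) * C * decay x"])
      (use m2 in \<open>auto simp: integrable_decay lim bnd\<close>)
  then show ?thesis by (simp add: s0 LIMSEQ_const_iff)
qed

section \<open>Schwartz functions\<close>

lemma schwartzI:
  assumes "smooth \<phi>" "\<And>K is. \<exists>C. \<forall>x. (1 + norm x) ^ K * norm (iter_partial is \<phi> x) \<le> C"
  shows "schwartz \<phi>"
  unfolding schwartz_def bounded_iff using assms by (auto simp: add_pos_nonneg)

lemma schwartzD:
  assumes "schwartz \<phi>" obtains C where "C \<ge> 0" "\<And>x. (1 + norm x) ^ K * norm (iter_partial is \<phi> x) \<le> C"
proof -
  obtain C where C: "\<And>x. norm ((1 + norm x) ^ K *\<^sub>R iter_partial is \<phi> x) \<le> C"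
    using assms unfolding schwartz_def bounded_iff by fastforce
  then have "0 \<le> C" using norm_ge_zero order_trans by blast
  moreover have "(1 + norm x) ^ K * norm (iter_partial is \<phi> x) \<le> C" for x
    using C[of x] by (simp add: abs_of_nonneg)
  ultimately show ?thesis using that by blast
qed

lemma schwartz_smooth: "schwartz \<phi> \<Longrightarrow> smooth \<phi>" by (simp add: schwartz_def)

lemma schwartz_differentiable: "schwartz \<phi> \<Longrightarrow> \<phi> differentiable (at x)"
  by (simp add: schwartz_smooth smooth_differentiable)

lemma schwartz_measurable: "schwartz \<phi> \<Longrightarrow> \<phi> \<in> borel_measurable borel"
  by (simp add: schwartz_smooth smooth_measurable)

lemma schwartz_iter_partial: "schwartz \<phi> \<Longrightarrow> schwartz (iter_partial is \<phi>)"
  unfolding schwartz_def by (metis iter_partial_append smooth_iter_partial)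

lemma schwartz_partial: "schwartz \<phi> \<Longrightarrow> schwartz (partial i \<phi>)"
  using schwartz_iter_partial[of \<phi> "[i]"] by simp

lemma schwartz_bounded:
  assumes "schwartz \<phi>" obtains C where "C \<ge> 0" "\<And>x. (1 + norm x) ^ K * norm (\<phi> x) \<le> C"
  using schwartzD[OF assms, of K "[]"] by auto

lemma schwartz_integrable: "schwartz \<phi> \<Longrightarrow> integrable lborel \<phi>"
  using integrable_of_decay[OF schwartz_measurable] schwartz_bounded by metis

lemma schwartz_add:
  assumes "schwartz f" "schwartz g" shows "schwartz (\<lambda>x. f x + g x)"
proof (rule schwartzI)
  fix K "is"
  obtain C where C: "\<And>x. (1 + norm x) ^ K * norm (iter_partial is f x) \<le> C" using schwartzD[OF assms(1)] by metis
  obtain D where D: "\<And>x. (1 + norm x) ^ K * norm (iter_partial is g x) \<le> D" using schwartzD[OF assms(2)] by metis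
  have "(1 + norm x) ^ K * norm (iter_partial is (\<lambda>x. f x + g x) x) \<le> C + D" for x
  proof -
    have "(1 + norm x) ^ K * norm (iter_partial is f x + iter_partial is g x)
      \<le> (1 + norm x) ^ K * (norm (iter_partial is f x) + norm (iter_partial is g x))"
      by (intro mult_left_mono norm_triangle_ineq) auto
    then show ?thesis using C[of x] D[of x]
      by (simp add: iter_partial_add schwartz_smooth assms distrib_left)
  qed
  then show "\<exists>C. \<forall>x. (1 + norm x) ^ K * norm (iter_partial is (\<lambda>x. f x + g x) x) \<le> C" by blast
qed (simp add: smooth_add assms schwartz_smooth)

lemma schwartz_cmult:
  assumes "schwartz f" shows "schwartz (\<lambda>x. c * f x)"
proof (rule schwartzI)
  fix K "is"
  obtain C where C: "\<And>x. (1 + norm x) ^ K * norm (iter_partial is f x) \<le> C" using schwartzD[OF assms(1)] by metis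
  have "(1 + norm x) ^ K * norm (iter_partial is (\<lambda>x. c * f x) x) \<le> norm c * C" for x
    using mult_left_mono[OF C[of x], of "norm c"]
    by (simp add: iter_partial_cmult schwartz_smooth assms norm_mult mult_ac)
  then show "\<exists>C. \<forall>x. (1 + norm x) ^ K * norm (iter_partial is (\<lambda>x. c * f x) x) \<le> C" by blast
qed (simp add: smooth_cmult assms schwartz_smooth)

lemma schwartz_zero: "schwartz (\<lambda>_. 0)"
  by (rule schwartzI) (auto simp: smooth_const iter_partial_zero)

lemma schwartz_sum:
  assumes "\<And>i. i \<in> I \<Longrightarrow> schwartz (f i)" shows "schwartz (\<lambda>x. \<Sum>i\<in>I. f i x)"
  using assms by (induction I rule: infinite_finite_induct) (auto intro: schwartz_zero schwartz_add)

lemma schwartz_diff: "schwartz f \<Longrightarrow> schwartz g \<Longrightarrow> schwartz (\<lambda>x. f x - g x)"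
  using schwartz_add[OF _ schwartz_cmult[of g "-1"]] by simp

lemma finite_lists_upto: "finite {is :: 'n::finite list. length is \<le> L}"
  using finite_lists_length_le[of "UNIV :: 'n set" L] by simp

text \<open>
  Multiplication by a smooth function all of whose derivatives grow at most polynomially. The finitely
  many constants and exponents for the derivatives up to the order in question are added up to uniform
  ones.
\<close>

lemma schwartz_mult:
  assumes u: "schwartz u" and v: "smooth v"
    and g: "\<And>is. \<exists>C N. \<forall>x. norm (iter_partial is v x) \<le> C * (1 + norm x) ^ N"
  shows "schwartz (\<lambda>x. u x * v x)"
proof (rule schwartzI)
  show "smooth (\<lambda>x. u x * v x)" using smooth_mult[OF schwartz_smooth[OF u] v] .
  fix K and "is" :: "'a list"
  let ?S = "{is' :: 'a list. length is' \<le> length is}"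
  obtain C N where CN: "\<And>is x. norm (iter_partial is v x) \<le> C is * (1 + norm x) ^ N is"
    using g by metis
  define C' N' where "C' = (\<Sum>is'\<in>?S. \<bar>C is'\<bar>)" and "N' = (\<Sum>is'\<in>?S. N is')"
  have V: "norm (iter_partial is' v x) \<le> C' * (1 + norm x) ^ N'" if "length is' \<le> length is" for is' x
  proof -
    have "\<bar>C is'\<bar> \<le> C'" unfolding C'_def by (rule member_le_sum) (use that finite_lists_upto in auto)
    moreover have "N is' \<le> N'" unfolding N'_def by (rule member_le_sum) (use that finite_lists_upto in auto)
    ultimately have "C is' * (1 + norm x) ^ N is' \<le> C' * (1 + norm x) ^ N'"
      by (intro mult_mono power_increasing) auto
    then show ?thesis using CN[of is' x] by linarith
  qed
  have "\<forall>is. \<exists>D. \<forall>x. (1 + norm x) ^ (K + N') * norm (iter_partial is u x) \<le> D"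
  proof
    fix "is"
    show "\<exists>D. \<forall>x. (1 + norm x) ^ (K + N') * norm (iter_partial is u x) \<le> D"
      by (rule schwartzD[OF u, of "K + N'" "is"]) blast
  qed
  from choice[OF this]
  obtain D where D: "\<And>is x. (1 + norm x) ^ (K + N') * norm (iter_partial is u x) \<le> D is" by blast
  define D' where "D' = (\<Sum>is'\<in>?S. \<bar>D is'\<bar>)"
  have U: "norm (iter_partial is' u x) \<le> D' / (1 + norm x) ^ (K + N')" if "length is' \<le> length is" for is' x
  proof -
    have "\<bar>D is'\<bar> \<le> D'" unfolding D'_def by (rule member_le_sum) (use that finite_lists_upto in auto)
    then have "(1 + norm x) ^ (K + N') * norm (iter_partial is' u x) \<le> D'" using D[of x is'] by linarith
    then show ?thesis by (simp add: field_simps add_pos_nonneg)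
  qed
  have "(1 + norm x) ^ K * norm (iter_partial is (\<lambda>x. u x * v x) x) \<le> 2 ^ length is * (D' * C')" for x
  proof -
    have p: "(1 + norm x) ^ k > 0" for k by (simp add: add_pos_nonneg)
    have "norm (iter_partial is (\<lambda>x. u x * v x) x) \<le>
      2 ^ length is * (D' / (1 + norm x) ^ (K + N') * (C' * (1 + norm x) ^ N'))"
      by (rule leibniz_bound) (use U V schwartz_smooth[OF u] v in auto)
    also have "\<dots> = 2 ^ length is * (D' * C') / (1 + norm x) ^ K"
      using less_imp_neq[OF p[of K], symmetric] less_imp_neq[OF p[of N'], symmetric]
      by (simp only: power_add) (simp del: power_eq_0_iff)
    finally show ?thesis using p[of K] by (simp add: pos_le_divide_eq mult.commute)
  qed
  then show "\<exists>C. \<forall>x. (1 + norm x) ^ K * norm (iter_partial is (\<lambda>x. u x * v x) x) \<le> C" by blast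
qed

lemma schwartz_coordinate_mult:
  assumes "schwartz u" shows "schwartz (\<lambda>x. u x * complex_of_real (x $ l))"
proof (rule schwartz_mult[OF assms smooth_coordinate])
  fix "is" :: "'a list"
  have c: "iter_partial js (\<lambda>_. c) = (\<lambda>_::real^'a. if js = [] then c else 0::complex)" for js c
    by (induction js) (auto intro!: ext partial_eqI[THEN trans, OF has_derivative_const])
  have "norm (iter_partial is (\<lambda>x. complex_of_real (x $ l)) x) \<le> 1 * (1 + norm x) ^ 1" for x
  proof (cases "is" rule: rev_cases)
    case Nil
    then show ?thesis using component_le_norm_cart[of x l] by simp
  next
    case (snoc js i)
    then show ?thesis by (auto simp: iter_partial_append partial_coordinate c add_nonneg_nonneg)
  qed
  then show "\<exists>C N. \<forall>x. norm (iter_partial is (\<lambda>x. complex_of_real (x $ l)) x) \<le> C * (1 + norm x) ^ N"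
    by blast
qed

lemma schwartz_compact_support:
  fixes \<phi> :: "real^'n::finite \<Rightarrow> complex"
  assumes "smooth \<phi>" "\<And>x. norm x > R \<Longrightarrow> \<phi> x = 0"
  shows "schwartz \<phi>"
proof (rule schwartzI[OF assms(1)])
  fix K and "is" :: "'n list"
  let ?f = "\<lambda>x. (1 + norm x) ^ K * norm (iter_partial is \<phi> x)"
  have "continuous_on (cball 0 R) ?f"
    by (intro continuous_intros smooth_continuous_on smooth_iter_partial assms)
  then have "bounded (?f ` cball 0 R)" 
    by (intro compact_imp_bounded compact_continuous_image) auto
  then obtain C where "\<forall>y\<in>?f ` cball 0 R. norm y \<le> C" unfolding bounded_iff by blast
  then have C: "\<And>x. norm x \<le> R \<Longrightarrow> norm (?f x) \<le> C" by auto
  have z: "iter_partial is \<phi> x = 0" if "norm x > R" for x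
  proof (rule iter_partial_eq_0[where S="{x. norm x > R}"])
    show "open {x::real^'n. R < norm x}" by (intro open_Collect_less continuous_intros)
  qed (use assms that in auto)
  have "?f x \<le> max C 0" for x
    using C[of x] z[of x] by (cases "norm x \<le> R") (auto simp: le_max_iff_disj)
  then show "\<exists>C. \<forall>x. ?f x \<le> C" by blast
qed

section \<open>The Fourier transform of a Schwartz function\<close>

text \<open>
  The character \<open>exp (\<i> a \<cdot> x)\<close>.
\<close>

definition wave :: "real^'n::finite \<Rightarrow> real^'n \<Rightarrow> complex" where
  "wave a x = exp (\<i> * complex_of_real (a \<bullet> x))"

text \<open>
  Without the factor \<open>(2\<pi>)\<^sup>-\<^sup>n\<^sup>/\<^sup>2\<close>; it reappears in the inversion formula as \<open>(2\<pi>)\<^sup>n\<close>.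
\<close>

definition fourier :: "(real^'n::finite \<Rightarrow> complex) \<Rightarrow> real^'n \<Rightarrow> complex" where
  "fourier \<phi> \<xi> = (LINT x|lborel. wave (- \<xi>) x * \<phi> x)"

lemma norm_wave [simp]: "norm (wave a x) = 1" by (simp add: wave_def)

lemma wave_0 [simp]: "wave 0 x = 1" by (simp add: wave_def)

lemma wave_commute: "wave a x = wave x a" by (simp add: wave_def inner_commute)

lemma wave_add: "wave (a + b) x = wave a x * wave b x"
  by (simp add: wave_def inner_add_left distrib_left exp_add)

lemma wave_add_right: "wave a (x + y) = wave a x * wave a y"
  by (simp add: wave_def inner_add_right distrib_left exp_add)

lemma wave_scale: "wave (c *\<^sub>R a) x = wave a (c *\<^sub>R x)"
  by (simp add: wave_def)

lemma wave_minus: "wave (- a) x = wave a (- x)"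
  by (simp add: wave_def)

lemma wave_measurable [measurable]: "wave a \<in> borel_measurable borel"
  unfolding wave_def[abs_def] by measurable

lemma continuous_on_wave: "continuous_on S (wave a)"
  unfolding wave_def[abs_def] by (intro continuous_intros)

lemma wave_has_derivative:
  "(wave a has_derivative (\<lambda>h. \<i> * complex_of_real (a \<bullet> h) * wave a x)) (at x)"
proof -
  have "((\<lambda>x. \<i> * complex_of_real (a \<bullet> x)) has_derivative (\<lambda>h. \<i> * complex_of_real (a \<bullet> h))) (at x)"
    by (intro bounded_linear_imp_has_derivative bounded_linear_const_mult
        bounded_linear_compose[OF bounded_linear_of_real] bounded_linear_inner_right)
  then show ?thesis unfolding wave_def[abs_def]
    using has_derivative_compose[OF _ DERIV_exp[unfolded has_field_derivative_def]] by (simp add: mult.commute)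
qed

lemma partial_wave: "partial l (wave a) = (\<lambda>x. \<i> * complex_of_real (a $ l) * wave a x)"
  by (rule ext) (simp add: partial_eqI[OF wave_has_derivative] inner_axis)

lemma wave_differentiable: "wave a differentiable (at x)"
  using wave_has_derivative unfolding differentiable_def by blast

lemma integrable_wave_mult:
  assumes "integrable lborel \<phi>" shows "integrable lborel (\<lambda>x. wave a x * \<phi> x)"
  by (rule Bochner_Integration.integrable_bound[OF assms])
    (use borel_measurable_integrable[OF assms] in \<open>auto simp: norm_mult\<close>)

text \<open>
  Integration by parts against a character, from \<open>integral_partial_eq_0\<close> for the product.
\<close>

lemma integral_wave_partial:
  assumes "schwartz H"
  shows "(LINT x|lborel. wave a x * partial l H x) = - \<i> * complex_of_real (a $ l) * (LINT x|lborel. wave a x * H x)"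
proof -
  let ?G = "\<lambda>x. wave a x * H x"
  have p: "partial l ?G x = \<i> * complex_of_real (a $ l) * (wave a x * H x) + wave a x * partial l H x" for x
    by (subst partial_mult) (auto simp: wave_differentiable schwartz_differentiable assms partial_wave)
  obtain C where C: "\<And>x. (1 + norm x) ^ (2 * CARD('a)) * norm (H x) \<le> C"
    using schwartz_bounded[OF assms] by metis
  obtain D where D: "\<And>x. (1 + norm x) ^ (2 * CARD('a)) * norm (partial l H x) \<le> D"
    using schwartz_bounded[OF schwartz_partial[OF assms]] by metis
  have "(LINT x|lborel. partial l ?G x) = 0"
  proof (rule integral_partial_eq_0)
    show "?G differentiable at x" for x
      by (intro differentiable_mult wave_differentiable schwartz_differentiable assms)
    show "integrable lborel ?G" by (intro integrable_wave_mult schwartz_integrable assms)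
    fix x :: "real^'a"
    let ?w = "(1 + norm x) ^ (2 * CARD('a))"
    have "?w * norm (partial l ?G x) \<le> ?w * (\<bar>a $ l\<bar> * norm (H x) + norm (partial l H x))"
      unfolding p by (intro mult_left_mono order_trans[OF norm_triangle_ineq]) (auto simp: norm_mult)
    also have "\<dots> \<le> \<bar>a $ l\<bar> * C + D"
      using mult_left_mono[OF C[of x], of "\<bar>a $ l\<bar>"] D[of x] by (simp add: distrib_left mult_ac)
    finally show "?w * norm (partial l ?G x) \<le> \<bar>a $ l\<bar> * C + D" .
  qed
  moreover have "(LINT x|lborel. partial l ?G x) =
      \<i> * complex_of_real (a $ l) * (LINT x|lborel. wave a x * H x) + (LINT x|lborel. wave a x * partial l H x)"
    unfolding p by (subst Bochner_Integration.integral_add)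
      (intro integrable_mult_right integrable_wave_mult schwartz_integrable assms schwartz_partial | simp)+
  ultimately show ?thesis by (simp add: add_eq_0_iff)
qed

lemma integral_wave_power_bound:
  assumes "schwartz H"
  shows "\<bar>a $ l\<bar> ^ M * norm (LINT x|lborel. wave a x * H x)
     \<le> (LINT x|lborel. norm (iter_partial (replicate M l) H x))"
proof -
  have eq: "\<bar>a $ l\<bar> ^ M * norm (LINT x|lborel. wave a x * H x) =
      norm (LINT x|lborel. wave a x * iter_partial (replicate M l) H x)"
  proof (induction M)
    case (Suc M)
    have "(LINT x|lborel. wave a x * iter_partial (replicate (Suc M) l) H x) =
       - \<i> * complex_of_real (a $ l) * (LINT x|lborel. wave a x * iter_partial (replicate M l) H x)"
      using integral_wave_partial[OF schwartz_iter_partial[OF assms]] by simp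
    then have "norm (LINT x|lborel. wave a x * iter_partial (replicate (Suc M) l) H x) =
       \<bar>a $ l\<bar> * norm (LINT x|lborel. wave a x * iter_partial (replicate M l) H x)"
      by (simp add: norm_mult)
    then show ?case by (simp add: Suc[symmetric])
  qed simp
  show ?thesis unfolding eq
    by (rule order_trans[OF integral_norm_bound]) (simp add: norm_mult)
qed

text \<open>
  Some coordinate carries a fixed proportion of the norm, so integration by parts in that direction
  alone yields decay in the full norm.
\<close>

lemma exists_large_component:
  fixes a :: "real^'n::finite"
  assumes "a \<noteq> 0"
  obtains l where "norm a \<le> real CARD('n) * \<bar>a $ l\<bar>"
proof -
  obtain l where l: "\<And>k. \<bar>a $ k\<bar> \<le> \<bar>a $ l\<bar>"
  proof -
    have "Max (range (\<lambda>k. \<bar>a $ k\<bar>)) \<in> range (\<lambda>k. \<bar>a $ k\<bar>)" by (rule Max_in) auto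
    then obtain l where "\<bar>a $ l\<bar> = Max (range (\<lambda>k. \<bar>a $ k\<bar>))" unfolding image_iff by metis
    then have "\<bar>a $ k\<bar> \<le> \<bar>a $ l\<bar>" for k by simp
    then show thesis by (rule that)
  qed
  have "norm a \<le> (\<Sum>k\<in>UNIV. \<bar>a $ k\<bar>)" by (rule norm_le_l1_cart)
  also have "\<dots> \<le> (\<Sum>k\<in>(UNIV::'n set). \<bar>a $ l\<bar>)" by (rule sum_mono) (rule l)
  finally show ?thesis using that[of l] by simp
qed

text \<open>
  Smoothness of \<open>H\<close> becomes decay in the frequency \<open>a\<close>. The same estimate gives the decay of a Fourier
  transform, of Fourier coefficients, and of the wavelet coefficients in the lattice point. The
  constant \<open>2 ^ M\<close> serves \<open>norm a \<le> 1\<close>, the other one the remaining \<open>a\<close>.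
\<close>

lemma integral_wave_decay:
  fixes H :: "real^'n::finite \<Rightarrow> complex"
  assumes "schwartz H"
    and "(LINT x|lborel. norm (H x)) \<le> B"
    and "\<And>l. (LINT x|lborel. norm (iter_partial (replicate M l) H x)) \<le> B"
  shows "(1 + norm a) ^ M * norm (LINT x|lborel. wave a x * H x) \<le> (2 ^ M + (2 * real CARD('n)) ^ M) * B"
proof -
  let ?I = "norm (LINT x|lborel. wave a x * H x)"
  have I0: "?I \<le> B"
    using integral_norm_bound[of lborel "\<lambda>x. wave a x * H x"] assms(2) by (simp add: norm_mult)
  have B: "0 \<le> B" using norm_ge_zero I0 by (rule order_trans)
  show ?thesis
  proof (cases "norm a \<le> 1")
    case True
    have "(1 + norm a) ^ M * ?I \<le> 2 ^ M * B"
      using True by (intro mult_mono power_mono I0) auto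
    also have "\<dots> \<le> (2 ^ M + (2 * real CARD('n)) ^ M) * B" using B by (intro mult_right_mono) auto
    finally show ?thesis .
  next
    case False
    then have "a \<noteq> 0" by auto
    then obtain l where l: "norm a \<le> real CARD('n) * \<bar>a $ l\<bar>" by (rule exists_large_component)
    have "(1 + norm a) ^ M * ?I \<le> (2 * real CARD('n) * \<bar>a $ l\<bar>) ^ M * ?I"
      using l False by (intro mult_right_mono power_mono) auto
    also have "\<dots> = (2 * real CARD('n)) ^ M * (\<bar>a $ l\<bar> ^ M * ?I)" by (simp add: power_mult_distrib)
    also have "\<dots> \<le> (2 * real CARD('n)) ^ M * B"
      by (intro mult_left_mono order_trans[OF integral_wave_power_bound[OF assms(1)] assms(3)]) auto
    also have "\<dots> \<le> (2 ^ M + (2 * real CARD('n)) ^ M) * B" using B by (intro mult_right_mono) auto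
    finally show ?thesis .
  qed
qed

lemma fourier_bounded:
  assumes "schwartz \<phi>"
  obtains C where "\<And>\<xi>. (1 + norm \<xi>) ^ M * norm (fourier \<phi> \<xi>) \<le> C"
proof -
  define B where "B = (LINT x|lborel. norm (\<phi> x)) + (\<Sum>l\<in>UNIV. LINT x|lborel. norm (iter_partial (replicate M l) \<phi> x))"
  have 1: "(LINT x|lborel. norm (\<phi> x)) \<le> B"
    unfolding B_def by (simp add: sum_nonneg)
  have 2: "(LINT x|lborel. norm (iter_partial (replicate M l) \<phi> x)) \<le> B" for l
    unfolding B_def
    by (rule order_trans[OF member_le_sum[of l UNIV "\<lambda>l. LINT x|lborel. norm (iter_partial (replicate M l) \<phi> x)"]]) auto
  show ?thesis
    by (rule that[of "(2 ^ M + (2 * real CARD('a)) ^ M) * B"])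
      (use integral_wave_decay[OF assms 1 2, of "- _"] in \<open>simp add: fourier_def\<close>)
qed

text \<open>
  Differentiation under the integral sign: the second order Taylor estimate for the exponential bounds
  the remainder by \<open>(norm h)\<^sup>2\<close> times an integral that converges since \<open>\<phi>\<close> absorbs \<open>(norm x)\<^sup>2\<close>.
\<close>

lemma fourier_has_derivative:
  assumes "schwartz \<phi>"
  shows "(fourier \<phi> has_derivative (\<lambda>h. LINT x|lborel. (- \<i> * complex_of_real (h \<bullet> x)) * (wave (- \<xi>) x
      * \<phi> x))) (at \<xi>)"
proof -
  let ?l = "\<lambda>h x. - \<i> * complex_of_real (h \<bullet> x)" and ?u = "\<lambda>x. wave (- \<xi>) x * \<phi> x"
  let ?D = "\<lambda>h. LINT x|lborel. ?l h x * ?u x"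
  have xi: "integrable lborel (\<lambda>x. complex_of_real (x $ l) * (wave a x * \<phi> x))" for l a
    using integrable_wave_mult[OF schwartz_integrable[OF schwartz_coordinate_mult[OF assms, of l]], of a]
    by (simp add: mult_ac)
  have hi: "integrable lborel (\<lambda>x. complex_of_real (h \<bullet> x) * (wave a x * \<phi> x))" for h a
  proof -
    have "(\<lambda>x. complex_of_real (h \<bullet> x) * (wave a x * \<phi> x)) =
      (\<lambda>x. \<Sum>l\<in>UNIV. complex_of_real (h $ l) * (complex_of_real (x $ l) * (wave a x * \<phi> x)))"
      by (simp add: inner_vec_def sum_distrib_right mult.assoc)
    then show ?thesis using xi by simp
  qed
  have lin: "bounded_linear ?D"
  proof (rule linear_conv_bounded_linear[THEN iffD1], rule linearI)
    fix h k :: "real^'a" and c :: real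
    have e: "- \<i> * complex_of_real (b \<bullet> x) * ?u x = - \<i> * (complex_of_real (b \<bullet> x) * ?u x)" for b x
      by (simp add: mult_ac)
    show "?D (h + k) =
      ?D h +
      ?D k"
      unfolding e using hi by (simp add: inner_add_left distrib_right distrib_left)
    show "?D (c *\<^sub>R h) =
      c *\<^sub>R ?D h"
      unfolding e by (simp add: mult.assoc) (simp add: scaleR_conv_of_real)
  qed
  (* Two powers beyond integrability absorb the quadratic Taylor remainder. *)
  obtain C where C: "\<And>x. (1 + norm x) ^ (2 * CARD('a) + 2) * norm (\<phi> x) \<le> C"
    using schwartz_bounded[OF assms] by metis
  have n2: "(norm x)\<^sup>2 * norm (\<phi> x) \<le> C * decay x" for x
  proof (rule decay_le)
    have "(1 + norm x) ^ (2 * CARD('a)) * ((norm x)\<^sup>2 * norm (\<phi> x))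
        \<le> (1 + norm x) ^ (2 * CARD('a)) * ((1 + norm x)\<^sup>2 * norm (\<phi> x))"
      by (intro mult_left_mono mult_right_mono power_mono) auto
    also have "\<dots> \<le> C" using C[of x] by (simp only: power_add mult.assoc)
    finally show "(1 + norm x) ^ (2 * CARD('a)) * ((norm x)\<^sup>2 * norm (\<phi> x)) \<le> C" .
  qed
  define D where "D = (LINT x|lborel. C * decay (x::real^'a))"
  have quad: "norm (fourier \<phi> (\<xi> + h) - fourier \<phi> \<xi> - ?D h)
      \<le> D * (norm h)\<^sup>2" for h
  proof -
    let ?r = "\<lambda>x. (wave (- h) x - 1 - ?l h x) * ?u x"
    have i1: "integrable lborel (\<lambda>x. wave (- h) x * ?u x)" "integrable lborel (\<lambda>x. wave (- \<xi>) x * \<phi> x)"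
      by (intro integrable_wave_mult schwartz_integrable assms)+
    have i2: "integrable lborel (\<lambda>x. ?l h x * ?u x)"
      using integrable_mult_right[OF hi[of h "- \<xi>"], of "- \<i>"] by (simp add: mult_ac)
    have eq: "fourier \<phi> (\<xi> + h) - fourier \<phi> \<xi> - ?D h
      = (LINT x|lborel. ?r x)"
    proof -
      have w: "wave (- (\<xi> + h)) x * \<phi> x = wave (- h) x * ?u x" for x
        using wave_add[of "- \<xi>" "- h" x] by (simp add: mult_ac)
      show ?thesis unfolding fourier_def w left_diff_distrib mult_1_left
        using i1 i2 by simp
    qed
    have ir: "integrable lborel ?r" unfolding left_diff_distrib mult_1_left
      using i1 i2 by (intro Bochner_Integration.integrable_diff)
    have rb: "norm (?r x) \<le> (norm h)\<^sup>2 * (C * decay x)" for x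
    proof -
      have "wave (- h) x - 1 - ?l h x = iexp (- (h \<bullet> x)) - (\<Sum>k\<le>1. (\<i> * complex_of_real (- (h \<bullet> x))) ^ k / fact k)"
        by (simp add: wave_def)
      then have "norm (wave (- h) x - 1 - ?l h x) \<le> \<bar>- (h \<bullet> x)\<bar> ^ Suc 1 / fact (Suc 1)"
        using iexp_approx1[of "- (h \<bullet> x)" 1] by (simp only:)
      also have "\<dots> = \<bar>h \<bullet> x\<bar>\<^sup>2 / 2" by (simp add: numeral_2_eq_2)
      also have "\<dots> \<le> \<bar>h \<bullet> x\<bar>\<^sup>2" by simp
      also have "\<dots> \<le> (norm h * norm x)\<^sup>2" by (intro power_mono Cauchy_Schwarz_ineq2) auto
      finally have *: "norm (wave (- h) x - 1 - ?l h x) \<le> (norm h * norm x)\<^sup>2" .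
      have "norm (?r x) = norm (wave (- h) x - 1 - ?l h x) * norm (\<phi> x)"
        by (simp add: norm_mult)
      also have "\<dots> \<le> (norm h * norm x)\<^sup>2 * norm (\<phi> x)"
        by (intro mult_right_mono *) auto
      also have "\<dots> = (norm h)\<^sup>2 * ((norm x)\<^sup>2 * norm (\<phi> x))" by (simp add: power_mult_distrib)
      also have "\<dots> \<le> (norm h)\<^sup>2 * (C * decay x)" by (intro mult_left_mono n2) auto
      finally show ?thesis .
    qed
    have "norm (LINT x|lborel. ?r x) \<le> (LINT x|lborel. norm (?r x))" by (rule integral_norm_bound)
    also have "\<dots> \<le> (LINT x|lborel. (norm h)\<^sup>2 * (C * decay (x::real^'a)))"
      by (intro integral_mono integrable_norm ir integrable_mult_right integrable_decay rb)
    also have "\<dots> = D * (norm h)\<^sup>2" by (simp add: D_def)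
    finally show ?thesis unfolding eq .
  qed
  have "((\<lambda>h. norm (fourier \<phi> (\<xi> + h) - fourier \<phi> \<xi> - ?D h) / norm h) \<longlongrightarrow> 0) (at 0)"
  proof (rule Lim_null_comparison)
    show "\<forall>\<^sub>F h in at 0. norm (norm (fourier \<phi> (\<xi> + h) - fourier \<phi> \<xi> - ?D h) / norm h) \<le> D * norm h"
      using quad by (intro eventually_at_filter[THEN iffD2] always_eventually)
        (auto simp: divide_le_eq power2_eq_square mult.assoc)
    show "((\<lambda>h. D * norm h) \<longlongrightarrow> 0) (at (0::real^'a))"
      by (rule tendsto_eq_intros refl | simp)+
  qed
  then show ?thesis unfolding has_derivative_at using lin by blast
qed

lemma partial_fourier:
  assumes "schwartz \<phi>"
  shows "partial l (fourier \<phi>) = fourier (\<lambda>x. - \<i> * (\<phi> x * complex_of_real (x $ l)))"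
  by (rule ext, subst partial_eqI[OF fourier_has_derivative[OF assms]])
    (simp add: fourier_def inner_axis' mult_ac del: integral_mult_right_zero integral_mult_left_zero Bochner_Integration.integral_minus)

text \<open>
  Every derivative of a Fourier transform is the Fourier transform of another Schwartz function, and
  Fourier transforms of Schwartz functions decay rapidly.
\<close>

lemma schwartz_fourier:
  assumes "schwartz \<phi>" shows "schwartz (fourier \<phi>)"
proof -
  have p: "\<exists>\<psi>. schwartz \<psi> \<and> partial i (fourier \<phi>) = fourier \<psi>" if "schwartz \<phi>" for \<phi> :: "real^'a \<Rightarrow> complex" and i
    using partial_fourier[OF that] schwartz_cmult[OF schwartz_coordinate_mult[OF that]] by blast
  show ?thesis
  proof (rule schwartzI)
    show "smooth (fourier \<phi>)"
    proof (rule smooth_coinduct[where P = "\<lambda>f. \<exists>\<psi>. schwartz \<psi> \<and> f = fourier \<psi>"])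
      show "\<exists>\<psi>. schwartz \<psi> \<and> fourier \<phi> = fourier \<psi>" using assms by blast
    next
      fix g :: "real^'a \<Rightarrow> complex" and x assume "\<exists>\<psi>. schwartz \<psi> \<and> g = fourier \<psi>"
      then show "g differentiable at x" using fourier_has_derivative unfolding differentiable_def by blast
    next
      fix g :: "real^'a \<Rightarrow> complex" and i assume "\<exists>\<psi>. schwartz \<psi> \<and> g = fourier \<psi>"
      then show "\<exists>\<psi>. schwartz \<psi> \<and> partial i g = fourier \<psi>" using p by blast
    qed
    fix K and "is" :: "'a list"
    have "\<exists>\<psi>. schwartz \<psi> \<and> iter_partial is (fourier \<phi>) = fourier \<psi>"
    proof (induction "is")
      case Nil
      then show ?case using assms by auto
    next
      case (Cons i "is")
      then show ?case using p by auto
    qed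
    then obtain \<psi> where psi: "schwartz \<psi>" "iter_partial is (fourier \<phi>) = fourier \<psi>" by blast
    obtain C where "\<And>\<xi>. (1 + norm \<xi>) ^ K * norm (fourier \<psi> \<xi>) \<le> C" using fourier_bounded[OF psi(1)] by metis
    then show "\<exists>C. \<forall>x. (1 + norm x) ^ K * norm (iter_partial is (fourier \<phi>) x) \<le> C"
      unfolding psi(2) by blast
  qed
qed

section \<open>Fourier inversion\<close>

text \<open>
  The form of Fubini's theorem that Fourier analysis needs: two integrable functions of separate
  variables coupled by a bounded kernel.
\<close>

lemma fubini_bounded_kernel:
  fixes f g :: "real^'n::finite \<Rightarrow> complex"
  assumes f: "integrable lborel f" and g: "integrable lborel g"
    and k: "(\<lambda>(x, y). k x y) \<in> borel_measurable (borel \<Otimes>\<^sub>M borel)" and b: "\<And>x y. norm (k x y) \<le> 1"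
  shows "(LINT y|lborel. LINT x|lborel. k x y * f x * g y) = (LINT x|lborel. LINT y|lborel. k x y * f x * g y)"
proof -
  have [measurable]: "f \<in> borel_measurable borel" "g \<in> borel_measurable borel"
    using borel_measurable_integrable[OF f] borel_measurable_integrable[OF g] by simp_all
  note k[measurable]
  have fg: "integrable (lborel \<Otimes>\<^sub>M lborel) (\<lambda>(x, y). f x * g y)"
  proof (rule lborel_pair.Fubini_integrable)
    show "(\<lambda>(x, y). f x * g y) \<in> borel_measurable (lborel \<Otimes>\<^sub>M lborel)" by measurable
    show "integrable lborel (\<lambda>x. LINT y|lborel. norm (case (x, y) of (x, y) \<Rightarrow> f x * g y))"
      using integrable_norm[OF f] by (simp add: norm_mult)
    show "AE x in lborel. integrable lborel (\<lambda>y. case (x, y) of (x, y) \<Rightarrow> f x * g y)"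
      using g by simp
  qed
  have "integrable (lborel \<Otimes>\<^sub>M lborel) (\<lambda>(x, y). k x y * f x * g y)"
  proof (rule Bochner_Integration.integrable_bound[OF fg])
    have "(\<lambda>(x, y). k x y) \<in> borel_measurable (lborel \<Otimes>\<^sub>M lborel)" using k by simp
    then have [measurable]: "(\<lambda>z. k (fst z) (snd z)) \<in> borel_measurable (lborel \<Otimes>\<^sub>M lborel)"
      by (simp add: case_prod_beta')
    have "(\<lambda>z. k (fst z) (snd z) * f (fst z) * g (snd z)) \<in> borel_measurable (lborel \<Otimes>\<^sub>M lborel)"
      by measurable
    then show "(\<lambda>(x, y). k x y * f x * g y) \<in> borel_measurable (lborel \<Otimes>\<^sub>M lborel)"
      by (simp add: case_prod_beta')
    have "norm (k x y * f x * g y) \<le> norm (f x * g y)" for x y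
      using mult_right_mono[OF b[of x y], of "norm (f x * g y)"] by (simp add: norm_mult mult.assoc)
    then show "AE z in lborel \<Otimes>\<^sub>M lborel. norm (case z of (x, y) \<Rightarrow> k x y * f x * g y)
        \<le> norm (case z of (x, y) \<Rightarrow> f x * g y)"
      by auto
  qed
  then show ?thesis by (rule lborel_pair.Fubini_integral)
qed

definition gauss :: "real^'n::finite \<Rightarrow> complex" where
  "gauss x = complex_of_real (exp (- (norm x)\<^sup>2 / 2))"

lemma gauss_prod: "gauss x = (\<Prod>l\<in>UNIV. complex_of_real (exp (- (x $ l)\<^sup>2 / 2)))"
proof -
  have "(norm x)\<^sup>2 = (\<Sum>l\<in>UNIV. (x $ l)\<^sup>2)"
    by (simp add: norm_vec_def L2_set_def sum_nonneg)
  then show ?thesis unfolding gauss_def of_real_prod[symmetric] exp_sum[OF finite, symmetric]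
    by (simp add: sum_negf sum_divide_distrib)
qed

text \<open>
  A restatement of the characteristic function of the normal distribution.
\<close>

lemma gauss_fourier_real:
  fixes t :: real
  shows "integrable lborel (\<lambda>x. iexp (t * x) * complex_of_real (exp (- x\<^sup>2 / 2)))"
    and "(LINT x|lborel. iexp (t * x) * complex_of_real (exp (- x\<^sup>2 / 2)))
        = complex_of_real (sqrt (2 * pi) * exp (- t\<^sup>2 / 2))"
proof -
  have e: "complex_of_real (exp (- x\<^sup>2 / 2)) = complex_of_real (sqrt (2 * pi))
      * complex_of_real (std_normal_density x)" for x
    unfolding std_normal_density_def of_real_mult[symmetric] by (intro arg_cong[where f=complex_of_real]) simp
  have i: "integrable lborel (\<lambda>x. iexp (t * x) * complex_of_real (std_normal_density x))"
    by (rule Bochner_Integration.integrable_bound[where f="\<lambda>x. std_normal_density x"])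
      (auto simp: norm_mult integrable_normal_density)
  show "integrable lborel (\<lambda>x. iexp (t * x) * complex_of_real (exp (- x\<^sup>2 / 2)))"
    unfolding e using integrable_mult_right[OF i, of "complex_of_real (sqrt (2 * pi))"] by (simp add: mult_ac)
  have "char std_normal_distribution t = (LINT x|lborel. std_normal_density x *\<^sub>R iexp (t * x))"
    unfolding char_def by (subst integral_density) auto
  then have c: "(LINT x|lborel. iexp (t * x) * complex_of_real (std_normal_density x))
      = complex_of_real (exp (- t\<^sup>2 / 2))"
    unfolding char_std_normal_distribution by (simp add: scaleR_conv_of_real mult.commute)
  have "(LINT x|lborel. iexp (t * x) * complex_of_real (exp (- x\<^sup>2 / 2))) =
    (LINT x|lborel. complex_of_real (sqrt (2 * pi)) * (iexp (t * x) * complex_of_real (std_normal_density x)))"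
    unfolding e by (simp only: mult_ac)
  also have "\<dots> = complex_of_real (sqrt (2 * pi) * exp (- t\<^sup>2 / 2))"
    unfolding integral_mult_right_zero c by simp
  finally show "(LINT x|lborel. iexp (t * x) * complex_of_real (exp (- x\<^sup>2 / 2)))
      = complex_of_real (sqrt (2 * pi) * exp (- t\<^sup>2 / 2))" .
qed

lemma gauss_fourier:
  fixes a :: "real^'n::finite"
  shows "integrable lborel (\<lambda>x. wave a x * gauss x)"
    and "(LINT x|lborel. wave a x * gauss x) = complex_of_real (sqrt (2 * pi) ^ CARD('n)) * gauss a"
proof -
  have w: "wave a x * gauss x = (\<Prod>l\<in>UNIV. iexp (a $ l * x $ l) * complex_of_real (exp (- (x $ l)\<^sup>2 / 2)))" for x
    unfolding gauss_prod prod.distrib wave_def inner_vec_def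
    by (simp add: exp_sum[symmetric] sum_distrib_left)
  show "integrable lborel (\<lambda>x. wave a x * gauss x)"
    unfolding w by (rule lborel_integrable_prod[of "\<lambda>l t. iexp (a $ l * t)
        * complex_of_real (exp (- t\<^sup>2 / 2))"]) (rule gauss_fourier_real)
  show "(LINT x|lborel. wave a x * gauss x) = complex_of_real (sqrt (2 * pi) ^ CARD('n)) * gauss a"
    unfolding w
    by (subst lborel_integral_prod[of "\<lambda>l t. iexp (a $ l * t) * complex_of_real (exp (- t\<^sup>2 / 2))"])
      (rule gauss_fourier_real(1), simp only: gauss_fourier_real(2), simp only: of_real_mult prod.distrib gauss_prod of_real_power prod_constant)
qed

lemma gauss_integrable: "integrable lborel gauss"
  using gauss_fourier(1)[of 0] by simp

lemma gauss_integral: "(LINT x|lborel. gauss (x::real^'n::finite)) = complex_of_real (sqrt (2 * pi) ^ CARD('n))"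
  using gauss_fourier(2)[of "0::real^'n"] unfolding gauss_def by simp

lemma gauss_measurable [measurable]: "gauss \<in> borel_measurable borel"
  using borel_measurable_integrable[OF gauss_integrable] by simp

lemma norm_gauss_le: "norm (gauss x) \<le> 1" by (simp add: gauss_def)

text \<open>
  Gaussian regularisation. Inserting \<open>gauss (t \<xi>)\<close> makes the double integral absolutely convergent;
  exchanging the integrals and rescaling turns it into an average of \<open>\<phi>\<close> near \<open>x\<close> with Gaussian
  weights of width \<open>t\<close>. Both sides converge by dominated convergence as \<open>t\<close> tends to \<open>0\<close>.
\<close>

theorem fourier_inversion:
  fixes \<phi> :: "real^'n::finite \<Rightarrow> complex"
  assumes "schwartz \<phi>"
  shows "(LINT \<xi>|lborel. wave x \<xi> * fourier \<phi> \<xi>) = complex_of_real ((2 * pi) ^ CARD('n)) * \<phi> x"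
proof -
  let ?s = "complex_of_real (sqrt (2 * pi) ^ CARD('n))"
  define t where "t = (\<lambda>k. 1 / real (Suc k))"
  have t: "0 < t k" for k unfolding t_def by auto
  have t0: "t \<longlonglongrightarrow> 0" unfolding t_def by (rule LIMSEQ_Suc[OF lim_1_over_n])
  have [measurable]: "\<phi> \<in> borel_measurable borel" "fourier \<phi> \<in> borel_measurable borel"
    using schwartz_measurable[OF assms] schwartz_measurable[OF schwartz_fourier[OF assms]] by auto
  have ip: "integrable lborel \<phi>" "integrable lborel (fourier \<phi>)"
    using schwartz_integrable[OF assms] schwartz_integrable[OF schwartz_fourier[OF assms]] by auto
  define A where "A = (\<lambda>k. LINT \<xi>|lborel. gauss (t k *\<^sub>R \<xi>) * (wave x \<xi> * fourier \<phi> \<xi>))"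
  have lim1: "A \<longlonglongrightarrow> (LINT \<xi>|lborel. wave x \<xi> * fourier \<phi> \<xi>)" unfolding A_def
  proof (rule integral_dominated_convergence[where w="\<lambda>\<xi>. norm (fourier \<phi> \<xi>)"])
    show "AE \<xi> in lborel. (\<lambda>k. gauss (t k *\<^sub>R \<xi>) * (wave x \<xi> * fourier \<phi> \<xi>)) \<longlonglongrightarrow> wave x \<xi> * fourier \<phi> \<xi>"
    proof (rule AE_I2)
      fix \<xi> :: "real^'n"
      have "(\<lambda>k. gauss (t k *\<^sub>R \<xi>)) \<longlonglongrightarrow> complex_of_real (exp (- (norm (0 *\<^sub>R \<xi>))\<^sup>2 / 2))"
        unfolding gauss_def by (intro tendsto_intros t0) auto
      from tendsto_mult[OF this tendsto_const[of "wave x \<xi> * fourier \<phi> \<xi>"]]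
      show "(\<lambda>k. gauss (t k *\<^sub>R \<xi>) * (wave x \<xi> * fourier \<phi> \<xi>)) \<longlonglongrightarrow> wave x \<xi> * fourier \<phi> \<xi>" by simp
    qed
    show "AE \<xi> in lborel. norm (gauss (t k *\<^sub>R \<xi>) * (wave x \<xi> * fourier \<phi> \<xi>)) \<le> norm (fourier \<phi> \<xi>)" for k
      by (rule AE_I2) (simp add: norm_mult mult_left_le_one_le norm_gauss_le)
  qed (use ip in \<open>auto\<close>)
  have A: "A k = (LINT z|lborel. \<phi> (x + t k *\<^sub>R z) * (?s * gauss z))" for k
  proof -
    have tn: "t k \<noteq> 0" using t[of k] by simp
    have gi: "integrable lborel (\<lambda>\<xi>::real^'n. gauss (t k *\<^sub>R \<xi>))"
      by (subst lborel_integrable_scaling[OF gauss_measurable tn]) (rule gauss_integrable)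
    define h where "h = (\<lambda>y::real^'n. LINT \<xi>|lborel. wave (- y) \<xi> * gauss (t k *\<^sub>R \<xi>))"
    have "A k = (LINT \<xi>|lborel. LINT y|lborel. wave (x - y) \<xi> * \<phi> y * gauss (t k *\<^sub>R \<xi>))"
    proof -
      have w: "gauss (t k *\<^sub>R \<xi>) * (wave x \<xi> * fourier \<phi> \<xi>)
          = (LINT y|lborel. wave (x - y) \<xi> * \<phi> y * gauss (t k *\<^sub>R \<xi>))" for \<xi>
      proof -
        have w: "wave (x - y) \<xi> * \<phi> y * gauss (t k *\<^sub>R \<xi>) = gauss (t k *\<^sub>R \<xi>) * wave x \<xi> * (wave (- \<xi>) y * \<phi> y)" for y
          using wave_add[of x "- y" \<xi>] by (simp add: wave_commute[of "- \<xi>" y] wave_minus[of y \<xi>])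
        show ?thesis unfolding w integral_mult_right_zero fourier_def by (simp add: mult.assoc)
      qed
      show ?thesis unfolding A_def w ..
    qed
    also have "\<dots> = (LINT y|lborel. LINT \<xi>|lborel. wave (x - y) \<xi> * \<phi> y * gauss (t k *\<^sub>R \<xi>))"
      by (rule fubini_bounded_kernel[OF ip(1) gi]) (auto simp: wave_def[abs_def])
    also have "\<dots> = (LINT y|lborel. h (y - x) * \<phi> y)"
    proof (rule Bochner_Integration.integral_cong[OF refl])
      fix y
      have "wave (x - y) \<xi> * \<phi> y * gauss (t k *\<^sub>R \<xi>) = (wave (- (y - x)) \<xi> * gauss (t k *\<^sub>R \<xi>)) * \<phi> y" for \<xi>
        by simp
      then show "(LINT \<xi>|lborel. wave (x - y) \<xi> * \<phi> y * gauss (t k *\<^sub>R \<xi>)) = h (y - x) * \<phi> y"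
        unfolding h_def by (simp only: integral_mult_left_zero)
    qed
    also have "\<dots> = (LINT y|lborel. h y * \<phi> (x + y))"
    proof -
      have [measurable]: "h \<in> borel_measurable borel"
        unfolding h_def wave_def by measurable
      show ?thesis
        using lborel_integral_translation[of "\<lambda>y. h (y - x) * \<phi> y" x] by simp
    qed
    also have "\<dots> = \<bar>t k\<bar> ^ CARD('n) *\<^sub>R (LINT z|lborel. h (t k *\<^sub>R z) * \<phi> (x + t k *\<^sub>R z))"
    proof -
      have [measurable]: "h \<in> borel_measurable borel"
        unfolding h_def wave_def by measurable
      show ?thesis
        by (subst lborel_integral_scaling[OF _ tn, of "\<lambda>z. h z * \<phi> (x + z)"]) auto
    qed
    also have "\<dots> = (LINT z|lborel. \<phi> (x + t k *\<^sub>R z) * (\<bar>t k\<bar> ^ CARD('n) *\<^sub>R h (t k *\<^sub>R z)))"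
      by (simp add: integral_scaleR_right[symmetric] mult.commute del: integral_scaleR_right)
    also have "(\<lambda>z. \<bar>t k\<bar> ^ CARD('n) *\<^sub>R h (t k *\<^sub>R z)) = (\<lambda>z. ?s * gauss z)"
    proof
      fix z
      have "h (t k *\<^sub>R z) = (LINT \<xi>|lborel. wave (- z) (t k *\<^sub>R \<xi>) * gauss (t k *\<^sub>R \<xi>))"
        unfolding h_def by (simp add: wave_scale[symmetric])
      then have "\<bar>t k\<bar> ^ CARD('n) *\<^sub>R h (t k *\<^sub>R z) = (LINT \<xi>|lborel. wave (- z) \<xi> * gauss \<xi>)"
        using lborel_integral_scaling[OF _ tn, of "\<lambda>\<xi>. wave (- z) \<xi> * gauss \<xi>"] by simp
      then show "\<bar>t k\<bar> ^ CARD('n) *\<^sub>R h (t k *\<^sub>R z) = ?s * gauss z"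
        unfolding gauss_fourier by (simp add: gauss_def)
    qed
    finally show ?thesis .
  qed
  have lim2: "A \<longlonglongrightarrow> (LINT z|lborel. \<phi> x * (?s * gauss (z::real^'n)))" unfolding A
  proof -
    obtain C where C: "\<And>x. norm (\<phi> x) \<le> C" using schwartz_bounded[OF assms, of 0] by auto
    show "(\<lambda>k. LINT z|lborel. \<phi> (x + t k *\<^sub>R z) * (?s * gauss z)) \<longlonglongrightarrow>
      (LINT z|lborel. \<phi> x * (?s * gauss (z::real^'n)))"
    proof (rule integral_dominated_convergence[where w="\<lambda>z. C * norm (?s * gauss z)"])
      show "AE z in lborel. (\<lambda>k. \<phi> (x + t k *\<^sub>R z) * (?s * gauss z)) \<longlonglongrightarrow> \<phi> x * (?s * gauss z)"
      proof (rule AE_I2)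
        fix z :: "real^'n"
        have "(\<lambda>k. x + t k *\<^sub>R z) \<longlonglongrightarrow> x + 0 *\<^sub>R z" by (intro tendsto_intros t0)
        then have "(\<lambda>k. \<phi> (x + t k *\<^sub>R z)) \<longlonglongrightarrow> \<phi> (x + 0 *\<^sub>R z)"
          by (rule continuous_on_tendsto_compose[OF smooth_continuous_on[OF schwartz_smooth[OF assms], of UNIV]]) simp_all
        then have "(\<lambda>k. \<phi> (x + t k *\<^sub>R z)) \<longlonglongrightarrow> \<phi> x" by simp
        then show "(\<lambda>k. \<phi> (x + t k *\<^sub>R z) * (?s * gauss z)) \<longlonglongrightarrow> \<phi> x * (?s * gauss z)"
          by (rule tendsto_mult[OF _ tendsto_const])
      qed
      show "AE z in lborel. norm (\<phi> (x + t k *\<^sub>R z) * (?s * gauss z)) \<le> C * norm (?s * gauss z)" for k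
        unfolding norm_mult[of "\<phi> _"] by (intro AE_I2 mult_right_mono C) auto
      show "integrable lborel (\<lambda>z::real^'n. C * norm (?s * gauss z))"
        by (intro integrable_mult_right integrable_norm gauss_integrable)
    qed measurable
  qed
  have "(LINT z|lborel. \<phi> x * (?s * gauss (z::real^'n))) = complex_of_real ((2 * pi) ^ CARD('n)) * \<phi> x"
  proof -
    have "sqrt (2 * pi) ^ CARD('n) * sqrt (2 * pi) ^ CARD('n) = (2 * pi) ^ CARD('n)"
      unfolding power_mult_distrib[symmetric] by simp
    then have "?s * ?s = complex_of_real ((2 * pi) ^ CARD('n))"
      unfolding of_real_mult[symmetric] by simp
    then show ?thesis unfolding integral_mult_right_zero gauss_integral by (simp only: mult.commute)
  qed
  with LIMSEQ_unique[OF lim1 lim2] show ?thesis by simp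
qed

section \<open>Unordered sums\<close>

text \<open>
  The remainder of a dominated sum is at most the remainder of the majorant. This is the quantitative
  form of absolute convergence behind every exchange of limits with sums below.
\<close>

lemma norm_has_sum_tail_le:
  fixes f :: "'i \<Rightarrow> 'b::banach"
  assumes f: "(f has_sum S) UNIV" and b: "(b has_sum T) UNIV" and le: "\<And>i. norm (f i) \<le> b i" and A: "finite A"
  shows "norm (S - sum f A) \<le> T - sum b A"
proof (rule norm_infsum_le)
  have *: "(g has_sum (s - sum g A)) (- A)" if "(g has_sum s) UNIV" for g :: "'i \<Rightarrow> 'c::banach" and s
    using has_sum_Diff[OF that has_sum_finite[OF A]] by (simp add: Compl_eq_Diff_UNIV)
  show "(f has_sum (S - sum f A)) (- A)" "(b has_sum (T - sum b A)) (- A)" using *[OF f] *[OF b] by auto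
qed (rule le)

text \<open>
  Termwise integration under a majorant that splits into a summable and an integrable factor.
\<close>

lemma has_sum_integral:
  fixes f :: "'i \<Rightarrow> 'a \<Rightarrow> 'b::{banach, second_countable_topology}"
  assumes f: "\<And>i. integrable M (f i)" and B: "B summable_on UNIV" and g: "integrable M g"
    and le: "\<And>i x. norm (f i x) \<le> B i * g x"
    and F: "\<And>x. ((\<lambda>i. f i x) has_sum F x) UNIV" and meas: "F \<in> borel_measurable M"
  shows "((\<lambda>i. integral\<^sup>L M (f i)) has_sum integral\<^sup>L M F) UNIV"
proof -
  define T where "T = infsum B UNIV"
  have T: "(B has_sum T) UNIV" unfolding T_def using B by (rule has_sum_infsum)
  have tail: "norm (F x - (\<Sum>i\<in>A. f i x)) \<le> (T - sum B A) * g x" if "finite A" for A x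
    using norm_has_sum_tail_le[OF F[of x] has_sum_cmult_left[OF T, of "g x"] le that]
    by (simp add: left_diff_distrib sum_distrib_right)
  have iF: "integrable M F"
  proof (rule Bochner_Integration.integrable_bound)
    show "integrable M (\<lambda>x. T * g x)" using g by simp
    show "AE x in M. norm (F x) \<le> norm (T * g x)"
      using tail[of "{}"] by (intro AE_I2) (smt (verit) diff_zero finite.emptyI real_norm_def sum.empty)
  qed (rule meas)
  have "((\<lambda>A. (\<Sum>i\<in>A. integral\<^sup>L M (f i)) - integral\<^sup>L M F) \<longlongrightarrow> 0) (finite_subsets_at_top UNIV)"
  proof (rule Lim_null_comparison)
    show "\<forall>\<^sub>F A in finite_subsets_at_top UNIV. norm ((\<Sum>i\<in>A. integral\<^sup>L M (f i)) - integral\<^sup>L M F)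
        \<le> (T - sum B A) * integral\<^sup>L M g"
    proof (rule eventually_finite_subsets_at_top_weakI)
      fix A :: "'i set" assume A: "finite A"
      have "norm ((\<Sum>i\<in>A. integral\<^sup>L M (f i)) - integral\<^sup>L M F) = norm (LINT x|M. F x - (\<Sum>i\<in>A. f i x))"
        using f iF by (simp add: norm_minus_commute Bochner_Integration.integral_sum Bochner_Integration.integral_diff)
      also have "\<dots> \<le> (LINT x|M. norm (F x - (\<Sum>i\<in>A. f i x)))" by (rule integral_norm_bound)
      also have "\<dots> \<le> (LINT x|M. (T - sum B A) * g x)"
        by (intro integral_mono integrable_norm Bochner_Integration.integrable_diff iF Bochner_Integration.integrable_sum f
            integrable_mult_right g tail A)
      also have "\<dots> = (T - sum B A) * integral\<^sup>L M g" by simp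
      finally show "norm ((\<Sum>i\<in>A. integral\<^sup>L M (f i)) - integral\<^sup>L M F) \<le> (T - sum B A) * integral\<^sup>L M g" .
    qed
    have "((\<lambda>A. (T - sum B A) * integral\<^sup>L M g) \<longlongrightarrow> (T - T) * integral\<^sup>L M g) (finite_subsets_at_top UNIV)"
      using T unfolding has_sum_def by (intro tendsto_intros)
    then show "((\<lambda>A. (T - sum B A) * integral\<^sup>L M g) \<longlongrightarrow> 0) (finite_subsets_at_top UNIV)" by simp
  qed
  then show ?thesis unfolding has_sum_def by (simp add: Lim_null[symmetric])
qed

text \<open>
  A finite set of vectors lies in the box spanned by its coordinate projections, and over a box the sum
  of products is the product of the sums.
\<close>

lemma summable_on_prod_vec:
  fixes f :: "'n::finite \<Rightarrow> 'a \<Rightarrow> real"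
  assumes nn: "\<And>l y. 0 \<le> f l y" and s: "\<And>l. f l summable_on UNIV"
  shows "(\<lambda>m::'a^'n. \<Prod>l\<in>UNIV. f l (m $ l)) summable_on UNIV"
proof (rule nonneg_bdd_above_summable_on)
  show "bdd_above (sum (\<lambda>m::'a^'n. \<Prod>l\<in>UNIV. f l (m $ l)) ` {F. F \<subseteq> UNIV \<and> finite F})"
  proof (rule bdd_aboveI2)
    fix F :: "('a^'n) set" assume "F \<in> {F. F \<subseteq> UNIV \<and> finite F}"
    then have F: "finite F" by simp
    let ?P = "PiE UNIV (\<lambda>l. (\<lambda>m. m $ l) ` F)"
    have inj: "inj_on vec_nth F" by (auto simp: inj_on_def vec_nth_inject)
    have "sum (\<lambda>m. \<Prod>l\<in>UNIV. f l (m $ l)) F = sum (\<lambda>h. \<Prod>l\<in>UNIV. f l (h l)) (vec_nth ` F)"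
      by (subst sum.reindex[OF inj]) simp
    also have "\<dots> \<le> sum (\<lambda>h. \<Prod>l\<in>UNIV. f l (h l)) ?P"
      by (rule sum_mono2) (auto intro!: finite_PiE prod_nonneg F nn)
    also have "\<dots> = (\<Prod>l\<in>UNIV. \<Sum>y\<in>(\<lambda>m. m $ l) ` F. f l y)"
      by (subst prod_sum_PiE) (auto simp: F)
    also have "\<dots> \<le> (\<Prod>l\<in>UNIV. infsum (f l) UNIV)"
      by (intro prod_mono conjI sum_nonneg nn finite_sum_le_infsum s) (auto simp: F)
    finally show "sum (\<lambda>m. \<Prod>l\<in>UNIV. f l (m $ l)) F \<le> (\<Prod>l\<in>UNIV. infsum (f l) UNIV)" .
  qed
qed (auto intro!: prod_nonneg nn)

lemma summable_int_inverse_squares: "(\<lambda>m::int. 1 / (1 + (real_of_int m)\<^sup>2)) summable_on UNIV"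
proof -
  let ?g = "\<lambda>m::int. 1 / (1 + (real_of_int m)\<^sup>2)"
  have "summable (\<lambda>n. 1 / (1 + (real n)\<^sup>2))"
  proof (rule summable_comparison_test'[where N=1])
    show "summable (\<lambda>n. inverse (real n ^ 2))" by (rule inverse_power_summable) simp
    show "norm (1 / (1 + (real n)\<^sup>2)) \<le> inverse (real n ^ 2)" if "1 \<le> n" for n
      using that by (simp add: inverse_eq_divide frac_le)
  qed
  then have n: "(\<lambda>n. 1 / (1 + (real n)\<^sup>2)) summable_on UNIV"
    by (subst summable_on_UNIV_nonneg_real_iff) auto
  have "?g summable_on (range int)"
    by (subst summable_on_reindex) (use n in \<open>auto simp: o_def\<close>)
  moreover have "?g summable_on (range (\<lambda>n. - int n))"
    by (subst summable_on_reindex) (use n in \<open>auto simp: o_def inj_on_def\<close>)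
  ultimately have "?g summable_on (range int \<union> range (\<lambda>n. - int n))"
    by (rule summable_on_union)
  also have "range int \<union> range (\<lambda>n. - int n) = UNIV"
  proof (rule UNIV_eq_I[symmetric])
    fix z :: int
    show "z \<in> range int \<union> range (\<lambda>n. - int n)" by (cases z rule: int_cases2) auto
  qed
  finally show ?thesis .
qed

lemma summable_decay_lattice: "(\<lambda>m. decay (lattice_point m :: real^'n::finite)) summable_on UNIV"
proof (rule summable_on_comparison_test)
  show "(\<lambda>m::int^'n. \<Prod>l\<in>UNIV. 1 / (1 + (real_of_int (m $ l))\<^sup>2)) summable_on UNIV"
    by (rule summable_on_prod_vec[of "\<lambda>_ m. 1 / (1 + (real_of_int m)\<^sup>2)"]) (auto simp: summable_int_inverse_squares)
  show "decay (lattice_point m :: real^'n) \<le> (\<Prod>l\<in>UNIV. 1 / (1 + (real_of_int (m $ l))\<^sup>2))" for m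
    using decay_le_prod[of "lattice_point m :: real^'n"] by (simp add: lattice_point_def)
  show "0 \<le> decay (lattice_point m :: real^'n)" for m using decay_pos less_imp_le by blast
qed

section \<open>Fourier series on the cube\<close>

definition cube :: "(real^'n::finite) set" where
  "cube = {x. \<forall>l. - pi \<le> x $ l \<and> x $ l \<le> pi}"

lemma cube_cbox: "cube = cbox (\<chi> l. - pi) (\<chi> l. pi)"
  unfolding cube_def by (auto simp: mem_box_cart)

lemma compact_cube: "compact cube" unfolding cube_cbox by (rule compact_cbox)

lemma indicator_cube: "indicator cube x = (\<Prod>l\<in>UNIV. indicator {-pi..pi} (x $ l) :: complex)"
proof (cases "x \<in> cube")
  case True
  then show ?thesis by (auto simp: cube_def)
next
  case False
  then obtain l where "x $ l \<notin> {-pi..pi}" by (auto simp: cube_def)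
  then have "(\<Prod>l\<in>UNIV. indicator {-pi..pi} (x $ l) :: complex) = 0"
    by (intro prod_zero bexI[of _ l]) auto
  then show ?thesis using False by simp
qed

lemma lattice_point_0: "lattice_point 0 = 0" by (simp add: lattice_point_def vec_eq_iff)
lemma lattice_point_add: "lattice_point (a + b) = lattice_point a
    + lattice_point b" by (simp add: lattice_point_def vec_eq_iff)
lemma lattice_point_diff: "lattice_point (a - b) = lattice_point a - lattice_point b" by (simp add: lattice_point_def vec_eq_iff)
lemma lattice_point_minus: "lattice_point (- a) = - lattice_point a" by (simp add: lattice_point_def vec_eq_iff)
lemma lattice_point_axis: "lattice_point (axis l 1) = axis l 1" by (simp add: lattice_point_def vec_eq_iff axis_def)

lemma integral_wave_period:
  fixes k :: int
  shows "integrable lborel (\<lambda>t. indicator {-pi..pi} t * iexp (real_of_int k * t))"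
    and "(LINT t|lborel. indicator {-pi..pi} t * iexp (real_of_int k * t)) = (if k = 0 then 2 * pi else 0)"
proof -
  have e: "indicator {-pi..pi} t * z = indicator {-pi..pi} t *\<^sub>R z" for t and z :: complex
    by (simp add: indicator_def)
  show "integrable lborel (\<lambda>t. indicator {-pi..pi} t * iexp (real_of_int k * t))"
    unfolding e by (rule borel_integrable_compact) (auto intro!: continuous_intros)
  show "(LINT t|lborel. indicator {-pi..pi} t * iexp (real_of_int k * t)) = (if k = 0 then 2 * pi else 0)"
  proof (cases "k = 0")
    case True
    have "(LINT t|lborel. indicator {-pi..pi} t *\<^sub>R (1::complex)) = complex_of_real pi - complex_of_real (- pi)"
      by (rule integral_FTC_Icc) (auto intro!: derivative_eq_intros)
    then show ?thesis unfolding e using True by simp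
  next
    case False
    let ?F = "\<lambda>t. iexp (real_of_int k * t) / (\<i> * of_int k)"
    have "(LINT t|lborel. indicator {-pi..pi} t *\<^sub>R iexp (real_of_int k * t)) = ?F pi - ?F (- pi)"
    proof (rule integral_FTC_Icc)
      show "(?F has_vector_derivative iexp (real_of_int k * t)) (at t within {- pi..pi})" for t
      proof -
        have "((\<lambda>z. exp (\<i> * of_int k * z) / (\<i> * of_int k)) has_field_derivative exp (\<i> * of_int k
            * complex_of_real t)) (at (complex_of_real t))"
          using False by (auto intro!: derivative_eq_intros)
        from has_vector_derivative_real_field[OF this] show ?thesis
          by (simp add: mult.assoc has_vector_derivative_at_within)
      qed
    qed (auto intro!: continuous_intros)
    also have "iexp (real_of_int k * pi) = iexp (real_of_int k * (- pi))"
    proof -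
      have "iexp (real_of_int k * pi) = iexp (real_of_int k * (- pi)) * exp (2 * of_int k * of_real pi * \<i>)"
        by (subst exp_add[symmetric]) (simp add: algebra_simps)
      also have "exp (2 * of_int k * of_real pi * \<i>) = 1"
        using exp_integer_2pi[of "of_int k"] by (simp add: mult_ac)
      finally show ?thesis by simp
    qed
    finally show ?thesis unfolding e using False by simp
  qed
qed

lemma integral_wave_cube:
  "(LINT x|lborel. indicator cube x * wave (lattice_point m) x) = (if m
      = (0::int^'n::finite) then (2 * complex_of_real pi) ^ CARD('n) else 0)"
proof -
  have w: "indicator cube x * wave (lattice_point m) x
      = (\<Prod>l\<in>UNIV. indicator {-pi..pi} (x $ l) * iexp (real_of_int (m $ l) * x $ l))" for x
    unfolding indicator_cube prod.distrib wave_def inner_vec_def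
    by (simp add: exp_sum[symmetric] sum_distrib_left lattice_point_def)
  have "(LINT x|lborel. indicator cube x * wave (lattice_point m) x)
      = (\<Prod>l\<in>UNIV. LINT t|lborel. indicator {-pi..pi} t * iexp (real_of_int (m $ l) * t))"
    unfolding w
    by (rule lborel_integral_prod[of "\<lambda>l t. indicator {-pi..pi} t * iexp (real_of_int (m $ l)
        * t)"]) (rule integral_wave_period)
  also have "\<dots> = (\<Prod>l\<in>UNIV. if m $ l = 0 then 2 * complex_of_real pi else 0)"
    unfolding integral_wave_period by (intro prod.cong) auto
  also have "\<dots> = (if m = 0 then (2 * complex_of_real pi) ^ CARD('n) else 0)"
    by (auto simp: vec_eq_iff prod_zero_iff)
  finally show ?thesis .
qed

text \<open>
  The powers of \<open>q\<close> concentrate at \<open>y\<close>: they decay geometrically away from \<open>y\<close> at a rate \<open>\<rho>\<close> that is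
  strictly better than the rate \<open>\<sigma>\<close> attained near \<open>y\<close>. If \<open>G y \<noteq> 0\<close>, the contribution near \<open>y\<close>
  would eventually dominate and the integrals could not all vanish.
\<close>

lemma vanishing_by_concentration:
  fixes G :: "real^'n::finite \<Rightarrow> complex" and q :: "real^'n \<Rightarrow> real"
  assumes G: "continuous_on UNIV G" and q: "continuous_on UNIV q"
    and Q: "compact Q" "y \<in> interior Q"
    and q01: "\<And>x. 0 \<le> q x" "\<And>x. q x \<le> 1" and qy: "q y = 1" and q1: "\<And>x. x \<in> Q \<Longrightarrow> x \<noteq> y \<Longrightarrow> q x < 1"
    and I: "\<And>N. (LINT x|lborel. indicator Q x *\<^sub>R (G x * complex_of_real (q x ^ N))) = 0"
  shows "G y = 0"
proof (rule ccontr)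
  assume "G y \<noteq> 0"
  define g where "g = (\<lambda>x. Re (cnj (G y) * G x))"
  have gc: "continuous_on UNIV g" unfolding g_def by (intro continuous_intros G)
  define r where "r = g y / 2"
  have gy: "g y = (norm (G y))\<^sup>2" unfolding g_def
    by (metis Re_complex_of_real complex_norm_square mult.commute of_real_power)
  then have r: "0 < r" "r < g y" using \<open>G y \<noteq> 0\<close> by (auto simp: r_def)
  have "open {x \<in> interior Q. r < g x}"
    unfolding Collect_conj_eq Collect_mem_eq using gc continuous_on_const
    by (intro open_Int open_interior open_Collect_less) auto
  then obtain d where d: "0 < d" "ball y d \<subseteq> {x \<in> interior Q. r < g x}"
    using r Q unfolding open_contains_ball by blast
  let ?K = "Q - ball y d"
  have K: "compact ?K" by (intro compact_diff Q) auto
  obtain \<rho> where rho: "0 \<le> \<rho>" "\<rho> < 1" "\<And>x. x \<in> ?K \<Longrightarrow> q x \<le> \<rho>"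
  proof (cases "?K = {}")
    case True
    then have "q x \<le> 0" if "x \<in> ?K" for x using that by blast
    then show ?thesis using that[of 0] by simp
  next
    case False
    have "continuous_on ?K q" using q by (rule continuous_on_subset) auto
    from continuous_attains_sup[OF K False this] obtain z where z: "z \<in> ?K" "\<And>x. x \<in> ?K \<Longrightarrow> q x \<le> q z" by blast
    have "z \<noteq> y" using z(1) d(1) by auto
    then show ?thesis using that[of "q z"] z q1[of z] q01 by auto
  qed
  (* Any rate strictly between \<rho> and 1 would do. *)
  define \<sigma> where "\<sigma> = (1 + \<rho>) / 2"
  have sigma: "\<rho> < \<sigma>" "\<sigma> < 1" "0 < \<sigma>" using rho by (auto simp: \<sigma>_def)
  have "open {x \<in> ball y d. \<sigma> < q x}"
    unfolding Collect_conj_eq Collect_mem_eq using q continuous_on_const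
    by (intro open_Int open_ball open_Collect_less) auto
  moreover have "y \<in> {x \<in> ball y d. \<sigma> < q x}" using sigma d qy by simp
  ultimately obtain e where e: "0 < e" "ball y e \<subseteq> {x \<in> ball y d. \<sigma> < q x}"
    unfolding open_contains_ball by blast
  obtain M where M: "0 \<le> M" "\<And>x. x \<in> Q \<Longrightarrow> \<bar>g x\<bar> \<le> M"
  proof -
    have "bounded (g ` Q)"
      by (intro compact_imp_bounded compact_continuous_image Q continuous_on_subset[OF gc]) auto
    then obtain M where "\<And>x. x \<in> Q \<Longrightarrow> \<bar>g x\<bar> \<le> M" unfolding bounded_iff by auto
    then show ?thesis using that[of "max M 0"] by (meson max.coboundedI1 max.cobounded2)
  qed
  have bQ: "ball y d \<subseteq> Q" using d interior_subset by blast
  have be: "ball y e \<subseteq> ball y d" using e by blast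
  define v V where "v = measure lborel (ball y e)" and "V = measure lborel Q"
  have v: "0 < v" unfolding v_def using content_ball_pos[OF e(1)] by simp
  have fin: "emeasure lborel Q < \<infinity>" "emeasure lborel (ball y e) < \<infinity>"
    by (rule emeasure_bounded_finite[OF compact_imp_bounded[OF Q(1)]]) (rule emeasure_bounded_finite[OF bounded_ball])
  have sQ: "Q \<in> sets borel" using Q(1) by (simp add: borel_compact)
  have key: "r * \<sigma> ^ N * v \<le> M * \<rho> ^ N * V" for N
  proof -
    let ?f = "\<lambda>x. indicator Q x *\<^sub>R (g x * q x ^ N)"
    have if0: "integrable lborel (\<lambda>x. indicator Q x *\<^sub>R (G x * complex_of_real (q x ^ N)))"
      by (intro borel_integrable_compact Q continuous_intros continuous_on_subset[OF G] continuous_on_subset[OF q]) auto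
    have fe: "?f x = Re (cnj (G y) * (indicator Q x *\<^sub>R (G x * complex_of_real (q x ^ N))))" for x
    proof -
      have "Re (z * complex_of_real t) = Re z * t" for z t by simp
      then have "Re (cnj (G y) * (G x * complex_of_real (q x ^ N))) = g x * q x ^ N"
        unfolding g_def mult.assoc[symmetric] by blast
      then show ?thesis by (cases "x \<in> Q") simp_all
    qed
    have "(LINT x|lborel. ?f x) = Re (LINT x|lborel. cnj (G y) * (indicator Q x *\<^sub>R (G x
        * complex_of_real (q x ^ N))))"
      unfolding fe using if0 by (intro integral_Re integrable_mult_right)
    also have "\<dots> = 0" unfolding integral_mult_right_zero I by simp
    finally have f0: "(LINT x|lborel. ?f x) = 0" .
    have "(LINT x|lborel. r * \<sigma> ^ N * indicator (ball y e) x - M * \<rho> ^ N * indicator Q x) \<le> (LINT x|lborel. ?f x)"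
    proof (rule integral_mono)
      show "integrable lborel (\<lambda>x. r * \<sigma> ^ N * indicator (ball y e) x - M * \<rho> ^ N * indicator Q x)"
        using fin sQ by (intro Bochner_Integration.integrable_diff integrable_mult_right integrable_real_indicator) auto
      show "integrable lborel ?f"
        by (intro borel_integrable_compact Q continuous_intros continuous_on_subset[OF gc] continuous_on_subset[OF q]) auto
      fix x
      consider "x \<notin> Q" | "x \<in> Q" "x \<notin> ball y d" | "x \<in> ball y d" "x \<notin> ball y e" | "x \<in> ball y e" by blast
      then show "r * \<sigma> ^ N * indicator (ball y e) x - M * \<rho> ^ N * indicator Q x \<le> ?f x"
      proof cases
        case 1
        then show ?thesis using bQ be by (auto simp: indicator_def)
      next
        case 2
        have "\<bar>g x * q x ^ N\<bar> \<le> M * \<rho> ^ N"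
          unfolding abs_mult using 2 M rho q01 by (intro mult_mono) (auto intro!: power_mono simp: power_abs)
        then show ?thesis using 2 be by (auto simp: indicator_def)
      next
        case 3
        have "0 \<le> g x * q x ^ N" using 3 d r q01 by (intro mult_nonneg_nonneg zero_le_power) force+
        moreover have "0 \<le> M * \<rho> ^ N" using M rho by simp
        ultimately show ?thesis using 3 bQ by (auto simp: indicator_def)
      next
        case 4
        have "r * \<sigma> ^ N \<le> g x * q x ^ N"
          using 4 d e be r sigma q01 by (intro mult_mono power_mono) force+
        moreover have "0 \<le> M * \<rho> ^ N" using M rho by simp
        ultimately show ?thesis using 4 bQ be by (auto simp: indicator_def)
      qed
    qed
    also have "(LINT x|lborel. r * \<sigma> ^ N * indicator (ball y e) x - M * \<rho> ^ N * indicator Q x)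
        = r * \<sigma> ^ N * v - M * \<rho> ^ N * V"
      using fin sQ unfolding v_def V_def by (subst Bochner_Integration.integral_diff) auto
    finally show ?thesis using f0 by simp
  qed
  have "(\<lambda>N. M * V * (\<rho> / \<sigma>) ^ N) \<longlonglongrightarrow> M * V * 0"
    using sigma rho by (intro tendsto_intros LIMSEQ_power_zero) auto
  moreover have "r * v \<le> M * V * (\<rho> / \<sigma>) ^ N" for N
    using key[of N] sigma by (simp add: power_divide field_simps)
  ultimately have "r * v \<le> M * V * 0"
    by (intro tendsto_lowerbound[of _ _ sequentially]) auto
  then show False using r v by (simp add: mult_le_0_iff)
qed

text \<open>
  The concentrating factor in one coordinate is a trigonometric polynomial of degree one.
\<close>

lemma cos_factor_waves:
  "complex_of_real ((1 + cos (x $ l - y $ l)) / 2) =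
    1 / 2 + wave (- axis l 1) y / 4 * wave (axis l 1) x + wave (axis l 1) y / 4 * wave (- axis l 1) x"
proof -
  have c: "complex_of_real (cos t) = (iexp t + iexp (- t)) / 2" for t
    unfolding cos_of_real[symmetric] cos_exp_eq by simp
  have 1: "iexp (x $ l - y $ l) = wave (- axis l 1) y * wave (axis l 1) x"
    unfolding wave_def exp_add[symmetric] by (simp add: inner_axis' algebra_simps)
  have 2: "iexp (- (x $ l - y $ l)) = wave (axis l 1) y * wave (- axis l 1) x"
    unfolding wave_def exp_add[symmetric] by (simp add: inner_axis' algebra_simps)
  have "complex_of_real ((1 + cos (x $ l - y $ l)) / 2) = (1 + complex_of_real (cos (x $ l - y $ l))) / 2" by simp
  also have "\<dots> = 1 / 2 + (iexp (x $ l - y $ l) + iexp (- (x $ l - y $ l))) / 4" unfolding c by (simp add: add_divide_distrib)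
  finally show ?thesis unfolding 1 2 by (simp add: add_divide_distrib add.assoc)
qed

text \<open>
  A continuous function with vanishing Fourier coefficients vanishes inside the cube. The functions
  whose product with \<open>G\<close> has vanishing Fourier coefficients are stable under multiplication by
  trigonometric polynomials, in particular by the powers of \<open>q x = \<Prod> (1 + cos (x\<^sub>l - y\<^sub>l)) / 2\<close>. Inside
  the cube \<open>q\<close> reaches its maximum \<open>1\<close> only at \<open>y\<close>, as differences of coordinates stay below \<open>2\<pi>\<close>.
\<close>

lemma cube_uniqueness:
  fixes G :: "real^'n::finite \<Rightarrow> complex"
  assumes G: "continuous_on UNIV G"
    and I: "\<And>a. (LINT x|lborel. indicator cube x *\<^sub>R (G x * wave (lattice_point a) x)) = 0"
    and y: "\<And>l. - pi < y $ l \<and> y $ l < pi"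
  shows "G y = 0"
proof -
  define fac where "fac = (\<lambda>l (x::real^'n). (1 + cos (x $ l - y $ l)) / 2)"
  define T where "T = (\<lambda>P. continuous_on UNIV P \<and>
     (\<forall>a. (LINT x|lborel. indicator cube x *\<^sub>R (G x * P x * wave (lattice_point a) x)) = 0))"
  have fc: "continuous_on UNIV (fac l)" for l unfolding fac_def by (intro continuous_intros) simp
  have step: "T (\<lambda>x. P x * complex_of_real (fac l x))" if "T P" for P l
  proof -
    from that have P: "continuous_on UNIV P"
      and P0: "(LINT x|lborel. indicator cube x *\<^sub>R (G x * P x * wave (lattice_point a) x)) = 0" for a
      by (auto simp: T_def)
    have int: "integrable lborel (\<lambda>x. indicator cube x *\<^sub>R (G x * P x * wave (lattice_point a) x))" for a
      by (intro borel_integrable_compact compact_cube continuous_intros continuous_on_wave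
          continuous_on_subset[OF G] continuous_on_subset[OF P]) auto
    have "(LINT x|lborel. indicator cube x *\<^sub>R (G x * (P x * complex_of_real (fac l x))
        * wave (lattice_point a) x)) = 0" for a
    proof -
      have e: "indicator cube x *\<^sub>R (G x * (P x * complex_of_real (fac l x)) * wave (lattice_point a) x) =
         1 / 2 * (indicator cube x *\<^sub>R (G x * P x * wave (lattice_point a) x))
       + wave (- axis l 1) y / 4 * (indicator cube x *\<^sub>R (G x * P x * wave (lattice_point (a + axis l 1)) x))
       + wave (axis l 1) y / 4 * (indicator cube x *\<^sub>R (G x * P x * wave (lattice_point (a + - axis l 1)) x))" for x
        unfolding fac_def cos_factor_waves lattice_point_add lattice_point_minus lattice_point_axis wave_add
        by (simp add: indicator_def algebra_simps)
      have int2: "integrable lborel (\<lambda>x. c * (indicator cube x *\<^sub>R (G x * P x * wave (lattice_point a) x)))" for c a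
        by (intro integrable_mult_right int)
      show ?thesis unfolding e
        by (simp only: Bochner_Integration.integral_add Bochner_Integration.integrable_add int2
            integral_mult_right_zero P0 mult_zero_right add_0_right)
    qed
    moreover have "continuous_on UNIV (\<lambda>x. P x * complex_of_real (fac l x))"
      by (intro continuous_intros P fc)
    ultimately show ?thesis by (simp add: T_def)
  qed
  define q where "q = (\<lambda>x. \<Prod>l\<in>UNIV. fac l x)"
  (* Multiplying in one coordinate factor at a time avoids expanding the trigonometric polynomial. *)
  have qstep: "T (\<lambda>x. P x * complex_of_real (q x))" if "T P" for P
  proof -
    have "T (\<lambda>x. P x * (\<Prod>l\<in>A. complex_of_real (fac l x)))" for A :: "'n set"
    proof (induction A rule: infinite_finite_induct)
      case (insert l A)
      show ?case using step[OF insert.IH, of l] insert.hyps by (simp add: mult_ac)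
    qed (use that in auto)
    then show ?thesis unfolding q_def by simp
  qed
  have T1: "T (\<lambda>_. 1)" using I by (simp add: T_def)
  have qN: "T (\<lambda>x. complex_of_real (q x ^ N))" for N
  proof (induction N)
    case (Suc N)
    from qstep[OF this] show ?case by (simp add: mult.commute)
  qed (use T1 in simp)
  have fac01: "0 \<le> fac l x" "fac l x \<le> 1" for l x
  proof -
    have "0 \<le> 1 + cos (x $ l - y $ l)" "1 + cos (x $ l - y $ l) \<le> 2"
      using cos_ge_minus_one[of "x $ l - y $ l"] cos_le_one[of "x $ l - y $ l"] by linarith+
    then show "0 \<le> fac l x" "fac l x \<le> 1" unfolding fac_def by simp_all
  qed
  show "G y = 0"
  proof (rule vanishing_by_concentration[OF G _ compact_cube, where q=q])
    show "continuous_on UNIV q" unfolding q_def by (intro continuous_intros fc)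
    have "y \<in> box (\<chi> l. - pi) (\<chi> l. pi)" using y by (auto simp: mem_box_cart)
    then show "y \<in> interior cube" unfolding cube_cbox interior_cbox .
    show "0 \<le> q x" "q x \<le> 1" for x unfolding q_def using fac01 by (auto intro!: prod_nonneg prod_le_1)
    show "q y = 1" by (simp add: q_def fac_def)
    fix x :: "real^'n" assume x: "x \<in> cube" "x \<noteq> y"
    then obtain l where l: "x $ l \<noteq> y $ l" by (auto simp: vec_eq_iff)
    have "cos (x $ l - y $ l) \<noteq> 1"
    proof
      assume "cos (x $ l - y $ l) = 1"
      then obtain k :: int where k: "x $ l - y $ l = k * 2 * pi" by (auto simp: cos_one_2pi_int)
      have "\<bar>x $ l - y $ l\<bar> < 2 * pi" using x(1) y[of l] unfolding cube_def by (auto simp: abs_less_iff) (smt (verit))+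
      then have "\<bar>real_of_int k\<bar> * (2 * pi) < 1 * (2 * pi)" unfolding k by (simp add: abs_mult)
      then have "\<bar>real_of_int k\<bar> < 1" by (subst (asm) mult_less_cancel_right_pos) auto
      then have "k = 0" by linarith
      then show False using k l by simp
    qed
    then have "cos (x $ l - y $ l) < 1" using cos_le_one[of "x $ l - y $ l"] by (simp only: less_le not_False_eq_True)
    then have "fac l x < 1" unfolding fac_def by simp
    moreover have "q x \<le> fac l x"
      unfolding q_def prod.remove[OF finite UNIV_I[of l]] using fac01
      by (intro mult_right_le_one_le prod_nonneg prod_le_1) auto
    ultimately show "q x < 1" by simp
  next
    fix N
    show "(LINT x|lborel. indicator cube x *\<^sub>R (G x * complex_of_real (q x ^ N))) = 0"
      using qN[of N, unfolded T_def, THEN conjunct2, rule_format, of 0]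
      by (simp only: lattice_point_0 wave_0 mult_1_right)
  qed
qed

text \<open>
  The coefficients decay rapidly, so the series converges uniformly to a continuous function, whose
  Fourier coefficients are those of \<open>g\<close> by orthogonality of the characters; \<open>cube_uniqueness\<close>
  identifies the two functions.
\<close>

theorem fourier_series:
  fixes g :: "real^'n::finite \<Rightarrow> complex"
  assumes g: "smooth g" and supp: "\<And>x. g x \<noteq> 0 \<Longrightarrow> (\<forall>l. - pi < x $ l \<and> x $ l < pi)"
    and y: "\<And>l. - pi < y $ l \<and> y $ l < pi"
  shows "((\<lambda>m. (LINT x|lborel. wave (lattice_point m) x * g x) * wave (- lattice_point m) y) has_sum
     (2 * complex_of_real pi) ^ CARD('n) * g y) UNIV"
proof -
  have sg: "schwartz g"
  proof (rule schwartz_compact_support[OF g, of "real CARD('n) * pi"])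
    fix x :: "real^'n" assume x: "real CARD('n) * pi < norm x"
    show "g x = 0"
    proof (rule ccontr)
      assume "g x \<noteq> 0"
      then have "\<bar>x $ l\<bar> \<le> pi" for l using supp[of x] by (auto simp: abs_le_iff less_imp_le minus_le_iff)
      then have "(\<Sum>l\<in>UNIV. \<bar>x $ l\<bar>) \<le> (\<Sum>l\<in>(UNIV::'n set). pi)" by (intro sum_mono)
      then show False using x norm_le_l1_cart[of x] by simp
    qed
  qed
  define c where "c = (\<lambda>m. LINT x|lborel. wave (lattice_point m :: real^'n) x * g x)"
  obtain C where C: "\<And>\<xi>. (1 + norm \<xi>) ^ (2 * CARD('n)) * norm (fourier g \<xi>) \<le> C"
    using fourier_bounded[OF sg] by metis
  have cb: "norm (c m) \<le> C * decay (lattice_point m :: real^'n)" for m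
    using decay_le[OF C[of "- lattice_point m"]] unfolding c_def by (simp add: fourier_def decay_def)
  have sB: "(\<lambda>m. C * decay (lattice_point m :: real^'n)) summable_on UNIV"
    by (intro summable_on_cmult_right summable_decay_lattice)
  have tb: "norm (c m * wave (- lattice_point m) x) \<le> C * decay (lattice_point m :: real^'n)" for m x
    using cb[of m] by (simp add: norm_mult)
  define S where "S = (\<lambda>x. infsum (\<lambda>m. c m * wave (- lattice_point m) x) UNIV)"
  have S: "((\<lambda>m. c m * wave (- lattice_point m) x) has_sum S x) UNIV" for x
  proof -
    have "(\<lambda>m. norm (c m * wave (- lattice_point m) x)) summable_on UNIV"
      by (rule Infinite_Sum.abs_summable_on_comparison_test'[OF sB tb])
    then show ?thesis unfolding S_def by (rule has_sum_infsum[OF abs_summable_summable])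
  qed
  have cS: "continuous_on UNIV S"
  proof (rule uniform_limit_theorem)
    show "uniform_limit UNIV (\<lambda>A x. \<Sum>m\<in>A. c m * wave (- lattice_point m) x) S (finite_subsets_at_top UNIV)"
      unfolding S_def by (rule Weierstrass_m_test_general[OF tb sB])
  qed (auto intro!: always_eventually continuous_intros continuous_on_wave)
  let ?p = "(2 * complex_of_real pi) ^ CARD('n)"
  have "S y - ?p * g y = 0"
  proof (rule cube_uniqueness[where G="\<lambda>x. S x - ?p * g x"])
    show "continuous_on UNIV (\<lambda>x. S x - ?p * g x)"
      by (intro continuous_intros cS smooth_continuous_on g)
    fix a :: "int^'n"
    let ?w = "wave (lattice_point a) :: real^'n \<Rightarrow> complex"
    have sq: "cube \<in> sets (borel :: (real^'n) measure)" by (simp add: borel_compact compact_cube)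
    have m[measurable]: "S \<in> borel_measurable borel" "cube \<in> sets (borel :: (real^'n) measure)" "(\<lambda>x. ?w x) \<in> borel_measurable borel"
      using cS sq by (auto intro: borel_measurable_continuous_onI)
    have fin: "emeasure lborel (cube :: (real^'n) set) < \<infinity>" using emeasure_compact_finite[OF compact_cube] .
    have iS: "integrable lborel (\<lambda>x. indicator cube x *\<^sub>R (S x * ?w x))"
      by (intro borel_integrable_compact compact_cube continuous_intros continuous_on_wave continuous_on_subset[OF cS]) auto
    have ig: "integrable lborel (\<lambda>x. indicator cube x *\<^sub>R (g x * ?w x))"
      by (intro borel_integrable_compact compact_cube continuous_intros continuous_on_wave smooth_continuous_on g)
    have "((\<lambda>m. LINT x|lborel. indicator cube x *\<^sub>R (c m * wave (- lattice_point m) x * ?w x)) has_sum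
       (LINT x|lborel. indicator cube x *\<^sub>R (S x * ?w x))) UNIV"
    proof (rule has_sum_integral[OF _ sB])
      show "integrable lborel (indicator (cube :: (real^'n) set) :: _ \<Rightarrow> real)" using sq fin by simp
      show "integrable lborel (\<lambda>x. indicator cube x *\<^sub>R (c m * wave (- lattice_point m) x * ?w x))" for m
        by (intro borel_integrable_compact compact_cube continuous_intros continuous_on_wave)
      show "norm (indicator cube x *\<^sub>R (c m * wave (- lattice_point m) x * ?w x))
         \<le> C * decay (lattice_point m :: real^'n) * indicator cube x" for m x
        using cb[of m] by (simp add: norm_mult indicator_def)
      show "((\<lambda>m. indicator cube x *\<^sub>R (c m * wave (- lattice_point m) x * ?w x))
          has_sum indicator cube x *\<^sub>R (S x * ?w x)) UNIV" for x
        unfolding scaleR_conv_of_real by (intro has_sum_cmult_right has_sum_cmult_left S)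
    qed measurable
    moreover have "(LINT x|lborel. indicator cube x *\<^sub>R (c m * wave (- lattice_point m) x * ?w x)) = (if m
        = a then c a * ?p else 0)" for m
    proof -
      have "indicator cube x *\<^sub>R (c m * wave (- lattice_point m) x * ?w x)
          = c m * (indicator cube x * wave (lattice_point (a - m)) x)" for x
        using wave_add[of "- lattice_point m" "lattice_point a" x] by (simp add: lattice_point_diff indicator_def)
      then show ?thesis by (simp add: integral_wave_cube)
    qed
    ultimately have "((\<lambda>m. if m = a then c a * ?p else 0) has_sum
       (LINT x|lborel. indicator cube x *\<^sub>R (S x * ?w x))) UNIV" by simp
    moreover have "((\<lambda>m. if m = a then c a * ?p else 0) has_sum c a * ?p) UNIV"
    proof -
      let ?f = "\<lambda>m. if m = a then c a * ?p else 0"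
      have "(?f has_sum sum ?f {a}) {a}" by (rule has_sum_finite) simp
      also have "(?f has_sum sum ?f {a}) {a} \<longleftrightarrow> (?f has_sum sum ?f {a}) UNIV"
        by (rule has_sum_cong_neutral) auto
      finally show ?thesis by simp
    qed
    ultimately have 1: "(LINT x|lborel. indicator cube x *\<^sub>R (S x * ?w x)) = c a * ?p"
      by (rule has_sum_unique)
    have "indicator cube x *\<^sub>R (g x * ?w x) = ?w x * g x" for x
      using supp[of x] by (cases "g x = 0") (auto simp: indicator_def cube_def less_imp_le)
    then have 2: "(LINT x|lborel. indicator cube x *\<^sub>R (g x * ?w x)) = c a"
      by (simp add: c_def)
    have e: "indicator cube x *\<^sub>R ((S x - ?p * g x) * ?w x) =
       indicator cube x *\<^sub>R (S x * ?w x) - ?p * (indicator cube x *\<^sub>R (g x * ?w x))" for x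
      by (simp add: indicator_def algebra_simps)
    show "(LINT x|lborel. indicator cube x *\<^sub>R ((S x - ?p * g x) * ?w x)) = 0"
      unfolding e
      by (subst Bochner_Integration.integral_diff[OF iS integrable_mult_right[OF ig]])
        (simp only: integral_mult_right_zero 1 2 mult.commute diff_self)
  qed (use y in auto)
  then show ?thesis using S[of y] unfolding c_def by simp
qed

section \<open>The coefficients as integrals over frequency\<close>

text \<open>
  The part of the normalising factor of \<^const>\<open>omega_mi\<close> that depends on \<open>\<beta>\<close>.
\<close>

definition quark_coeff :: "nat \<Rightarrow> nat^'n::finite \<Rightarrow> complex" where
  "quark_coeff J \<beta> = \<i> ^ mi_abs \<beta> * 2 ^ (J * mi_abs \<beta>) / of_nat (mi_fact \<beta>)"

lemma smooth_of_real: "smooth f \<Longrightarrow> smooth (\<lambda>x. complex_of_real (f x))"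
  by (rule smooth_bounded_linear[OF bounded_linear_of_real])

text \<open>
  \<^const>\<open>Omega_mi\<close> is, up to the normalisation of the transform, the Fourier series of
  \<^const>\<open>omega_mi\<close> on the cube; on the ball of radius \<open>2\<close>, which lies inside the cube because \<open>2 < \<pi>\<close>,
  the cutoff \<open>\<omega>\<close> equals \<open>1\<close> and only the monomial remains.
\<close>

lemma Omega_mi_eq:
  fixes \<omega> :: "real^'n::finite \<Rightarrow> real"
  assumes sm: "smooth \<omega>" and supp: "closure {x. \<omega> x \<noteq> 0} \<subseteq> {x. \<forall>l. - pi < x $ l \<and> x $ l < pi}"
    and one: "\<And>x. norm x \<le> 2 \<Longrightarrow> \<omega> x = 1" and x: "norm x \<le> 2"
  shows "Omega_mi J \<omega> \<beta> x = complex_of_real ((2 * pi) powr (- real CARD('n) / 2)) * quark_coeff J \<beta> * monomial \<beta> x"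
proof -
  let ?w = "complex_of_real ((2 * pi) powr (- real CARD('n) / 2))" and ?p = "(2 * complex_of_real pi) ^ CARD('n)"
  define c where "c = quark_coeff J \<beta> / ?p"
  have om: "omega_mi J \<omega> \<beta> = (\<lambda>x. c * (monomial \<beta> x * complex_of_real (\<omega> x)))"
    by (rule ext) (simp add: omega_mi_def c_def quark_coeff_def monomial_def mult_ac)
  have smo: "smooth (omega_mi J \<omega> \<beta>)"
    unfolding om by (intro smooth_cmult smooth_mult smooth_monomial smooth_of_real sm)
  have y: "- pi < x $ l \<and> x $ l < pi" for l
    using component_le_norm_cart[of x l] x pi_gt3 by linarith
  have sp: "- pi < z $ l \<and> z $ l < pi" if "omega_mi J \<omega> \<beta> z \<noteq> 0" for z l
  proof -
    have "\<omega> z \<noteq> 0" using that unfolding om by auto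
    then have "z \<in> closure {x. \<omega> x \<noteq> 0}" by (intro subsetD[OF closure_subset]) simp
    then show ?thesis using subsetD[OF supp] by simp
  qed
  have "((\<lambda>m. (LINT z|lborel. wave (lattice_point m) z * omega_mi J \<omega> \<beta> z) * wave (- lattice_point m) x) has_sum
     ?p * omega_mi J \<omega> \<beta> x) UNIV"
    by (rule fourier_series[OF smo]) (use sp y in auto)
  from has_sum_cmult_right[OF this, of ?w]
  have "((\<lambda>m. inverse_fourier (omega_mi J \<omega> \<beta>) (lattice_point m) * exp (- \<i>
      * complex_of_real (lattice_point m \<bullet> x))) has_sum
     ?w * (?p * omega_mi J \<omega> \<beta> x)) UNIV"
    by (simp add: inverse_fourier_def wave_def inner_commute mult.assoc)
  then have "Omega_mi J \<omega> \<beta> x = ?w * (?p * omega_mi J \<omega> \<beta> x)"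
    unfolding Omega_mi_def by (rule infsumI)
  also have "\<dots> = ?w * (?p * c) * monomial \<beta> x" unfolding om using one[OF x] by simp
  also have "?p * c = quark_coeff J \<beta>" by (simp add: c_def)
  finally show ?thesis by (simp add: mult.assoc)
qed

text \<open>
  Fourier inversion is applied to the test function and the integrals are exchanged. The inner integral
  is the inverse Fourier transform of a dilated and translated function: the dilation contributes
  \<open>t\<^sup>-\<^sup>n\<close>, which cancels the factor on the left, and the translation contributes a character.
\<close>

lemma pairing_dilated:
  fixes \<Phi> \<phi> :: "real^'n::finite \<Rightarrow> complex"
  assumes Phi: "schwartz \<Phi>" and phi: "schwartz \<phi>" and t: "t > 0"
  shows "complex_of_real (t ^ CARD('n)) * regular_distribution (\<lambda>x. \<Phi> (t *\<^sub>R x - a)) \<phi> =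
    complex_of_real ((2 * pi) powr (- real CARD('n) / 2)) *
    (LINT \<eta>|lborel. fourier \<phi> \<eta> * inverse_fourier \<Phi> ((1 / t) *\<^sub>R \<eta>) * wave a ((1 / t) *\<^sub>R \<eta>))"
proof -
  let ?P = "\<lambda>x. \<Phi> (t *\<^sub>R x - a)"
  let ?G = "\<lambda>\<eta>. LINT x|lborel. wave x \<eta> * ?P x"
  let ?p = "complex_of_real ((2 * pi) ^ CARD('n))"
  let ?w = "complex_of_real ((2 * pi) powr (- real CARD('n) / 2))"
  have p0: "?p \<noteq> 0" by simp
  have w0: "?w \<noteq> 0" by simp
  (* The two normalisations (2 pi)^(-n/2) and the inversion constant (2 pi)^n cancel. *)
  have wp: "?w * ?p * ?w = 1"
  proof -
    have "(2 * pi) powr (- real CARD('n) / 2) * (2 * pi) ^ CARD('n) * (2 * pi) powr (- real CARD('n) / 2) = 1"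
    proof -
      have "(2 * pi) ^ CARD('n) = (2 * pi) powr real CARD('n)" by (rule powr_realpow[symmetric]) simp
      moreover have "- real CARD('n) / 2 + real CARD('n) + - real CARD('n) / 2 = 0" by simp
      ultimately show ?thesis
        by (simp only: powr_add[symmetric]) simp
    qed
    then show ?thesis by (simp flip: of_real_mult)
  qed
  have ms[measurable]: "\<Phi> \<in> borel_measurable borel" by (rule schwartz_measurable[OF Phi])
  have iP: "integrable lborel ?P"
  proof -
    have "integrable lborel (\<lambda>y. \<Phi> (y - a))"
      using lborel_integrable_translation[of \<Phi> "- a"] schwartz_integrable[OF Phi] by simp
    then show ?thesis
      using lborel_integrable_scaling[of "\<lambda>y. \<Phi> (y - a)" t] t by simp
  qed
  have inner: "complex_of_real (t ^ CARD('n)) * ?G \<eta> =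
      wave a ((1 / t) *\<^sub>R \<eta>) * (inverse_fourier \<Phi> ((1 / t) *\<^sub>R \<eta>) / ?w)" for \<eta>
  proof -
    let ?\<xi> = "(1 / t) *\<^sub>R \<eta>"
    have "complex_of_real (t ^ CARD('n)) * ?G \<eta>
       = \<bar>t\<bar> ^ CARD('n) *\<^sub>R (LINT x|lborel. wave ?\<xi> (t *\<^sub>R x) * ?P x)"
    proof -
      have w: "wave ?\<xi> (t *\<^sub>R x) = wave x \<eta>" for x
        using t by (simp add: wave_scale wave_commute[of \<eta> x])
      show ?thesis unfolding w using t by (simp add: scaleR_conv_of_real)
    qed
    also have "\<dots> = (LINT y|lborel. wave ?\<xi> y * \<Phi> (y - a))"
      using t lborel_integral_scaling[of "\<lambda>y. wave ?\<xi> y * \<Phi> (y - a)" t] by simp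
    also have "\<dots> = (LINT y|lborel. wave ?\<xi> (a + y) * \<Phi> y)"
      using lborel_integral_translation[of "\<lambda>y. wave ?\<xi> y * \<Phi> (y - a)" a] by simp
    also have "\<dots> = wave a ?\<xi> * (LINT y|lborel. wave ?\<xi> y * \<Phi> y)"
      by (simp add: wave_add_right mult.assoc wave_commute[of a])
    also have "(LINT y|lborel. wave ?\<xi> y * \<Phi> y) = inverse_fourier \<Phi> ?\<xi> / ?w"
      using w0 unfolding inverse_fourier_def wave_def by (simp add: inner_commute)
    finally show ?thesis .
  qed
  have "?p * regular_distribution ?P \<phi> = (LINT x|lborel. ?P x * (?p * \<phi> x))"
    unfolding regular_distribution_def integral_mult_right_zero[symmetric] by (simp only: mult.left_commute)
  also have "\<dots> = (LINT x|lborel. LINT \<eta>|lborel. wave x \<eta> * ?P x * fourier \<phi> \<eta>)"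
    unfolding fourier_inversion[OF phi, symmetric] integral_mult_right_zero[symmetric]
    by (simp only: mult_ac)
  also have "\<dots> = (LINT \<eta>|lborel. LINT x|lborel. wave x \<eta> * ?P x * fourier \<phi> \<eta>)"
    by (rule fubini_bounded_kernel[OF iP schwartz_integrable[OF schwartz_fourier[OF phi]], symmetric])
      (auto simp: wave_def[abs_def])
  also have "\<dots> = (LINT \<eta>|lborel. ?G \<eta> * fourier \<phi> \<eta>)"
    by (simp only: integral_mult_left_zero)
  finally have A: "?p * regular_distribution ?P \<phi> =
     (LINT \<eta>|lborel. ?G \<eta> * fourier \<phi> \<eta>)" .
  let ?I = "LINT \<eta>|lborel. fourier \<phi> \<eta> * inverse_fourier \<Phi> ((1 / t) *\<^sub>R \<eta>) * wave a ((1 / t) *\<^sub>R \<eta>)"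
  have "?p * (complex_of_real (t ^ CARD('n)) * regular_distribution ?P \<phi>) =
     complex_of_real (t ^ CARD('n)) * (?p * regular_distribution ?P \<phi>)" by (simp only: mult_ac)
  also have "\<dots> = (LINT \<eta>|lborel. complex_of_real (t ^ CARD('n)) * ?G \<eta> * fourier \<phi> \<eta>)"
    unfolding A by (subst integral_mult_right_zero[symmetric]) (simp only: mult.assoc)
  also have "\<dots> = (LINT \<eta>|lborel. 1 / ?w * (fourier \<phi> \<eta> * inverse_fourier \<Phi> ((1 / t) *\<^sub>R \<eta>) * wave a ((1 / t) *\<^sub>R \<eta>)))"
    unfolding inner by (simp add: mult_ac)
  also have "\<dots> = 1 / ?w * ?I" unfolding integral_mult_right_zero ..
  finally have B: "?p * (complex_of_real (t ^ CARD('n)) * regular_distribution ?P \<phi>) = 1 / ?w * ?I" .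
  have "complex_of_real (t ^ CARD('n)) * regular_distribution ?P \<phi>
    = ?w * ?w * (?p * (complex_of_real (t ^ CARD('n)) * regular_distribution ?P \<phi>))"
    using wp by (simp only: mult.assoc[symmetric]) (simp only: mult_ac mult_1_right mult_1_left)
  also have "\<dots> = ?w * ?w * (1 / ?w * ?I)" unfolding B ..
  also have "\<dots> = ?w * ?I" using w0 by simp
  finally show ?thesis .
qed

lemma compact_support_derivatives_bounded:
  fixes \<theta> :: "real^'n::finite \<Rightarrow> complex"
  assumes "smooth \<theta>" "\<And>x. norm x > R \<Longrightarrow> \<theta> x = 0"
  obtains C where "0 \<le> C" "\<And>is x. length is \<le> L \<Longrightarrow> norm (iter_partial is \<theta> x) \<le> C"
proof -
  have s: "schwartz \<theta>" by (rule schwartz_compact_support[OF assms])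
  have "\<forall>is. \<exists>D\<ge>0. \<forall>x. norm (iter_partial is \<theta> x) \<le> D"
  proof
    fix "is"
    show "\<exists>D\<ge>0. \<forall>x. norm (iter_partial is \<theta> x) \<le> D"
      by (rule schwartzD[OF s, of 0 "is"]) auto
  qed
  from choice[OF this] obtain D where D: "\<And>is. 0 \<le> D is" "\<And>is x. norm (iter_partial is \<theta> x) \<le> D is" by blast
  show ?thesis
  proof (rule that[of "\<Sum>is | length is \<le> L. D is"])
    show "0 \<le> (\<Sum>is | length is \<le> L. D is)" by (intro sum_nonneg D)
    fix "is" :: "'n list" and x assume "length is \<le> L"
    then have "D is \<le> (\<Sum>is | length is \<le> L. D is)"
      by (intro member_le_sum) (auto simp: finite_lists_upto D)
    then show "norm (iter_partial is \<theta> x) \<le> (\<Sum>is | length is \<le> L. D is)" using D(2)[of "is" x] by linarith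
  qed
qed

text \<open>
  On the support of \<open>\<theta>\<close> the monomial grows at most exponentially in \<open>mi_abs \<beta>\<close>, uniformly in the point.
\<close>

lemma mult_monomial_derivative_bound:
  fixes \<theta> :: "real^'n::finite \<Rightarrow> complex"
  assumes th: "smooth \<theta>" and C: "\<And>is x. length is \<le> L \<Longrightarrow> norm (iter_partial is \<theta> x) \<le> C" "0 \<le> C"
    and supp: "\<And>x. norm x > R \<Longrightarrow> \<theta> x = 0" and R: "1 \<le> R" and l: "length is \<le> L"
  shows "norm (iter_partial is (\<lambda>x. \<theta> x * monomial \<beta> x) x) \<le> 2 ^ L * (C * (real (1 + mi_abs \<beta>) ^ L * R ^ mi_abs \<beta>))"
proof -
  have sm: "smooth (\<lambda>x. \<theta> x * monomial \<beta> x)" by (intro smooth_mult th smooth_monomial)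
  show ?thesis
  proof (cases "norm x \<le> R")
    case True
    have "norm (iter_partial is (\<lambda>x. \<theta> x * monomial \<beta> x) x)
        \<le> 2 ^ length is * (C * (real (1 + mi_abs \<beta>) ^ L * R ^ mi_abs \<beta>))"
    proof (rule leibniz_bound[OF th smooth_monomial])
      fix is' :: "'n list" assume l': "length is' \<le> length is"
      show "norm (iter_partial is' \<theta> x) \<le> C" using C(1) l l' by simp
      have "norm (iter_partial is' (monomial \<beta>) x) \<le> real (1 + mi_abs \<beta>) ^ length is' * R ^ mi_abs \<beta>"
        by (rule iter_partial_monomial_bound[OF R True])
      also have "\<dots> \<le> real (1 + mi_abs \<beta>) ^ L * R ^ mi_abs \<beta>"
        using l l' R by (intro mult_right_mono power_increasing) auto
      finally show "norm (iter_partial is' (monomial \<beta>) x) \<le> real (1 + mi_abs \<beta>) ^ L * R ^ mi_abs \<beta>" .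
    qed
    also have "\<dots> \<le> 2 ^ L * (C * (real (1 + mi_abs \<beta>) ^ L * R ^ mi_abs \<beta>))"
      using l R C(2) by (intro mult_right_mono power_increasing) auto
    finally show ?thesis .
  next
    case False
    have "iter_partial is (\<lambda>x. \<theta> x * monomial \<beta> x) x = 0"
    proof (rule iter_partial_eq_0[where S="{x. norm x > R}"])
      show "open {x::real^'n. R < norm x}" by (intro open_Collect_less continuous_intros)
    qed (use False supp in auto)
    then show ?thesis using R C(2) by simp
  qed
qed

text \<open>
  Up to constants the coefficient of the quark with parameters \<open>\<beta>\<close>, \<open>j\<close>, \<open>m\<close>, for \<open>\<psi>\<close> the Fourier
  transform of the test function, \<open>\<theta>\<close> the frequency cutoff, \<open>t = 2 ^ j\<close> and \<open>a = m\<close>.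
\<close>

definition band_integral ::
  "(real^'n::finite \<Rightarrow> complex) \<Rightarrow> (real^'n \<Rightarrow> complex) \<Rightarrow> nat^'n \<Rightarrow> real \<Rightarrow> real^'n \<Rightarrow> complex" where
  "band_integral \<psi> \<theta> \<beta> t a =
     (LINT \<eta>|lborel. \<psi> \<eta> * (\<theta> ((1 / t) *\<^sub>R \<eta>) * monomial \<beta> ((1 / t) *\<^sub>R \<eta>)) * wave a ((1 / t) *\<^sub>R \<eta>))"

text \<open>
  Derivatives in the lattice point are traded for derivatives of the integrand. In the scaled variable
  the frequency is \<open>a / t\<close>, so \<open>M\<close> integrations by parts cost a factor \<open>t ^ M\<close>. If \<open>\<theta>\<close> vanishes near
  the origin, the integrand lives on \<open>norm \<eta> \<ge> t / 2\<close>, where the rapid decay of \<open>\<psi>\<close> pays for any power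
  of \<open>t\<close>; for \<open>t = 1\<close> there is nothing to pay.
\<close>

lemma band_integral_bound:
  fixes \<psi> \<theta> :: "real^'n::finite \<Rightarrow> complex"
  assumes psi: "schwartz \<psi>" and th: "smooth \<theta>" and supp: "\<And>x. norm x > 2 \<Longrightarrow> \<theta> x = 0"
  obtains C where "0 \<le> C"
    "\<And>t \<beta> a. 1 \<le> t \<Longrightarrow> t = 1 \<or> (\<forall>x. norm x < 1 / 2 \<longrightarrow> \<theta> x = 0) \<Longrightarrow>
       norm (band_integral \<psi> \<theta> \<beta> t a) * t ^ N * (1 + norm a) ^ M \<le> C * real (1 + mi_abs \<beta>) ^ M * 2 ^ mi_abs \<beta>"
proof -
  obtain D where D: "0 \<le> D" "\<And>is x. length is \<le> M \<Longrightarrow> norm (iter_partial is \<theta> x) \<le> D"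
    using compact_support_derivatives_bounded[OF th supp, where L=M] by metis
  (* M extra powers of t pay for the loss t ^ M in the M integrations by parts. *)
  let ?N = "N + M"
  let ?E = "2 * CARD('n) + ?N"
  have "\<forall>is. \<exists>E\<ge>0. \<forall>x. (1 + norm x) ^ ?E * norm (iter_partial is \<psi> x) \<le> E"
  proof
    fix "is"
    show "\<exists>E\<ge>0. \<forall>x. (1 + norm x) ^ ?E * norm (iter_partial is \<psi> x) \<le> E"
      by (rule schwartzD[OF psi, of ?E "is"]) auto
  qed
  from choice[OF this] obtain E where E: "\<And>is. 0 \<le> E is" "\<And>is x. (1 + norm x) ^ ?E * norm (iter_partial is \<psi> x)
      \<le> E is" by blast
  define E' where "E' = (\<Sum>is | length is \<le> M. E is)"
  have E'0: "0 \<le> E'" unfolding E'_def by (intro sum_nonneg E)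
  have E': "norm (iter_partial is \<psi> x) \<le> E' * (decay x / (1 + norm x) ^ ?N)" if "length is \<le> M" for "is" x
  proof -
    have "E is \<le> E'" unfolding E'_def using that by (intro member_le_sum) (auto simp: finite_lists_upto E)
    then have "(1 + norm x) ^ ?E * norm (iter_partial is \<psi> x) \<le> E'" using E(2)[of x "is"] by linarith
    moreover have "0 < (1 + norm x) ^ ?E" by (intro zero_less_power add_pos_nonneg) auto
    ultimately have "norm (iter_partial is \<psi> x) \<le> E' / (1 + norm x) ^ ?E"
      by (simp only: pos_le_divide_eq mult.commute)
    also have "\<dots> = E' * (decay x / (1 + norm x) ^ ?N)" unfolding decay_def power_add by simp
    finally show ?thesis .
  qed
  define I where "I = (LINT x|lborel. decay (x::real^'n))"
  have I0: "0 \<le> I" unfolding I_def by (intro integral_nonneg_AE AE_I2 less_imp_le decay_pos)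
  define C where "C = (2 ^ M + (2 * real CARD('n)) ^ M) * (2 ^ M * (2 ^ ?N * E' * (2 ^ M * D)) * I)"
  have C0: "0 \<le> C" unfolding C_def using E'0 D(1) I0 by (intro mult_nonneg_nonneg add_nonneg_nonneg) auto
  show ?thesis
  proof (rule that[OF C0])
    fix t :: real and \<beta> :: "nat^'n" and a :: "real^'n"
    assume t: "1 \<le> t" and lo: "t = 1 \<or> (\<forall>x. norm x < 1 / 2 \<longrightarrow> \<theta> x = 0)"
    let ?V = "\<lambda>x. \<theta> x * monomial \<beta> x"
    let ?v = "\<lambda>\<eta>. ?V ((1 / t) *\<^sub>R \<eta> + 0)"
    let ?H = "\<lambda>\<eta>. \<psi> \<eta> * ?v \<eta>"
    define B where "B = real (1 + mi_abs \<beta>) ^ M * 2 ^ mi_abs \<beta>"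
    have B0: "0 \<le> B" unfolding B_def by simp
    have smV: "smooth ?V" by (intro smooth_mult th smooth_monomial)
    have smv: "smooth ?v" by (rule smooth_affine[OF smV])
    have vb: "norm (iter_partial is ?v \<eta>) \<le> 2 ^ M * (D * B)" if "length is \<le> M" for "is" \<eta>
    proof -
      have "norm (iter_partial is ?v \<eta>) = (1 / t) ^ length is * norm (iter_partial is ?V ((1 / t) *\<^sub>R \<eta> + 0))"
        using t unfolding iter_partial_affine[OF smV] by (simp add: power_abs)
      also have "\<dots> \<le> 1 * norm (iter_partial is ?V ((1 / t) *\<^sub>R \<eta> + 0))"
        using t by (intro mult_right_mono power_le_one) auto
      also have "\<dots> \<le> 2 ^ M * (D * B)"
        unfolding B_def mult_1 by (rule mult_monomial_derivative_bound[OF th D(2) D(1) supp _ that]) auto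
      finally show ?thesis .
    qed
    have sH: "schwartz ?H"
    proof (rule schwartz_mult[OF psi smv])
      fix "is" :: "'n list"
      obtain F where F: "\<And>js x. length js \<le> length is \<Longrightarrow> norm (iter_partial js \<theta> x) \<le> F" "0 \<le> F"
        using compact_support_derivatives_bounded[OF th supp, where L="length is"] by metis
      have "norm (iter_partial is ?v x) \<le> 2 ^ length is * (F * (real (1 + mi_abs \<beta>) ^ length is * 2 ^ mi_abs \<beta>))
          * (1 + norm x) ^ 0" for x
      proof -
        have "norm (iter_partial is ?v x) = (1 / t) ^ length is * norm (iter_partial is ?V ((1 / t) *\<^sub>R x + 0))"
          using t unfolding iter_partial_affine[OF smV] by (simp add: power_abs)
        also have "\<dots> \<le> 1 * norm (iter_partial is ?V ((1 / t) *\<^sub>R x + 0))"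
          using t by (intro mult_right_mono power_le_one) auto
        also have "\<dots> \<le> 2 ^ length is * (F * (real (1 + mi_abs \<beta>) ^ length is * 2 ^ mi_abs \<beta>))"
          unfolding mult_1 by (rule mult_monomial_derivative_bound[OF th F supp]) auto
        finally show ?thesis by simp
      qed
      then show "\<exists>C N. \<forall>x. norm (iter_partial is ?v x) \<le> C * (1 + norm x) ^ N" by blast
    qed
    have Hb: "norm (iter_partial is ?H \<eta>) \<le> 2 ^ M * (2 ^ ?N * E' * (2 ^ M * D)) * (B / t ^ ?N) * decay \<eta>"
      if l: "length is \<le> M" for "is" \<eta>
    proof (cases "t \<noteq> 1 \<and> norm \<eta> < t / 2")
      case True
      have "iter_partial is ?H \<eta> = 0"
      proof (rule iter_partial_eq_0[where S="ball 0 (t / 2)"])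
        fix x :: "real^'n" assume "x \<in> ball 0 (t / 2)"
        then have "norm ((1 / t) *\<^sub>R x) < 1 / 2" using t by (simp add: field_simps)
        then show "?H x = 0" using lo True by auto
      qed (use True in auto)
      then show ?thesis using E'0 D(1) B0 t decay_pos[of \<eta>] by simp
    next
      case False
      have tn: "1 / (1 + norm \<eta>) ^ ?N \<le> 2 ^ ?N / t ^ ?N"
      proof -
        have "t \<le> 2 * (1 + norm \<eta>)" using False t norm_ge_zero[of \<eta>] by argo
        then have "t ^ ?N \<le> (2 * (1 + norm \<eta>)) ^ ?N" using t by (intro power_mono) auto
        moreover have "0 < (1 + norm \<eta>) ^ ?N" by (intro zero_less_power add_pos_nonneg) auto
        moreover have "0 < t ^ ?N" using t by simp
        ultimately show ?thesis by (simp only: power_mult_distrib frac_le_eq divide_le_eq) (simp add: field_simps)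
      qed
      have "norm (iter_partial is ?H \<eta>) \<le> 2 ^ length is * (E' * (decay \<eta> / (1 + norm \<eta>) ^ ?N) * (2 ^ M * (D * B)))"
        by (rule leibniz_bound[OF schwartz_smooth[OF psi] smv]) (use E' vb l in auto)
      also have "\<dots> \<le> 2 ^ M * (E' * (decay \<eta> / (1 + norm \<eta>) ^ ?N) * (2 ^ M * (D * B)))"
        using l E'0 D(1) B0 decay_pos[of \<eta>]
        by (intro mult_right_mono power_increasing mult_nonneg_nonneg divide_nonneg_nonneg) auto
      also have "\<dots> = (2 ^ M * E' * decay \<eta> * (2 ^ M * (D * B))) * (1 / (1 + norm \<eta>) ^ ?N)" by simp
      also have "\<dots> \<le> (2 ^ M * E' * decay \<eta> * (2 ^ M * (D * B))) * (2 ^ ?N / t ^ ?N)"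
        using E'0 D(1) B0 decay_pos[of \<eta>] by (intro mult_left_mono tn mult_nonneg_nonneg) auto
      also have "\<dots> = 2 ^ M * (2 ^ ?N * E' * (2 ^ M * D)) * (B / t ^ ?N) * decay \<eta>" by simp
      finally show ?thesis .
    qed
    define K where "K = 2 ^ M * (2 ^ ?N * E' * (2 ^ M * D)) * (B / t ^ ?N)"
    have Ib: "(LINT x|lborel. norm (iter_partial is ?H x)) \<le> K * I" if "length is \<le> M" for "is"
    proof -
      have "(LINT x|lborel. norm (iter_partial is ?H x)) \<le> (LINT x|lborel. K * decay (x::real^'n))"
        using Hb[OF that] unfolding K_def[symmetric]
        by (intro integral_mono integrable_norm schwartz_integrable schwartz_iter_partial sH integrable_mult_right integrable_decay) auto
      then show ?thesis by (simp add: I_def)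
    qed
    have eq: "band_integral \<psi> \<theta> \<beta> t a = (LINT x|lborel. wave ((1 / t) *\<^sub>R a) x * ?H x)"
      unfolding band_integral_def by (simp add: wave_scale mult_ac)
    have "(1 + norm ((1 / t) *\<^sub>R a)) ^ M * norm (band_integral \<psi> \<theta> \<beta> t a)
        \<le> (2 ^ M + (2 * real CARD('n)) ^ M) * (K * I)"
      unfolding eq using Ib[of "[]"] Ib by (intro integral_wave_decay sH) auto
    also have "\<dots> = C * B / t ^ ?N" by (simp add: C_def K_def)
    finally have main: "(1 + norm ((1 / t) *\<^sub>R a)) ^ M * norm (band_integral \<psi> \<theta> \<beta> t a) \<le> C * B / t ^ ?N" .
    have "(1 + norm a) ^ M \<le> (t * (1 + norm ((1 / t) *\<^sub>R a))) ^ M"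
      using t by (intro power_mono) (auto simp: distrib_left)
    then have "(1 + norm a) ^ M * norm (band_integral \<psi> \<theta> \<beta> t a)
        \<le> t ^ M * ((1 + norm ((1 / t) *\<^sub>R a)) ^ M * norm (band_integral \<psi> \<theta> \<beta> t a))"
      unfolding power_mult_distrib mult.assoc[symmetric] by (rule mult_right_mono) simp
    also have "\<dots> \<le> t ^ M * (C * B / t ^ ?N)" using t by (intro mult_left_mono main) auto
    also have "\<dots> = C * B / t ^ N" using t by (simp add: power_add)
    finally have "(1 + norm a) ^ M * norm (band_integral \<psi> \<theta> \<beta> t a) * t ^ N \<le> C * B"
      using t by (simp add: pos_le_divide_eq)
    then show "norm (band_integral \<psi> \<theta> \<beta> t a) * t ^ N * (1 + norm a) ^ M \<le> C * real (1 + mi_abs \<beta>) ^ M * 2 ^ mi_abs \<beta>"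
      unfolding B_def by (simp add: mult_ac)
  qed
qed

section \<open>Size of the quarks and the exponential series over multi-indices\<close>

lemma quark_scaled_eq:
  "quark_scaled J k \<beta> j m =
    (\<lambda>x. (\<lambda>y. complex_of_real (k y) * monomial \<beta> ((1 / 2 ^ J) *\<^sub>R y + 0)) (2 ^ j *\<^sub>R x + - lattice_point m))"
  by (rule ext) (simp add: quark_scaled_def quark_def monomial_def mult.commute)

lemma schwartz_quark_scaled:
  fixes k :: "real^'n::finite \<Rightarrow> real"
  assumes k: "smooth k" and supp: "\<And>x. norm x > R \<Longrightarrow> k x = 0"
  shows "schwartz (quark_scaled J k \<beta> j m)"
proof (rule schwartz_compact_support)
  show "smooth (quark_scaled J k \<beta> j m)"
    unfolding quark_scaled_eq
    by (rule smooth_affine) (intro smooth_mult smooth_of_real k smooth_affine[OF smooth_monomial])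
  fix x :: "real^'n" assume x: "R + norm (lattice_point m :: real^'n) < norm x"
  have "norm (2 ^ j *\<^sub>R x) \<le> norm (2 ^ j *\<^sub>R x - lattice_point m) + norm (lattice_point m :: real^'n)"
    by (rule norm_triangle_sub[of "2 ^ j *\<^sub>R x" "lattice_point m", THEN order_trans]) simp
  moreover have "1 * norm x \<le> 2 ^ j * norm x" by (intro mult_right_mono) auto
  ultimately have "R < norm (2 ^ j *\<^sub>R x - lattice_point m)" using x by simp
  then show "quark_scaled J k \<beta> j m x = 0" unfolding quark_scaled_def quark_def using supp by simp
qed

text \<open>
  On the support, \<open>norm (2 ^ j x - m) \<le> 2 ^ J\<close>, so the monomial of \<open>2\<^sup>-\<^sup>J (2 ^ j x - m)\<close> is at most \<open>1\<close> and the
  weight \<open>1 + norm x\<close> is controlled by \<open>1 + norm m\<close>. Growth in \<open>\<beta>\<close> comes from derivatives only and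
  is polynomial.
\<close>

lemma quark_scaled_bound:
  fixes k :: "real^'n::finite \<Rightarrow> real"
  assumes k: "smooth k" and supp: "\<And>x. norm x > 2 ^ J \<Longrightarrow> k x = 0"
  obtains C where "0 \<le> C"
    "\<And>\<beta> j m is x. length is \<le> L \<Longrightarrow> (1 + norm x) ^ K * norm (iter_partial is (quark_scaled J k \<beta> j m) x)
       \<le> C * real (1 + mi_abs \<beta>) ^ L * 2 ^ (j * L) * (1 + norm (lattice_point m :: real^'n)) ^ K"
proof -
  have sk: "smooth (\<lambda>x. complex_of_real (k x))" by (rule smooth_of_real[OF k])
  obtain D where D: "0 \<le> D" "\<And>is x. length is \<le> L \<Longrightarrow> norm (iter_partial is (\<lambda>x. complex_of_real (k x)) x) \<le> D"
    using compact_support_derivatives_bounded[OF sk, where L=L and R="2 ^ J"] supp by auto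
  define C where "C = (2 ^ J + 1) ^ K * (2 ^ L * D)"
  have C0: "0 \<le> C" unfolding C_def using D by simp
  show ?thesis
  proof (rule that[OF C0])
    fix \<beta> :: "nat^'n" and j m and "is" :: "'n list" and x :: "real^'n" assume l: "length is \<le> L"
    let ?c = "1 / 2 ^ J :: real"
    let ?mo = "\<lambda>y. monomial \<beta> (?c *\<^sub>R y + 0)"
    let ?Q = "\<lambda>y. complex_of_real (k y) * ?mo y"
    let ?a = "lattice_point m :: real^'n"
    let ?y = "2 ^ j *\<^sub>R x + - ?a"
    have smo: "smooth ?mo" by (rule smooth_affine[OF smooth_monomial])
    have sQ: "smooth ?Q" by (intro smooth_mult sk smo)
    have eq: "norm (iter_partial is (quark_scaled J k \<beta> j m) x) = 2 ^ (j * length is) * norm (iter_partial is ?Q ?y)"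
      unfolding quark_scaled_eq iter_partial_affine[OF sQ] by (simp add: power_mult)
    show "(1 + norm x) ^ K * norm (iter_partial is (quark_scaled J k \<beta> j m) x)
       \<le> C * real (1 + mi_abs \<beta>) ^ L * 2 ^ (j * L) * (1 + norm ?a) ^ K"
    proof (cases "norm ?y \<le> 2 ^ J")
      case False
      have "iter_partial is ?Q ?y = 0"
      proof (rule iter_partial_eq_0[where S="{x. norm x > 2 ^ J}"])
        show "open {x::real^'n. 2 ^ J < norm x}" by (intro open_Collect_less continuous_intros)
      qed (use False supp in auto)
      then show ?thesis unfolding eq using C0 by simp
    next
      case True
      have "norm (iter_partial is ?Q ?y) \<le> 2 ^ length is * (D * real (1 + mi_abs \<beta>) ^ L)"
      proof (rule leibniz_bound[OF sk smo])
        fix is' :: "'n list" assume l': "length is' \<le> length is"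
        show "norm (iter_partial is' (\<lambda>x. complex_of_real (k x)) ?y) \<le> D" using D(2) l l' by simp
        have n: "norm (?c *\<^sub>R ?y + 0) \<le> 1" using True unfolding add_0_right norm_scaleR by simp
        have "norm (iter_partial is' ?mo ?y) = ?c ^ length is' * norm (iter_partial is' (monomial \<beta>) (?c *\<^sub>R ?y + 0))"
          unfolding iter_partial_affine[OF smooth_monomial] by (simp add: power_abs)
        also have "\<dots> \<le> 1 * (real (1 + mi_abs \<beta>) ^ length is' * 1 ^ mi_abs \<beta>)"
          by (intro mult_mono power_le_one iter_partial_monomial_bound n) auto
        also have "\<dots> \<le> real (1 + mi_abs \<beta>) ^ L"
          using l l' unfolding power_one mult_1 mult_1_right by (intro power_increasing) auto
        finally show "norm (iter_partial is' ?mo ?y) \<le> real (1 + mi_abs \<beta>) ^ L" .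
      qed
      also have "\<dots> \<le> 2 ^ L * (D * real (1 + mi_abs \<beta>) ^ L)"
        using l D by (intro mult_right_mono power_increasing) auto
      finally have 1: "norm (iter_partial is ?Q ?y) \<le> 2 ^ L * (D * real (1 + mi_abs \<beta>) ^ L)" .
      have "norm (2 ^ j *\<^sub>R x) \<le> norm (2 ^ j *\<^sub>R x - ?a) + norm ?a"
        by (rule norm_triangle_sub[of "2 ^ j *\<^sub>R x" ?a, THEN order_trans]) simp
      moreover have "1 * norm x \<le> 2 ^ j * norm x" by (intro mult_right_mono) auto
      ultimately have "norm x \<le> 2 ^ J + norm ?a" using True by simp
      moreover have "(2::real) ^ J * norm ?a \<ge> 0" by simp
      moreover have "(2 ^ J + 1) * (1 + norm ?a) = 1 + (2 ^ J + norm ?a) + 2 ^ J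
          * norm ?a" by (simp add: algebra_simps)
      ultimately have "1 + norm x \<le> (2 ^ J + 1) * (1 + norm ?a)" by linarith
      then have 2: "(1 + norm x) ^ K \<le> ((2 ^ J + 1) * (1 + norm ?a)) ^ K" by (intro power_mono) auto
      have "(1 + norm x) ^ K * norm (iter_partial is (quark_scaled J k \<beta> j m) x) \<le>
         ((2 ^ J + 1) * (1 + norm ?a)) ^ K * (2 ^ (j * L) * (2 ^ L * (D * real (1 + mi_abs \<beta>) ^ L)))"
        unfolding eq using l by (intro mult_mono 2 1 power_increasing mult_nonneg_nonneg zero_le_power add_nonneg_nonneg) auto
      also have "\<dots> = C * real (1 + mi_abs \<beta>) ^ L * 2 ^ (j * L) * (1 + norm ?a) ^ K"
        unfolding C_def power_mult_distrib by (simp add: mult_ac)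
      finally show ?thesis .
    qed
  qed
qed

lemma summable_on_triple:
  fixes b :: "'a \<Rightarrow> real" and c :: "'b \<Rightarrow> real" and e :: "'c \<Rightarrow> real"
  assumes b: "b summable_on UNIV" "\<And>i. 0 \<le> b i" and c: "c summable_on UNIV" "\<And>i. 0 \<le> c i"
    and e: "e summable_on UNIV" "\<And>i. 0 \<le> e i"
  shows "(\<lambda>(i, j, m). b i * (c j * e m)) summable_on UNIV"
proof -
  have pair: "(\<lambda>(i, j). u i * v j) summable_on UNIV"
    if u: "u summable_on UNIV" "\<And>i. 0 \<le> u i" and v: "v summable_on UNIV" "\<And>i. 0 \<le> v i"
    for u :: "'x \<Rightarrow> real" and v :: "'y \<Rightarrow> real"
  proof -
    have "(\<lambda>(i, j). u i * v j) summable_on (Sigma UNIV (\<lambda>_. UNIV))"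
    proof (rule summable_on_SigmaI)
      show "((\<lambda>j. (case (i, j) of (i, j) \<Rightarrow> u i * v j)) has_sum (u i * infsum v UNIV)) UNIV" for i
        using has_sum_cmult_right[OF has_sum_infsum[OF v(1)]] by simp
      show "(\<lambda>i. u i * infsum v UNIV) summable_on UNIV" by (rule summable_on_cmult_left[OF u(1)])
    qed (use u v in auto)
    then show ?thesis by simp
  qed
  have "(\<lambda>(i, p). b i * (\<lambda>(j, m). c j * e m) p) summable_on UNIV"
    by (rule pair[OF b pair[OF c e]]) (use c e in auto)
  then show ?thesis by (simp add: case_prod_beta')
qed

lemma summable_multi_exp:
  "(\<lambda>\<beta>::nat^'n::finite. A ^ mi_abs \<beta> / real (mi_fact \<beta>)) summable_on UNIV" if "0 \<le> A" for A :: real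
proof -
  have "summable (\<lambda>n. A ^ n / fact n)" using summable_exp[of A] by (simp add: divide_inverse mult.commute)
  then have "(\<lambda>n. A ^ n / fact n) summable_on UNIV"
    by (subst summable_on_UNIV_nonneg_real_iff) (use that in auto)
  then have "(\<lambda>\<beta>::nat^'n. \<Prod>l\<in>UNIV. A ^ (\<beta> $ l) / fact (\<beta> $ l)) summable_on UNIV"
    using that by (intro summable_on_prod_vec[of "\<lambda>_ n. A ^ n / fact n"]) auto
  then show ?thesis by (simp add: mi_abs_def mi_fact_def prod_dividef power_sum)
qed

text \<open>
  The product over the coordinates of the exponential series.
\<close>

lemma has_sum_multi_exp:
  fixes w :: "'n::finite \<Rightarrow> complex"
  shows "((\<lambda>\<beta>::nat^'n. \<Prod>l\<in>UNIV. w l ^ (\<beta> $ l) / fact (\<beta> $ l)) has_sum (\<Prod>l\<in>UNIV. exp (w l))) UNIV"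
proof -
  let ?P = "\<lambda>\<beta>::nat^'n. \<Prod>l\<in>UNIV. w l ^ (\<beta> $ l) / fact (\<beta> $ l)"
  have s: "(\<lambda>n. norm (w l ^ n / fact n)) summable_on UNIV" for l
  proof -
    have "summable (\<lambda>n. norm (w l) ^ n / fact n)" using summable_exp[of "norm (w l)"] by (simp add: divide_inverse mult.commute)
    then show ?thesis by (subst summable_on_UNIV_nonneg_real_iff) (auto simp: norm_divide norm_power)
  qed
  have e: "infsum (\<lambda>n. w l ^ n / fact n) UNIV = exp (w l)" for l
  proof -
    have "(\<lambda>n. w l ^ n / fact n) sums infsum (\<lambda>n. w l ^ n / fact n) UNIV"
      by (rule has_sum_imp_sums[OF has_sum_infsum[OF abs_summable_summable[OF s]]])
    moreover have "(\<lambda>n. w l ^ n / fact n) sums exp (w l)"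
      using exp_converges[of "w l"] by (simp add: scaleR_conv_of_real divide_inverse mult.commute)
    ultimately show ?thesis by (rule sums_unique2)
  qed
  have "(\<lambda>\<beta>::nat^'n. \<Prod>l\<in>UNIV. norm (w l ^ (\<beta> $ l) / fact (\<beta> $ l))) summable_on UNIV"
    by (rule summable_on_prod_vec[of "\<lambda>l n. norm (w l ^ n / fact n)"]) (auto simp: s)
  then have "(\<lambda>\<beta>::nat^'n. norm (\<Prod>l\<in>UNIV. w l ^ (\<beta> $ l) / fact (\<beta> $ l))) summable_on UNIV"
    by (simp add: prod_norm)
  then have h: "(?P has_sum
      infsum ?P UNIV) UNIV"
    by (intro has_sum_infsum) (rule abs_summable_summable)
  have "infsum ?P UNIV
     = infsum (\<lambda>g. \<Prod>l\<in>UNIV. w l ^ g l / fact (g l)) UNIV"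
    by (rule infsum_reindex_bij_witness[where i="\<lambda>g. \<chi> l. g l" and j="vec_nth"]) auto
  also have "\<dots> = infsum (\<lambda>g. \<Prod>l\<in>UNIV. w l ^ g l / fact (g l)) (PiE UNIV (\<lambda>_. UNIV))"
    by (simp add: PiE_UNIV_domain)
  also have "\<dots> = (\<Prod>l\<in>UNIV. infsum (\<lambda>n. w l ^ n / fact n) UNIV)"
    by (rule infsum_prod_PiE_abs) (auto simp: s)
  also have "\<dots> = (\<Prod>l\<in>UNIV. exp (w l))" unfolding e ..
  finally show ?thesis using h by simp
qed

text \<open>
  The powers of \<open>2 ^ J\<close> in the coefficient and in the quark cancel, and the multinomial exponential series
  of \<open>\<i> z \<cdot> \<xi>\<close> remains.
\<close>

lemma quark_coeff_series:
  fixes z \<xi> :: "real^'n::finite"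
  shows "((\<lambda>\<beta>. quark_coeff J \<beta> * monomial \<beta> ((1 / 2 ^ J) *\<^sub>R z) * monomial \<beta> \<xi>) has_sum wave z \<xi>) UNIV"
proof -
  let ?w = "\<lambda>l. \<i> * complex_of_real (z $ l * \<xi> $ l)"
  have t: "quark_coeff J \<beta> * monomial \<beta> ((1 / 2 ^ J) *\<^sub>R z) * monomial \<beta> \<xi>
      = (\<Prod>l\<in>UNIV. ?w l ^ (\<beta> $ l) / fact (\<beta> $ l))" for \<beta>
  proof -
    have "quark_coeff J \<beta> = (\<Prod>l\<in>UNIV. (\<i> * 2 ^ J) ^ (\<beta> $ l) / fact (\<beta> $ l))"
      unfolding quark_coeff_def mi_abs_def mi_fact_def prod_dividef
      by (simp add: power_sum power_mult_distrib prod.distrib flip: power_mult)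
        (simp add: power_sum sum_distrib_left)
    then have "quark_coeff J \<beta> * monomial \<beta> ((1 / 2 ^ J) *\<^sub>R z) * monomial \<beta> \<xi> =
       (\<Prod>l\<in>UNIV. (\<i> * 2 ^ J) ^ (\<beta> $ l) / fact (\<beta> $ l) * complex_of_real (1 / 2 ^ J * z $ l) ^ (\<beta> $ l) * complex_of_real (\<xi> $ l) ^ (\<beta> $ l))"
      unfolding monomial_prod by (simp only: prod.distrib vector_scaleR_component real_scaleR_def)
    also have "\<dots> = (\<Prod>l\<in>UNIV. ?w l ^ (\<beta> $ l) / fact (\<beta> $ l))"
    proof (intro prod.cong refl)
      fix l
      have "?w l = \<i> * 2 ^ J * complex_of_real (1 / 2 ^ J * z $ l) * complex_of_real (\<xi> $ l)" by simp
      then show "(\<i> * 2 ^ J) ^ (\<beta> $ l) / fact (\<beta> $ l) * complex_of_real (1 / 2 ^ J * z $ l) ^ (\<beta> $ l)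
          * complex_of_real (\<xi> $ l) ^ (\<beta> $ l) = ?w l ^ (\<beta> $ l) / fact (\<beta> $ l)"
        by (simp only: power_mult_distrib) simp
    qed
    finally show ?thesis .
  qed
  have "(\<Prod>l\<in>UNIV. exp (?w l)) = wave z \<xi>"
    unfolding wave_def inner_vec_def by (simp add: exp_sum[symmetric] sum_distrib_left)
  with has_sum_multi_exp[of ?w] show ?thesis unfolding t by simp
qed

lemma norm_quark_coeff: "norm (quark_coeff J \<beta>) = (2 ^ J) ^ mi_abs \<beta> / real (mi_fact \<beta>)"
  unfolding quark_coeff_def by (simp add: norm_mult norm_divide norm_power power_mult)

section \<open>The quark expansion of a test function\<close>

text \<open>
  The cutoff \<open>\<phi>\<^sub>0\<close> for \<open>j = 0\<close>; for \<open>j > 0\<close> the function supported in the annulus, with the same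
  profile for all these \<open>j\<close>.
\<close>

definition band :: "(real^'n::finite \<Rightarrow> real) \<Rightarrow> nat \<Rightarrow> real^'n \<Rightarrow> complex" where
  "band \<phi>\<^sub>0 j x = complex_of_real (if j = 0 then \<phi>\<^sub>0 x else \<phi>\<^sub>0 x - \<phi>\<^sub>0 (2 *\<^sub>R x))"

text \<open>
  The numbers \<open>2 ^ (j n) (\<Phi>\<^sub>\<beta>\<^sub>j\<^sub>m, \<phi>)\<close>, as \<open>wavelet_pairing\<close> shows. They depend on \<open>\<Phi>\<^sub>F\<close> and \<open>\<Phi>\<^sub>M\<close>
  only through the cutoff.
\<close>

definition wavelet_coeff ::
  "nat \<Rightarrow> (real^'n::finite \<Rightarrow> real) \<Rightarrow> (real^'n \<Rightarrow> complex) \<Rightarrow> nat^'n \<Rightarrow> nat \<Rightarrow> int^'n \<Rightarrow> complex" where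
  "wavelet_coeff J \<phi>\<^sub>0 \<phi> \<beta> j m = complex_of_real (1 / (2 * pi) ^ CARD('n)) * quark_coeff J \<beta> *
     band_integral (fourier \<phi>) (band \<phi>\<^sub>0 j) \<beta> (2 ^ j) (lattice_point m)"

lemma smooth_band:
  assumes "smooth \<phi>\<^sub>0" shows "smooth (band \<phi>\<^sub>0 j)"
proof -
  have "smooth (\<lambda>x. \<phi>\<^sub>0 x - \<phi>\<^sub>0 (2 *\<^sub>R x + 0))"
    by (intro smooth_diff assms smooth_affine)
  then show ?thesis unfolding band_def[abs_def] using assms
    by (cases "j = 0") (simp_all del: of_real_diff add: smooth_of_real)
qed

lemma band_outside:
  assumes "\<And>x. norm x \<ge> 3 / 2 \<Longrightarrow> \<phi>\<^sub>0 x = 0" "norm x > 2" shows "band \<phi>\<^sub>0 j x = 0"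
  using assms unfolding band_def by simp

lemma band_inside:
  assumes "\<And>x. norm x \<le> 1 \<Longrightarrow> \<phi>\<^sub>0 x = 1" "norm x < 1 / 2" "j \<noteq> 0" shows "band \<phi>\<^sub>0 j x = 0"
  using assms(1)[of x] assms(1)[of "2 *\<^sub>R x"] assms(2,3) unfolding band_def by simp

text \<open>
  The dyadic resolution of unity.
\<close>

lemma band_telescope:
  "(\<Sum>j<Suc N. band \<phi>\<^sub>0 j ((1 / 2 ^ j) *\<^sub>R x)) = complex_of_real (\<phi>\<^sub>0 ((1 / 2 ^ N) *\<^sub>R x))"
proof (induction N)
  case (Suc N)
  have "2 *\<^sub>R ((1 / 2 ^ Suc N) *\<^sub>R x) = (1 / 2 ^ N) *\<^sub>R x" by simp
  then have "band \<phi>\<^sub>0 (Suc N) ((1 / 2 ^ Suc N) *\<^sub>R x)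
      = complex_of_real (\<phi>\<^sub>0 ((1 / 2 ^ Suc N) *\<^sub>R x)) - complex_of_real (\<phi>\<^sub>0 ((1 / 2 ^ N) *\<^sub>R x))"
    unfolding band_def by simp
  with Suc show ?case by (subst sum.lessThan_Suc) simp
qed (simp add: band_def)

lemma wavelet_pairing:
  fixes \<omega> \<phi>\<^sub>0 :: "real^'n::finite \<Rightarrow> real"
  assumes om: "smooth \<omega>" "closure {x. \<omega> x \<noteq> 0} \<subseteq> {x. \<forall>l. - pi < x $ l \<and> x $ l < pi}" "\<And>x. norm x \<le> 2 \<Longrightarrow> \<omega> x = 1"
    and phi0: "\<And>x. norm x \<ge> 3 / 2 \<Longrightarrow> \<phi>\<^sub>0 x = 0"
    and F: "schwartz (\<Phi>\<^sub>F \<beta>)" "\<And>x. inverse_fourier (\<Phi>\<^sub>F \<beta>) x = complex_of_real (\<phi>\<^sub>0 x) * Omega_mi J \<omega> \<beta> x"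
    and M: "schwartz (\<Phi>\<^sub>M \<beta>)" "\<And>x. inverse_fourier (\<Phi>\<^sub>M \<beta>) x
        = complex_of_real (\<phi>\<^sub>0 x - \<phi>\<^sub>0 (2 *\<^sub>R x)) * Omega_mi J \<omega> \<beta> x"
    and phi: "schwartz \<phi>"
  shows "2 ^ (j * CARD('n)) * regular_distribution (wavelet_scaled \<Phi>\<^sub>F \<Phi>\<^sub>M \<beta> j m) \<phi> = wavelet_coeff J \<phi>\<^sub>0 \<phi> \<beta> j m"
proof -
  let ?w = "complex_of_real ((2 * pi) powr (- real CARD('n) / 2))"
  let ?t = "2 ^ j :: real"
  define \<Phi> where "\<Phi> = (if j = 0 then \<Phi>\<^sub>F \<beta> else \<Phi>\<^sub>M \<beta>)"
  have sP: "schwartz \<Phi>" unfolding \<Phi>_def using F M by simp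
  have ws: "wavelet_scaled \<Phi>\<^sub>F \<Phi>\<^sub>M \<beta> j m = (\<lambda>x. \<Phi> (?t *\<^sub>R x - lattice_point m))"
    by (rule ext) (simp add: wavelet_scaled_def \<Phi>_def)
  have inv: "inverse_fourier \<Phi> x = ?w * quark_coeff J \<beta> * (band \<phi>\<^sub>0 j x * monomial \<beta> x)" for x
  proof (cases "norm x \<le> 2")
    case True
    have "inverse_fourier \<Phi> x = band \<phi>\<^sub>0 j x * Omega_mi J \<omega> \<beta> x"
      unfolding \<Phi>_def band_def using F M by simp
    then show ?thesis by (simp only: Omega_mi_eq[OF om True] mult_ac)
  next
    case False
    have "inverse_fourier \<Phi> x = band \<phi>\<^sub>0 j x * Omega_mi J \<omega> \<beta> x"
      unfolding \<Phi>_def band_def using F M by simp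
    then show ?thesis using band_outside[of \<phi>\<^sub>0 x j] phi0 False by simp
  qed
  have ww: "?w * ?w = complex_of_real (1 / (2 * pi) ^ CARD('n))"
  proof -
    have "(2 * pi) ^ CARD('n) = (2 * pi) powr real CARD('n)" by (rule powr_realpow[symmetric]) simp
    moreover have "- real CARD('n) / 2 + - real CARD('n) / 2 = - real CARD('n)" by simp
    ultimately have "(2 * pi) powr (- real CARD('n) / 2) * (2 * pi) powr (- real CARD('n) / 2)
        = 1 / (2 * pi) ^ CARD('n)"
      by (simp only: powr_add[symmetric] powr_minus_divide)
    then show ?thesis by (simp only: of_real_mult[symmetric])
  qed
  have "complex_of_real (?t ^ CARD('n)) * regular_distribution (\<lambda>x. \<Phi> (?t *\<^sub>R x - lattice_point m)) \<phi> =
    ?w * (LINT \<eta>|lborel. fourier \<phi> \<eta> * inverse_fourier \<Phi> ((1 / ?t) *\<^sub>R \<eta>) * wave (lattice_point m) ((1 / ?t) *\<^sub>R \<eta>))"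
    by (rule pairing_dilated[OF sP phi]) simp
  also have "\<dots> = ?w * (LINT \<eta>|lborel. ?w * quark_coeff J \<beta> * (fourier \<phi> \<eta> * (band \<phi>\<^sub>0 j ((1 / ?t) *\<^sub>R \<eta>)
      * monomial \<beta> ((1 / ?t) *\<^sub>R \<eta>)) * wave (lattice_point m) ((1 / ?t) *\<^sub>R \<eta>)))"
    unfolding inv by (simp only: mult_ac)
  also have "\<dots> = ?w * ?w * quark_coeff J \<beta> * band_integral (fourier \<phi>) (band \<phi>\<^sub>0 j) \<beta> ?t (lattice_point m)"
    unfolding integral_mult_right_zero band_integral_def by (simp only: mult.assoc)
  finally show ?thesis unfolding ws wavelet_coeff_def ww by (simp add: power_mult)
qed

text \<open>
  Absolute convergence of the expansion in every Schwartz seminorm. The coefficients are estimated with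
  \<open>L + 1\<close> powers of \<open>2\<^sup>-\<^sup>j\<close>, one more than the derivatives of the quark consume, and with
  \<open>K + 2 n\<close> powers of \<open>1 / (1 + norm m)\<close>, of which the weight consumes \<open>K\<close>. Everything that
  grows with \<open>\<beta>\<close> is at most exponential and is beaten by \<open>1 / \<beta>!\<close>.
\<close>

lemma weighted_summable:
  fixes k \<phi>\<^sub>0 :: "real^'n::finite \<Rightarrow> real"
  assumes k: "smooth k" "\<And>x. norm x > 2 ^ J \<Longrightarrow> k x = 0"
    and phi0: "smooth \<phi>\<^sub>0" "\<And>x. norm x \<le> 1 \<Longrightarrow> \<phi>\<^sub>0 x = 1" "\<And>x. norm x \<ge> 3 / 2 \<Longrightarrow> \<phi>\<^sub>0 x = 0"
    and phi: "schwartz \<phi>"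
  obtains W where "W summable_on UNIV"
    "\<And>\<beta> j m is x. length is \<le> L \<Longrightarrow>
       (1 + norm x) ^ K * norm (wavelet_coeff J \<phi>\<^sub>0 \<phi> \<beta> j m * iter_partial is (quark_scaled J k \<beta> j m) x) \<le> W (\<beta>, j, m)"
proof -
  let ?M = "K + 2 * CARD('n)" and ?N = "L + 1"
  let ?B = "\<lambda>j. band_integral (fourier \<phi>) (band \<phi>\<^sub>0 j)"
  have bo: "band \<phi>\<^sub>0 j x = 0" if "norm x > 2" for j x using band_outside[of \<phi>\<^sub>0 x j] phi0(3) that by blast
  obtain C0 where C0: "0 \<le> C0" "\<And>t \<beta> a. 1 \<le> t \<Longrightarrow> t = 1 \<or> (\<forall>x. norm x < 1 / 2 \<longrightarrow> band \<phi>\<^sub>0 0 x = 0) \<Longrightarrow>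
      norm (?B 0 \<beta> t a) * t ^ ?N * (1 + norm a) ^ ?M \<le> C0 * real (1 + mi_abs \<beta>) ^ ?M * 2 ^ mi_abs \<beta>"
    using band_integral_bound[OF schwartz_fourier[OF phi] smooth_band[OF phi0(1), of 0] bo, where N="?N" and M="?M"] by metis
  obtain C1 where C1: "0 \<le> C1" "\<And>t \<beta> a. 1 \<le> t \<Longrightarrow> t = 1 \<or> (\<forall>x. norm x < 1 / 2 \<longrightarrow> band \<phi>\<^sub>0 1 x = 0) \<Longrightarrow>
      norm (?B 1 \<beta> t a) * t ^ ?N * (1 + norm a) ^ ?M \<le> C1 * real (1 + mi_abs \<beta>) ^ ?M * 2 ^ mi_abs \<beta>"
    using band_integral_bound[OF schwartz_fourier[OF phi] smooth_band[OF phi0(1), of 1] bo, where N="?N" and M="?M"] by metis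
  obtain D where D: "0 \<le> D" "\<And>\<beta> j m is x. length is \<le> L
      \<Longrightarrow> (1 + norm x) ^ K * norm (iter_partial is (quark_scaled J k \<beta> j m) x)
       \<le> D * real (1 + mi_abs \<beta>) ^ L * 2 ^ (j * L) * (1 + norm (lattice_point m :: real^'n)) ^ K"
    using quark_scaled_bound[OF k] by metis
  let ?P = "?M + L"
  (* The three exponential bases: the coefficient, the cutoff of radius 2, and the polynomial in
     mi_abs \<beta>, which is bounded by 1 + b \<le> 2 ^ b. *)
  define A where "A = (2 ^ J * 2 * 2 ^ ?P :: real)"
  define c where "c = 1 / (2 * pi) ^ CARD('n)"
  have c0: "0 \<le> c" unfolding c_def by simp
  have Bb: "norm (?B j \<beta> (2 ^ j) a) * (2 ^ j) ^ ?N * (1 + norm a) ^ ?M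
      \<le> (C0 + C1) * (real (1 + mi_abs \<beta>) ^ ?M * 2 ^ mi_abs \<beta>)" for j \<beta> a
  proof (cases "j = 0")
    case True
    have "norm (?B j \<beta> (2 ^ j) a) * (2 ^ j) ^ ?N * (1 + norm a) ^ ?M \<le> C0 * (real (1 + mi_abs \<beta>) ^ ?M * 2 ^ mi_abs \<beta>)"
      using C0(2)[of 1 \<beta> a] True by (simp add: mult.assoc)
    also have "\<dots> \<le> (C0 + C1) * (real (1 + mi_abs \<beta>) ^ ?M * 2 ^ mi_abs \<beta>)"
      using C1(1) by (intro mult_right_mono) auto
    finally show ?thesis .
  next
    case False
    have b1: "band \<phi>\<^sub>0 j = band \<phi>\<^sub>0 1" using False by (simp add: band_def fun_eq_iff)
    have "\<forall>x. norm x < 1 / 2 \<longrightarrow> band \<phi>\<^sub>0 1 x = 0" using band_inside[of \<phi>\<^sub>0 _ 1] phi0(2) by auto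
    then have "norm (?B j \<beta> (2 ^ j) a) * (2 ^ j) ^ ?N * (1 + norm a) ^ ?M
        \<le> C1 * (real (1 + mi_abs \<beta>) ^ ?M * 2 ^ mi_abs \<beta>)"
      using C1(2)[of "2 ^ j" \<beta> a] unfolding b1 by (simp add: mult.assoc)
    also have "\<dots> \<le> (C0 + C1) * (real (1 + mi_abs \<beta>) ^ ?M * 2 ^ mi_abs \<beta>)"
      using C0(1) by (intro mult_right_mono) auto
    finally show ?thesis .
  qed
  define E where "E = c * (C0 + C1) * D"
  have E0: "0 \<le> E" unfolding E_def using c0 C0(1) C1(1) D(1) by simp
  define W where "W = (\<lambda>(\<beta>::nat^'n, j::nat, m::int^'n). E * ((A ^ mi_abs \<beta> / real (mi_fact \<beta>)) * ((1 / 2) ^ j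
      * decay (lattice_point m :: real^'n))))"
  show ?thesis
  proof (rule that[of W])
    have A0: "0 \<le> A" unfolding A_def by simp
    have geo: "(\<lambda>j. (1 / 2 :: real) ^ j) summable_on UNIV"
      by (subst summable_on_UNIV_nonneg_real_iff) (auto intro!: summable_geometric)
    have "(\<lambda>(\<beta>, j, m). (A ^ mi_abs \<beta> / real (mi_fact \<beta>)) * ((1 / 2) ^ j * decay (lattice_point m :: real^'n)))
        summable_on (UNIV :: ((nat^'n) \<times> nat \<times> (int^'n)) set)"
      by (rule summable_on_triple[OF summable_multi_exp[OF A0] _ geo _ summable_decay_lattice])
        (auto intro!: divide_nonneg_nonneg zero_le_power A0 less_imp_le[OF decay_pos])
    from summable_on_cmult_right[OF this, of E]
    show "W summable_on UNIV" unfolding W_def by (simp add: case_prod_beta')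
  next
    fix \<beta> :: "nat^'n" and j :: nat and m :: "int^'n" and "is" :: "'n list" and x :: "real^'n"
    assume l: "length is \<le> L"
    let ?a = "lattice_point m :: real^'n"
    let ?b = "real (1 + mi_abs \<beta>)"
    let ?q = "norm (iter_partial is (quark_scaled J k \<beta> j m) x)"
    have pos: "0 < (1 + norm ?a) ^ n" for n by (intro zero_less_power add_pos_nonneg) auto
    have 1: "norm (?B j \<beta> (2 ^ j) ?a) \<le> (C0 + C1) * (?b ^ ?M * 2 ^ mi_abs \<beta>) / ((2 ^ j) ^ ?N * (1 + norm ?a) ^ ?M)"
      using Bb[of j \<beta> ?a] pos[of ?M] by (subst pos_le_divide_eq) (auto simp: mult.assoc)
    have bb: "?b ^ ?M * ?b ^ L \<le> (2 ^ ?P) ^ mi_abs \<beta>"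
    proof -
      have "1 + mi_abs \<beta> \<le> 2 ^ mi_abs \<beta>" using less_exp[of "mi_abs \<beta>"] by linarith
      then have "?b \<le> 2 ^ mi_abs \<beta>" by (metis of_nat_le_iff of_nat_numeral of_nat_power)
      then have "?b ^ ?P \<le> (2 ^ mi_abs \<beta>) ^ ?P" by (intro power_mono) auto
      also have "\<dots> = (2 ^ ?P) ^ mi_abs \<beta>" by (simp only: power_mult[symmetric] mult.commute)
      finally show ?thesis by (simp only: power_add)
    qed
    have "(1 + norm x) ^ K * norm (wavelet_coeff J \<phi>\<^sub>0 \<phi> \<beta> j m * iter_partial is (quark_scaled J k \<beta> j m) x)
      = c * norm (quark_coeff J \<beta>) * norm (?B j \<beta> (2 ^ j) ?a) * ((1 + norm x) ^ K * ?q)"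
      unfolding wavelet_coeff_def c_def by (simp add: norm_mult norm_power norm_divide mult_ac)
    also have "\<dots> \<le> c * norm (quark_coeff J \<beta>) * ((C0 + C1) * (?b ^ ?M * 2 ^ mi_abs \<beta>) / ((2 ^ j) ^ ?N * (1
        + norm ?a) ^ ?M)) *
        (D * ?b ^ L * 2 ^ (j * L) * (1 + norm ?a) ^ K)"
      using c0 C0(1) C1(1) by (intro mult_mono mult_left_mono 1 D(2) l mult_nonneg_nonneg divide_nonneg_nonneg) auto
    also have "\<dots> = E * ((2 ^ J) ^ mi_abs \<beta> * 2 ^ mi_abs \<beta> * (?b ^ ?M * ?b ^ L) / real (mi_fact \<beta>)) *
       (2 ^ (j * L) / (2 ^ j) ^ ?N) * ((1 + norm ?a) ^ K / (1 + norm ?a) ^ ?M)"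
      unfolding norm_quark_coeff E_def
      by (simp only: times_divide_eq_left times_divide_eq_right divide_divide_eq_left divide_divide_eq_right mult_ac)
    also have "2 ^ (j * L) / (2 ^ j) ^ ?N = (1 / 2 :: real) ^ j"
      by (simp add: power_mult power_add power_divide)
    also have "(1 + norm ?a) ^ K / (1 + norm ?a) ^ ?M = decay ?a"
      unfolding decay_def power_add using pos[of K] by simp
    also have "E * ((2 ^ J) ^ mi_abs \<beta> * 2 ^ mi_abs \<beta> * (?b ^ ?M * ?b ^ L) / real (mi_fact \<beta>)) * (1 / 2) ^ j
        * decay ?a
      \<le> E * ((2 ^ J) ^ mi_abs \<beta> * 2 ^ mi_abs \<beta> * (2 ^ ?P) ^ mi_abs \<beta> / real (mi_fact \<beta>)) * (1 / 2) ^ j * decay ?a"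
      using E0 by (intro mult_right_mono mult_left_mono divide_right_mono bb less_imp_le[OF decay_pos]) auto
    also have "\<dots> = W (\<beta>, j, m)"
      unfolding W_def A_def power_mult_distrib by simp
    finally show "(1 + norm x) ^ K * norm (wavelet_coeff J \<phi>\<^sub>0 \<phi> \<beta> j m
        * iter_partial is (quark_scaled J k \<beta> j m) x) \<le> W (\<beta>, j, m)" .
  qed
qed

text \<open>
  The Littlewood--Paley piece of \<open>\<phi>\<close> with frequencies of size about \<open>2 ^ j\<close>.
\<close>

definition band_part :: "(real^'n::finite \<Rightarrow> real) \<Rightarrow> (real^'n \<Rightarrow> complex) \<Rightarrow> nat \<Rightarrow> real^'n \<Rightarrow> complex" where
  "band_part \<phi>\<^sub>0 \<phi> j x = complex_of_real (1 / (2 * pi) ^ CARD('n)) *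
     (LINT \<eta>|lborel. wave x \<eta> * fourier \<phi> \<eta> * band \<phi>\<^sub>0 j ((1 / 2 ^ j) *\<^sub>R \<eta>))"

text \<open>
  Summing over \<open>\<beta>\<close> under the integral produces the character \<open>exp (\<i> (2 ^ j x - m) \<cdot> \<xi>)\<close> with \<open>\<xi> = 2\<^sup>-\<^sup>j \<eta>\<close>.
  It undoes the modulation by \<open>m\<close>, so the lattice point survives in the factor \<open>k (2 ^ j x - m)\<close> only.
\<close>

lemma sum_over_moments:
  fixes k \<phi>\<^sub>0 :: "real^'n::finite \<Rightarrow> real"
  assumes phi0: "smooth \<phi>\<^sub>0" "\<And>x. norm x \<ge> 3 / 2 \<Longrightarrow> \<phi>\<^sub>0 x = 0"
    and phi: "schwartz \<phi>"
  shows "((\<lambda>\<beta>. wavelet_coeff J \<phi>\<^sub>0 \<phi> \<beta> j m * quark_scaled J k \<beta> j m x) has_sum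
     complex_of_real (k (2 ^ j *\<^sub>R x - lattice_point m)) * band_part \<phi>\<^sub>0 \<phi> j x) UNIV"
proof -
  let ?t = "2 ^ j :: real"
  let ?a = "lattice_point m :: real^'n"
  let ?z = "?t *\<^sub>R x - ?a"
  let ?kz = "complex_of_real (k ?z)"
  let ?c = "complex_of_real (1 / (2 * pi) ^ CARD('n))"
  have bo: "band \<phi>\<^sub>0 j y = 0" if "norm y > 2" for y using band_outside[of \<phi>\<^sub>0 y j] phi0(2) that by blast
  have sb: "smooth (band \<phi>\<^sub>0 j)" by (rule smooth_band[OF phi0(1)])
  obtain C where C: "0 \<le> C" "\<And>y. norm (band \<phi>\<^sub>0 j y) \<le> C"
  proof -
    obtain C where C: "0 \<le> C" "\<And>is y. length is \<le> 0 \<Longrightarrow> norm (iter_partial is (band \<phi>\<^sub>0 j) y) \<le> C"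
      using compact_support_derivatives_bounded[OF sb bo, where L=0] by metis
    show ?thesis using that[OF C(1)] C(2)[of "[]"] by simp
  qed
  (* x is arbitrary here, so the monomial of the quark need not be bounded by 1. *)
  define Z where "Z = max 1 (norm ((1 / 2 ^ J) *\<^sub>R ?z))"
  have Z: "1 \<le> Z" "norm ((1 / 2 ^ J) *\<^sub>R ?z) \<le> Z" unfolding Z_def by auto
  let ?f = "\<lambda>\<beta> \<eta>. quark_coeff J \<beta> * monomial \<beta> ((1 / 2 ^ J) *\<^sub>R ?z) * (fourier \<phi> \<eta> * (band \<phi>\<^sub>0 j ((1 / ?t) *\<^sub>R \<eta>)
      * monomial \<beta> ((1 / ?t) *\<^sub>R \<eta>)) * wave ?a ((1 / ?t) *\<^sub>R \<eta>))"
  let ?F = "\<lambda>\<eta>. wave x \<eta> * fourier \<phi> \<eta> * band \<phi>\<^sub>0 j ((1 / ?t) *\<^sub>R \<eta>)"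
  let ?B = "\<lambda>\<beta>::nat^'n. (2 ^ J * Z * 2) ^ mi_abs \<beta> / real (mi_fact \<beta>)"
  have iF: "integrable lborel (\<lambda>\<eta>. C * norm (fourier \<phi> \<eta>))"
    by (intro integrable_mult_right integrable_norm schwartz_integrable schwartz_fourier phi)
  have fb: "norm (?f \<beta> \<eta>) \<le> ?B \<beta> * (C * norm (fourier \<phi> \<eta>))" for \<beta> \<eta>
  proof -
    let ?y = "(1 / ?t) *\<^sub>R \<eta>"
    have 1: "norm (band \<phi>\<^sub>0 j ?y * monomial \<beta> ?y) \<le> C * 2 ^ mi_abs \<beta>"
    proof (cases "norm ?y \<le> 2")
      case True
      show ?thesis unfolding norm_mult using C(1) by (intro mult_mono C(2) monomial_bound True) auto
    next
      case False
      then show ?thesis using bo[of ?y] C(1) by simp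
    qed
    have 2: "norm (monomial \<beta> ((1 / 2 ^ J) *\<^sub>R ?z)) \<le> Z ^ mi_abs \<beta>" by (rule monomial_bound[OF Z])
    have "norm (?f \<beta> \<eta>) = norm (quark_coeff J \<beta>) * norm (monomial \<beta> ((1 / 2 ^ J) *\<^sub>R ?z)) * (norm (fourier \<phi> \<eta>)
        * norm (band \<phi>\<^sub>0 j ?y * monomial \<beta> ?y))"
      unfolding norm_mult norm_wave by simp
    also have "\<dots> \<le> norm (quark_coeff J \<beta>) * Z ^ mi_abs \<beta> * (norm (fourier \<phi> \<eta>) * (C * 2 ^ mi_abs \<beta>))"
      using Z(1) by (intro mult_mono mult_left_mono 1 2 mult_nonneg_nonneg) auto
    also have "\<dots> = ?B \<beta> * (C * norm (fourier \<phi> \<eta>))"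
      unfolding norm_quark_coeff power_mult_distrib by simp
    finally show ?thesis .
  qed
  have bm: "(\<lambda>\<eta>. band \<phi>\<^sub>0 j ((1 / ?t) *\<^sub>R \<eta>)) \<in> borel_measurable borel" "(\<lambda>\<eta>. monomial \<beta> ((1 / ?t) *\<^sub>R \<eta>)) \<in> borel_measurable borel"
    "fourier \<phi> \<in> borel_measurable borel" for \<beta>
    using smooth_measurable[OF smooth_affine[OF sb, of "1 / ?t" 0]] smooth_measurable[OF smooth_affine[OF smooth_monomial, of \<beta> "1 / ?t" 0]]
      schwartz_measurable[OF schwartz_fourier[OF phi]] by simp_all
  note bm[measurable]
  have "((\<lambda>\<beta>. LINT \<eta>|lborel. ?f \<beta> \<eta>) has_sum (LINT \<eta>|lborel. ?F \<eta>)) UNIV"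
  proof (rule has_sum_integral[OF _ _ iF fb])
    show "?B summable_on UNIV" using Z(1) by (intro summable_multi_exp) auto
    show "integrable lborel (?f \<beta>)" for \<beta>
    proof (rule Bochner_Integration.integrable_bound)
      show "integrable lborel (\<lambda>\<eta>. ?B \<beta> * (C * norm (fourier \<phi> \<eta>)))" by (intro integrable_mult_right iF)
      show "AE \<eta> in lborel. norm (?f \<beta> \<eta>) \<le> norm (?B \<beta> * (C * norm (fourier \<phi> \<eta>)))"
        by (rule AE_I2, rule order_trans[OF fb], unfold real_norm_def, rule abs_ge_self)
      show "?f \<beta> \<in> borel_measurable lborel" by measurable
    qed
    fix \<eta> :: "real^'n"
    let ?y = "(1 / ?t) *\<^sub>R \<eta>"
    have w: "wave ?z ?y * wave ?a ?y = wave x \<eta>"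
      by (simp add: wave_add[symmetric] wave_scale)
    have "((\<lambda>\<beta>. (quark_coeff J \<beta> * monomial \<beta> ((1 / 2 ^ J) *\<^sub>R ?z) * monomial \<beta> ?y) * (fourier \<phi> \<eta> * band \<phi>\<^sub>0 j ?y
        * wave ?a ?y)) has_sum
        wave ?z ?y * (fourier \<phi> \<eta> * band \<phi>\<^sub>0 j ?y * wave ?a ?y)) UNIV"
      by (intro has_sum_cmult_left quark_coeff_series)
    moreover have "wave ?z ?y * (fourier \<phi> \<eta> * band \<phi>\<^sub>0 j ?y * wave ?a ?y) = ?F \<eta>"
      unfolding w[symmetric] by (simp only: mult_ac)
    moreover have "(\<lambda>\<beta>. (quark_coeff J \<beta> * monomial \<beta> ((1 / 2 ^ J) *\<^sub>R ?z) * monomial \<beta> ?y) * (fourier \<phi> \<eta>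
        * band \<phi>\<^sub>0 j ?y * wave ?a ?y)) = (\<lambda>\<beta>. ?f \<beta> \<eta>)"
      by (simp only: mult_ac)
    ultimately show "((\<lambda>\<beta>. ?f \<beta> \<eta>) has_sum ?F \<eta>) UNIV" by simp
  next
    show "?F \<in> borel_measurable lborel" by measurable
  qed
  from has_sum_cmult_right[OF this, of "?kz * ?c"]
  have "((\<lambda>\<beta>. ?kz * ?c * (quark_coeff J \<beta> * monomial \<beta> ((1 / 2 ^ J) *\<^sub>R ?z)
      * band_integral (fourier \<phi>) (band \<phi>\<^sub>0 j) \<beta> ?t ?a)) has_sum ?kz * ?c * (LINT \<eta>|lborel. ?F \<eta>)) UNIV"
    unfolding integral_mult_right_zero band_integral_def .
  moreover have "?kz * ?c * (quark_coeff J \<beta> * monomial \<beta> ((1 / 2 ^ J) *\<^sub>R ?z)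
      * band_integral (fourier \<phi>) (band \<phi>\<^sub>0 j) \<beta> ?t ?a)
      = wavelet_coeff J \<phi>\<^sub>0 \<phi> \<beta> j m * quark_scaled J k \<beta> j m x" for \<beta>
    unfolding wavelet_coeff_def quark_scaled_def quark_def monomial_def of_real_mult by (simp only: mult_ac)
  ultimately show ?thesis unfolding band_part_def by (simp only: mult.assoc)
qed

text \<open>
  By the telescoping of the cutoffs a partial sum is the inverse Fourier integral of the transform of \<open>\<phi>\<close>
  truncated at \<open>norm \<eta> \<le> 3 / 2 * 2 ^ N\<close>; dominated convergence and Fourier inversion give the limit.
\<close>

lemma band_part_sums:
  fixes \<phi>\<^sub>0 :: "real^'n::finite \<Rightarrow> real"
  assumes phi0: "smooth \<phi>\<^sub>0" "\<And>x. norm x \<le> 1 \<Longrightarrow> \<phi>\<^sub>0 x = 1" "\<And>x. norm x \<ge> 3 / 2 \<Longrightarrow> \<phi>\<^sub>0 x = 0"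
    and phi: "schwartz \<phi>"
  shows "(\<lambda>j. band_part \<phi>\<^sub>0 \<phi> j x) sums \<phi> x"
proof -
  let ?h = "\<lambda>N \<eta>. complex_of_real (\<phi>\<^sub>0 ((1 / 2 ^ N) *\<^sub>R \<eta>))" and ?u = "\<lambda>\<eta>. wave x \<eta> * fourier \<phi> \<eta>"
  let ?c = "complex_of_real (1 / (2 * pi) ^ CARD('n))"
  let ?I = "\<lambda>N. LINT \<eta>|lborel. ?u \<eta> * ?h N \<eta>"
  have sb: "smooth (band \<phi>\<^sub>0 j)" for j by (rule smooth_band[OF phi0(1)])
  have bo: "band \<phi>\<^sub>0 j y = 0" if "norm y > 2" for j y using band_outside[of \<phi>\<^sub>0 y j] phi0(3) that by blast
  have bB: "\<exists>C. \<forall>y. norm (band \<phi>\<^sub>0 j y) \<le> C" for j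
  proof -
    obtain C where "\<And>is y. length is \<le> 0 \<Longrightarrow> norm (iter_partial is (band \<phi>\<^sub>0 j) y) \<le> C"
      using compact_support_derivatives_bounded[OF sb bo, where L=0] by metis
    from this[of "[]"] show ?thesis by auto
  qed
  have [measurable]: "(\<lambda>\<eta>. band \<phi>\<^sub>0 j ((1 / t) *\<^sub>R \<eta>)) \<in> borel_measurable borel" "fourier \<phi> \<in> borel_measurable borel" for j t
    using smooth_measurable[OF smooth_affine[OF sb, of _ "1 / t" 0]] schwartz_measurable[OF schwartz_fourier[OF phi]] by simp_all
  have iphi: "integrable lborel (fourier \<phi>)" by (rule schwartz_integrable[OF schwartz_fourier[OF phi]])
  have int: "integrable lborel (\<lambda>\<eta>. ?u \<eta> * band \<phi>\<^sub>0 j ((1 / t) *\<^sub>R \<eta>))" for j t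
  proof -
    obtain C where C: "\<And>y. norm (band \<phi>\<^sub>0 j y) \<le> C" using bB by blast
    show ?thesis
    proof (rule Bochner_Integration.integrable_bound)
      show "integrable lborel (\<lambda>\<eta>. norm (fourier \<phi> \<eta>) * C)" by (intro integrable_mult_left integrable_norm iphi)
      show "AE \<eta> in lborel. norm (?u \<eta> * band \<phi>\<^sub>0 j ((1 / t) *\<^sub>R \<eta>)) \<le> norm (norm (fourier \<phi> \<eta>) * C)"
      proof (rule AE_I2)
        fix \<eta>
        have "norm (?u \<eta> * band \<phi>\<^sub>0 j ((1 / t) *\<^sub>R \<eta>)) \<le> norm (fourier \<phi> \<eta>) * C"
          unfolding norm_mult norm_wave mult_1 by (intro mult_left_mono C) auto
        then show "norm (?u \<eta> * band \<phi>\<^sub>0 j ((1 / t) *\<^sub>R \<eta>)) \<le> norm (norm (fourier \<phi> \<eta>) * C)"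
          by (rule order_trans) simp
      qed
    qed measurable
  qed
  have part: "(\<Sum>j<Suc N. band_part \<phi>\<^sub>0 \<phi> j x) = ?c * ?I N" for N
  proof -
    have "(\<Sum>j<Suc N. band_part \<phi>\<^sub>0 \<phi> j x) = ?c * (\<Sum>j<Suc N. LINT \<eta>|lborel. ?u \<eta> * band \<phi>\<^sub>0 j ((1 / 2 ^ j) *\<^sub>R \<eta>))"
      unfolding band_part_def by (simp only: sum_distrib_left)
    also have "(\<Sum>j<Suc N. LINT \<eta>|lborel. ?u \<eta> * band \<phi>\<^sub>0 j ((1 / 2 ^ j) *\<^sub>R \<eta>)) =
       (LINT \<eta>|lborel. (\<Sum>j<Suc N. ?u \<eta> * band \<phi>\<^sub>0 j ((1 / 2 ^ j) *\<^sub>R \<eta>)))"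
      by (rule Bochner_Integration.integral_sum[symmetric]) (rule int)
    also have "\<dots> = ?I N" unfolding sum_distrib_left[symmetric] band_telescope ..
    finally show ?thesis .
  qed
  obtain C where C: "\<And>y. norm (band \<phi>\<^sub>0 0 y) \<le> C" using bB by blast
  have "?I \<longlonglongrightarrow> (LINT \<eta>|lborel. ?u \<eta>)"
  proof (rule integral_dominated_convergence[where w="\<lambda>\<eta>. norm (fourier \<phi> \<eta>) * C"])
    show "integrable lborel (\<lambda>\<eta>. norm (fourier \<phi> \<eta>) * C)" by (intro integrable_mult_left integrable_norm iphi)
    show "AE \<eta> in lborel. norm (?u \<eta> * ?h N \<eta>) \<le> norm (fourier \<phi> \<eta>) * C" for N
      using C unfolding norm_mult norm_wave mult_1 by (intro AE_I2 mult_left_mono) (auto simp: band_def)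
    show "AE \<eta> in lborel. (\<lambda>N. ?u \<eta> * ?h N \<eta>) \<longlonglongrightarrow> ?u \<eta>"
    proof (rule AE_I2)
      fix \<eta> :: "real^'n"
      obtain n where n: "norm \<eta> < 2 ^ n" using real_arch_pow[of 2 "norm \<eta>"] by auto
      have "\<phi>\<^sub>0 ((1 / 2 ^ N) *\<^sub>R \<eta>) = 1" if "n \<le> N" for N
      proof (rule phi0(2))
        have "norm \<eta> \<le> 2 ^ N" using n power_increasing[OF that, of "2::real"] by linarith
        then show "norm ((1 / 2 ^ N) *\<^sub>R \<eta>) \<le> 1" by simp
      qed
      then have "\<forall>\<^sub>F N in sequentially. ?u \<eta> * ?h N \<eta> = ?u \<eta>"
        unfolding eventually_sequentially by auto
      then show "(\<lambda>N. ?u \<eta> * ?h N \<eta>) \<longlonglongrightarrow> ?u \<eta>"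
        by (rule tendsto_eventually)
    qed
    have "\<phi>\<^sub>0 \<in> borel_measurable borel" by (rule smooth_measurable[OF phi0(1)])
    then show "(\<lambda>\<eta>. ?u \<eta> * ?h N \<eta>) \<in> borel_measurable lborel" for N
      by measurable
  qed measurable
  then have "(\<lambda>N. ?c * ?I N) \<longlonglongrightarrow> ?c * (LINT \<eta>|lborel. ?u \<eta>)" by (intro tendsto_intros)
  also have "?c * (LINT \<eta>|lborel. ?u \<eta>) = \<phi> x"
    unfolding fourier_inversion[OF phi] by simp
  finally have "(\<lambda>N. \<Sum>j<Suc N. band_part \<phi>\<^sub>0 \<phi> j x) \<longlonglongrightarrow> \<phi> x" unfolding part .
  then show ?thesis unfolding sums_def by (rule LIMSEQ_imp_Suc)
qed

text \<open>
  Absolute convergence allows summation in the order \<open>\<beta>\<close>, \<open>m\<close>, \<open>j\<close>: the sum over \<open>\<beta>\<close> is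
  \<open>sum_over_moments\<close>, the sum over \<open>m\<close> uses that the translates of \<open>k\<close> add up to \<open>1\<close>, and the sum
  over \<open>j\<close> is \<open>band_part_sums\<close>.
\<close>

lemma quark_expansion_pointwise:
  fixes k \<phi>\<^sub>0 :: "real^'n::finite \<Rightarrow> real"
  assumes k: "smooth k" "\<And>x. norm x > 2 ^ J \<Longrightarrow> k x = 0" "\<And>x. ((\<lambda>m. k (x - lattice_point m)) has_sum 1) UNIV"
    and phi0: "smooth \<phi>\<^sub>0" "\<And>x. norm x \<le> 1 \<Longrightarrow> \<phi>\<^sub>0 x = 1" "\<And>x. norm x \<ge> 3 / 2 \<Longrightarrow> \<phi>\<^sub>0 x = 0"
    and phi: "schwartz \<phi>"
  shows "((\<lambda>(\<beta>, j, m). wavelet_coeff J \<phi>\<^sub>0 \<phi> \<beta> j m * quark_scaled J k \<beta> j m x) has_sum \<phi> x) UNIV"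
proof -
  let ?T = "\<lambda>(\<beta>, j, m). wavelet_coeff J \<phi>\<^sub>0 \<phi> \<beta> j m * quark_scaled J k \<beta> j m x"
  let ?T' = "\<lambda>(j, m, \<beta>). ?T (\<beta>, j, m)"
  obtain W where W: "W summable_on UNIV" "\<And>\<beta> j m is x. length is \<le> 0 \<Longrightarrow>
       (1 + norm x) ^ 0 * norm (wavelet_coeff J \<phi>\<^sub>0 \<phi> \<beta> j m * iter_partial is (quark_scaled J k \<beta> j m) x) \<le> W (\<beta>, j, m)"
    using weighted_summable[OF k(1,2) phi0 phi, where K=0 and L=0] by metis
  have "(\<lambda>i. norm (?T i)) summable_on UNIV"
  proof (rule Infinite_Sum.abs_summable_on_comparison_test'[OF W(1)])
    fix i :: "(nat^'n) \<times> nat \<times> (int^'n)"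
    show "norm (?T i) \<le> W i" using W(2)[of "[]"] by (cases i) simp
  qed
  then obtain S where S: "(?T has_sum S) UNIV" using abs_summable_summable summable_on_def by blast
  have "(?T has_sum S) UNIV \<longleftrightarrow> (?T' has_sum S) UNIV"
    by (rule has_sum_reindex_bij_witness[where i="\<lambda>(j, m, \<beta>). (\<beta>, j, m)" and j="\<lambda>(\<beta>, j, m). (j, m, \<beta>)"]) auto
  with S have "(?T' has_sum S) UNIV" by simp
  then have 1: "(?T' has_sum S) (Sigma UNIV (\<lambda>_. UNIV))" by simp
  have s3: "?T' summable_on (Sigma UNIV (\<lambda>_. UNIV))" using 1 summable_on_def by blast
  have "((\<lambda>j. band_part \<phi>\<^sub>0 \<phi> j x) has_sum S) UNIV"
  proof (rule has_sum_SigmaD[OF 1])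
    fix j :: nat
    have "(\<lambda>p. ?T' (j, p)) summable_on UNIV"
      by (rule summable_on_SigmaD1[of "\<lambda>j p. ?T' (j, p)" UNIV "\<lambda>_. UNIV"]) (use s3 in \<open>auto simp: case_prod_beta'\<close>)
    then have "(\<lambda>p. ?T' (j, p)) summable_on (Sigma UNIV (\<lambda>_. UNIV))" by simp
    moreover have "((\<lambda>\<beta>. ?T' (j, (m, \<beta>))) has_sum complex_of_real (k (2 ^ j *\<^sub>R x - lattice_point m))
        * band_part \<phi>\<^sub>0 \<phi> j x) UNIV" for m
      using sum_over_moments[OF phi0(1,3) phi, of J j m k x] by simp
    moreover have "((\<lambda>m. complex_of_real (k (2 ^ j *\<^sub>R x - lattice_point m)) * band_part \<phi>\<^sub>0 \<phi> j x)
        has_sum band_part \<phi>\<^sub>0 \<phi> j x) UNIV"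
      using has_sum_cmult_left[OF has_sum_of_real[OF k(3)[of "2 ^ j *\<^sub>R x"]], of "band_part \<phi>\<^sub>0 \<phi> j x"] by simp
    ultimately have "((\<lambda>p. ?T' (j, p)) has_sum band_part \<phi>\<^sub>0 \<phi> j x) (Sigma UNIV (\<lambda>_. UNIV))"
      by (intro has_sum_SigmaI) auto
    then show "((\<lambda>p. ?T' (j, p)) has_sum band_part \<phi>\<^sub>0 \<phi> j x) UNIV" by simp
  qed
  then have "(\<lambda>j. band_part \<phi>\<^sub>0 \<phi> j x) sums S" by (rule has_sum_imp_sums)
  moreover have "(\<lambda>j. band_part \<phi>\<^sub>0 \<phi> j x) sums \<phi> x" by (rule band_part_sums[OF phi0 phi])
  ultimately have "S = \<phi> x" by (rule sums_unique2)
  with S show ?thesis by simp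
qed

section \<open>Termwise application of a tempered distribution\<close>

text \<open>
  Termwise differentiation of a series known to have a differentiable sum: the series of difference
  quotients converges uniformly by the mean value inequality, so the limit of the quotients may be
  taken term by term.
\<close>

lemma has_sum_partial:
  fixes g :: "'i \<Rightarrow> real^'n::finite \<Rightarrow> complex"
  assumes g: "\<And>i x. g i differentiable (at x)" and G: "\<And>x. G differentiable (at x)"
    and sum: "\<And>x. ((\<lambda>i. g i x) has_sum G x) UNIV"
    and W: "\<And>i x. norm (partial l (g i) x) \<le> W i" "W summable_on UNIV"
  shows "((\<lambda>i. partial l (g i) x) has_sum partial l G x) UNIV"
proof -
  let ?Q = "\<lambda>f t. (1 / t) *\<^sub>R (f (x + t *\<^sub>R axis l 1) - f x) :: complex"
  have "(\<lambda>i. norm (partial l (g i) x)) summable_on UNIV"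
    by (rule Infinite_Sum.abs_summable_on_comparison_test'[OF W(2) W(1)])
  from abs_summable_summable[OF this] obtain D where D: "((\<lambda>i. partial l (g i) x) has_sum D) UNIV"
    unfolding summable_on_def by blast
  have "(?Q G \<longlongrightarrow> D) (at 0 within - {0})"
  proof (rule swap_uniform_limit)
    show "\<forall>\<^sub>F X in finite_subsets_at_top UNIV. ((\<lambda>t. \<Sum>i\<in>X. ?Q (g i) t) \<longlongrightarrow> (\<Sum>i\<in>X. partial l (g i) x)) (at 0 within - {0})"
      by (intro always_eventually allI tendsto_sum tendsto_within_subset[OF difference_quotient_tendsto] g) auto
    show "((\<lambda>X. \<Sum>i\<in>X. partial l (g i) x) \<longlongrightarrow> D) (finite_subsets_at_top UNIV)"
      using D unfolding has_sum_def .
    show "uniform_limit (- {0}) (\<lambda>X t. \<Sum>i\<in>X. ?Q (g i) t) (?Q G) (finite_subsets_at_top UNIV)"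
    proof (rule Weierstrass_m_test_general'[OF _ _ W(2)])
      show "norm (?Q (g i) t) \<le> W i" if "t \<in> - {0}" for i t
        using that by (intro difference_quotient_le g W(1)) auto
      have "((\<lambda>i. g i y - g i x) has_sum (G y - G x)) UNIV" for y
        using has_sum_add[OF sum[of y] has_sum_uminusI[OF sum[of x]]] by simp
      then show "((\<lambda>i. ?Q (g i) t) has_sum ?Q G t) UNIV" for t
        unfolding scaleR_conv_of_real by (intro has_sum_cmult_right)
    qed
  qed simp
  moreover have "at (0::real) within - {0} = at 0"
  proof -
    have "- {0} - {0} = UNIV - {0::real}" by auto
    then show ?thesis unfolding at_within_def by simp
  qed
  ultimately have "(?Q G \<longlongrightarrow> D) (at 0)" by simp
  moreover have "(?Q G \<longlongrightarrow> partial l G x) (at 0)" by (rule difference_quotient_tendsto[OF G])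
  ultimately have "D = partial l G x" by (rule tendsto_unique[OF at_neq_bot])
  with D show ?thesis by simp
qed

lemma schwartz_norm_upper:
  assumes "schwartz \<phi>"
  shows "(1 + norm x) ^ K * (\<Sum>is | length is \<le> L. norm (iter_partial is \<phi> x)) \<le> schwartz_norm K L \<phi>"
proof -
  have "\<forall>is. \<exists>D. \<forall>x. (1 + norm x) ^ K * norm (iter_partial is \<phi> x) \<le> D"
  proof
    fix "is"
    show "\<exists>D. \<forall>x. (1 + norm x) ^ K * norm (iter_partial is \<phi> x) \<le> D"
      by (rule schwartzD[OF assms, of K "is"]) auto
  qed
  from choice[OF this] obtain D where D: "\<And>is x. (1 + norm x) ^ K * norm (iter_partial is \<phi> x) \<le> D is" by blast
  have "bdd_above (range (\<lambda>x. (1 + norm x) ^ K * (\<Sum>is | length is \<le> L. norm (iter_partial is \<phi> x))))"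
    unfolding sum_distrib_left by (rule bdd_aboveI2[where M="\<Sum>is | length is \<le> L. D is"]) (intro sum_mono D)
  then show ?thesis unfolding schwartz_norm_def by (rule cSUP_upper[OF UNIV_I])
qed

lemma schwartz_norm_least:
  assumes "\<And>x. (1 + norm x) ^ K * (\<Sum>is | length is \<le> L. norm (iter_partial is \<phi> x)) \<le> B"
  shows "schwartz_norm K L \<phi> \<le> B"
  unfolding schwartz_norm_def by (rule cSUP_least) (auto intro: assms)

lemma schwartz_norm_nonneg:
  assumes "schwartz \<phi>" shows "0 \<le> schwartz_norm K L \<phi>"
proof (rule order_trans[OF _ schwartz_norm_upper[OF assms, of 0]])
  show "0 \<le> (1 + norm (0::real^'a)) ^ K * (\<Sum>is | length is \<le> L. norm (iter_partial is \<phi> 0))"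
    by (intro mult_nonneg_nonneg sum_nonneg) auto
qed

lemma schwartz_norm_mono:
  assumes "schwartz \<phi>" "K \<le> K'" "L \<le> L'"
  shows "schwartz_norm K L \<phi> \<le> schwartz_norm K' L' \<phi>"
proof (rule schwartz_norm_least)
  fix x
  have "(1 + norm x) ^ K * (\<Sum>is | length is \<le> L. norm (iter_partial is \<phi> x)) \<le>
    (1 + norm x) ^ K' * (\<Sum>is | length is \<le> L'. norm (iter_partial is \<phi> x))"
    using assms finite_lists_upto[of L']
    by (intro mult_mono power_increasing sum_mono2 sum_nonneg) auto
  also have "\<dots> \<le> schwartz_norm K' L' \<phi>" by (rule schwartz_norm_upper[OF assms(1)])
  finally show "(1 + norm x) ^ K * (\<Sum>is | length is \<le> L. norm (iter_partial is \<phi> x)) \<le> schwartz_norm K' L' \<phi>" .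
qed

lemma schwartz_norm_add:
  assumes "schwartz \<phi>" "schwartz \<psi>"
  shows "schwartz_norm K L (\<lambda>x. \<phi> x + \<psi> x) \<le> schwartz_norm K L \<phi> + schwartz_norm K L \<psi>"
proof (rule schwartz_norm_least)
  fix x
  have "(1 + norm x) ^ K * (\<Sum>is | length is \<le> L. norm (iter_partial is (\<lambda>x. \<phi> x + \<psi> x) x)) \<le>
    (1 + norm x) ^ K * (\<Sum>is | length is \<le> L. norm (iter_partial is \<phi> x) + norm (iter_partial is \<psi> x))"
    unfolding iter_partial_add[OF schwartz_smooth[OF assms(1)] schwartz_smooth[OF assms(2)]]
    by (intro mult_left_mono sum_mono norm_triangle_ineq) auto
  also have "\<dots> = (1 + norm x) ^ K * (\<Sum>is | length is
      \<le> L. norm (iter_partial is \<phi> x)) + (1 + norm x) ^ K * (\<Sum>is | length is \<le> L. norm (iter_partial is \<psi> x))"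
    by (simp only: sum.distrib distrib_left)
  also have "\<dots> \<le> schwartz_norm K L \<phi> + schwartz_norm K L \<psi>"
    by (intro add_mono schwartz_norm_upper assms)
  finally show "(1 + norm x) ^ K * (\<Sum>is | length is \<le> L. norm (iter_partial is (\<lambda>x. \<phi> x + \<psi> x) x))
      \<le> schwartz_norm K L \<phi> + schwartz_norm K L \<psi>" .
qed

lemma schwartz_norm_cmult_le:
  assumes "schwartz \<phi>"
  shows "schwartz_norm K L (\<lambda>x. c * \<phi> x) \<le> norm c * schwartz_norm K L \<phi>"
proof (rule schwartz_norm_least)
  fix x
  have "(1 + norm x) ^ K * (\<Sum>is | length is \<le> L. norm (iter_partial is (\<lambda>x. c * \<phi> x) x)) =
    norm c * ((1 + norm x) ^ K * (\<Sum>is | length is \<le> L. norm (iter_partial is \<phi> x)))"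
    unfolding iter_partial_cmult[OF schwartz_smooth[OF assms]] norm_mult
    by (simp only: sum_distrib_left[symmetric] mult.left_commute)
  also have "\<dots> \<le> norm c * schwartz_norm K L \<phi>"
    by (intro mult_left_mono schwartz_norm_upper assms) auto
  finally show "(1 + norm x) ^ K * (\<Sum>is | length is \<le> L. norm (iter_partial is (\<lambda>x. c * \<phi> x) x))
      \<le> norm c * schwartz_norm K L \<phi>" .
qed

text \<open>
  The given subbasis consists of balls around arbitrary centres with respect to arbitrary seminorms. By
  the triangle inequality each of them that contains \<open>0\<close> contains a ball around \<open>0\<close>, and
  finitely many seminorms are dominated by a single one.
\<close>

lemma neighbourhood_of_zero:
  fixes U :: "(real^'n::finite \<Rightarrow> complex) set"
  assumes "generate_topology_on {{\<psi>. schwartz \<psi> \<and> schwartz_norm K L (\<lambda>x. \<psi> x - \<phi> x) < \<epsilon>} | \<phi> K L \<epsilon>.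
        schwartz \<phi> \<and> \<epsilon> > 0} U" and "(\<lambda>_. 0) \<in> U"
  shows "\<exists>K L \<epsilon>. \<epsilon> > 0 \<and> (\<forall>\<psi>. schwartz \<psi> \<longrightarrow> schwartz_norm K L \<psi> < \<epsilon> \<longrightarrow> \<psi> \<in> U)"
  using assms
proof induction
  case Empty
  then show ?case by simp
next
  case (Int a b)
  from Int obtain K L e where a: "e > 0" "\<And>\<psi>. schwartz \<psi> \<Longrightarrow> schwartz_norm K L \<psi> < e \<Longrightarrow> \<psi> \<in> a" by blast
  from Int obtain K' L' e' where b: "e' > 0" "\<And>\<psi>. schwartz \<psi> \<Longrightarrow> schwartz_norm K' L' \<psi> < e' \<Longrightarrow> \<psi> \<in> b" by blast
  have "\<psi> \<in> a \<inter> b" if "schwartz \<psi>" "schwartz_norm (max K K') (max L L') \<psi> < min e e'" for \<psi>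
    using that a(2)[of \<psi>] b(2)[of \<psi>] schwartz_norm_mono[of \<psi> K "max K K'" L "max L L'"]
      schwartz_norm_mono[of \<psi> K' "max K K'" L' "max L L'"] by auto
  then show ?case using a(1) b(1) by (intro exI[of _ "max K K'"] exI[of _ "max L L'"] exI[of _ "min e e'"]) auto
next
  case (UN S)
  then show ?case by (meson UnionE UnionI)
next
  case (Basis s)
  then obtain \<phi> K L e where s: "s = {\<psi>. schwartz \<psi> \<and> schwartz_norm K L (\<lambda>x. \<psi> x - \<phi> x) < e}" "schwartz \<phi>" "e > 0" by blast
  let ?p = "schwartz_norm K L (\<lambda>x. 0 - \<phi> x)"
  have sp: "schwartz (\<lambda>x. 0 - \<phi> x)" by (rule schwartz_diff[OF schwartz_zero s(2)])
  have p: "?p < e" using Basis(2) unfolding s(1) by simp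
  have "\<psi> \<in> s" if "schwartz \<psi>" "schwartz_norm K L \<psi> < e - ?p" for \<psi>
    using schwartz_norm_add[OF that(1) sp, of K L] that unfolding s(1) by simp
  then show ?case using p by (intro exI[of _ K] exI[of _ L] exI[of _ "e - ?p"]) auto
qed

text \<open>
  Continuity at \<open>0\<close> and homogeneity. Scaling by \<open>e / r\<close> with \<open>r\<close> above the seminorm also covers
  functions whose seminorm vanishes.
\<close>

lemma tempered_seminorm_bound:
  fixes f :: "(real^'n::finite \<Rightarrow> complex) \<Rightarrow> complex"
  assumes "tempered f"
  obtains C K L where "0 \<le> C" "\<And>\<psi>. schwartz \<psi> \<Longrightarrow> norm (f \<psi>) \<le> C * schwartz_norm K L \<psi>"
proof -
  have hom: "f (\<lambda>x. c * \<phi> x) = c * f \<phi>" if "schwartz \<phi>" for c \<phi> using assms that by (simp add: tempered_def)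
  have cont: "continuous_map schwartz_topology euclidean f" using assms by (simp add: tempered_def)
  have f0: "f (\<lambda>_. 0) = 0" using hom[OF schwartz_zero, of 0] by simp
  let ?U = "{\<psi> \<in> topspace schwartz_topology. f \<psi> \<in> ball 0 1}"
  have "openin schwartz_topology ?U"
    by (rule openin_continuous_map_preimage[OF cont]) simp
  then have gen: "generate_topology_on {{\<psi>. schwartz \<psi> \<and> schwartz_norm K L (\<lambda>x. \<psi> x - \<phi> x) < \<epsilon>} | \<phi> K L \<epsilon>.
        schwartz \<phi> \<and> \<epsilon> > 0} ?U"
    unfolding schwartz_topology_def openin_topology_generated_by_iff .
  have sn0: "schwartz_norm 0 0 (\<lambda>x::real^'n. 0 - 0) < 1"
    by (rule le_less_trans[OF schwartz_norm_least[where B=0]]) (auto simp: iter_partial_zero)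
  have "(\<lambda>_::real^'n. 0::complex) \<in> topspace schwartz_topology"
    unfolding schwartz_topology_def topology_generated_by_topspace
  proof (rule UnionI[where X="{\<psi>. schwartz \<psi> \<and> schwartz_norm 0 0 (\<lambda>x::real^'n. \<psi> x - 0) < 1}"])
    show "{\<psi>. schwartz \<psi> \<and> schwartz_norm 0 0 (\<lambda>x::real^'n. \<psi> x - 0) < 1} \<in>
      {{\<psi>. schwartz \<psi> \<and> schwartz_norm K L (\<lambda>x. \<psi> x - \<phi> x) < \<epsilon>} | \<phi> K L \<epsilon>. schwartz \<phi> \<and> \<epsilon> > 0}"
      by (rule CollectI, rule exI[of _ "\<lambda>_. 0"], rule exI[of _ 0], rule exI[of _ 0], rule exI[of _ 1]) (simp add: schwartz_zero)
    show "(\<lambda>_. 0) \<in> {\<psi>. schwartz \<psi> \<and> schwartz_norm 0 0 (\<lambda>x::real^'n. \<psi> x - 0) < 1}"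
      using sn0 schwartz_zero by simp
  qed
  then have "(\<lambda>_. 0) \<in> ?U" using f0 by simp
  from neighbourhood_of_zero[OF gen this] obtain K L e where e: "e > 0" "\<And>\<psi>. schwartz \<psi> \<Longrightarrow> schwartz_norm K L \<psi> < e
      \<Longrightarrow> norm (f \<psi>) < 1"
    by auto
  show ?thesis
  proof (rule that[of "1 / e" K L])
    show "0 \<le> 1 / e" using e by simp
    fix \<psi> :: "real^'n \<Rightarrow> complex" assume psi: "schwartz \<psi>"
    let ?p = "schwartz_norm K L \<psi>"
    have p0: "0 \<le> ?p" by (rule schwartz_norm_nonneg[OF psi])
    have "norm (f \<psi>) * e \<le> r" if r: "?p < r" for r
    proof -
      have r0: "0 < r" using p0 r by linarith
      let ?c = "complex_of_real (e / r)"
      have nc: "norm ?c = e / r" using e(1) r0 unfolding norm_of_real by simp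
      have "schwartz_norm K L (\<lambda>x. ?c * \<psi> x) \<le> e / r * ?p"
        using schwartz_norm_cmult_le[OF psi, of K L ?c] unfolding nc .
      also have "\<dots> < e" using e(1) r r0 by (simp add: field_simps)
      finally have "norm (f (\<lambda>x. ?c * \<psi> x)) < 1" by (intro e(2) schwartz_cmult psi)
      then have "e / r * norm (f \<psi>) < 1" unfolding hom[OF psi] norm_mult nc .
      then show ?thesis using r0 by (simp add: field_simps)
    qed
    then have "norm (f \<psi>) * e \<le> ?p" by (rule dense_ge)
    then show "norm (f \<psi>) \<le> 1 / e * ?p" using e(1) by (simp add: field_simps)
  qed
qed

lemma tempered_finite_sum:
  assumes f: "tempered f" and q: "\<And>i. schwartz (q i)"
  shows "f (\<lambda>x. \<Sum>i\<in>A. d i * q i x) = (\<Sum>i\<in>A. d i * f (q i))"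
proof -
  have hom: "f (\<lambda>x. c * \<phi> x) = c * f \<phi>" if "schwartz \<phi>" for c \<phi> using f that by (simp add: tempered_def)
  have add: "f (\<lambda>x. \<phi> x + \<psi> x) = f \<phi> + f \<psi>" if "schwartz \<phi>" "schwartz \<psi>" for \<phi> \<psi> using f that by (simp add: tempered_def)
  have f0: "f (\<lambda>_. 0) = 0" using hom[OF schwartz_zero, of 0] by simp
  show ?thesis
  proof (induction A rule: infinite_finite_induct)
    case (insert i A)
    then show ?case using add[OF schwartz_cmult[OF q] schwartz_sum[where I=A and f="\<lambda>i x. d i * q i x"]]
      by (simp add: hom q schwartz_cmult)
  qed (auto simp: f0)
qed

text \<open>
  Termwise differentiation shows that the expansion converges together with all derivatives, and the
  majorants bound the remainders in the seminorm that controls \<open>f\<close>.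
\<close>

lemma tempered_has_sum_of_expansion:
  fixes q :: "'i \<Rightarrow> real^'n::finite \<Rightarrow> complex"
  assumes f: "tempered f" and q: "\<And>i. schwartz (q i)" and phi: "schwartz \<phi>"
    and sum: "\<And>x. ((\<lambda>i. d i * q i x) has_sum \<phi> x) UNIV"
    and W: "\<And>K L. \<exists>W. W summable_on UNIV \<and> (\<forall>i is x. length is
        \<le> L \<longrightarrow> (1 + norm x) ^ K * norm (d i * iter_partial is (q i) x) \<le> W i)"
  shows "((\<lambda>i. d i * f (q i)) has_sum f \<phi>) UNIV"
proof -
  have der: "((\<lambda>i. d i * iter_partial is (q i) x) has_sum iter_partial is \<phi> x) UNIV" for "is" x
  proof (induction "is" arbitrary: x)
    case Nil
    then show ?case using sum by simp
  next
    case (Cons l "is")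
    have sq: "smooth (iter_partial is (q i))" for i by (intro smooth_iter_partial schwartz_smooth q)
    have p: "partial l (\<lambda>x. d i * iter_partial is (q i) x) x = d i * iter_partial (l # is) (q i) x" for i x
      by (simp add: partial_bounded_linear[OF bounded_linear_mult_right] smooth_differentiable[OF sq])
    obtain W where W: "W summable_on UNIV" "\<forall>i is' x. length is' \<le> length (l # is) \<longrightarrow> (1 + norm x) ^ 0 * norm (d i
        * iter_partial is' (q i) x) \<le> W i"
      using assms(5) by blast
    have "((\<lambda>i. partial l (\<lambda>x. d i * iter_partial is (q i) x) x) has_sum partial l (iter_partial is \<phi>) x) UNIV"
    proof (rule has_sum_partial[OF _ _ Cons.IH _ W(1)])
      show "(\<lambda>x. d i * iter_partial is (q i) x) differentiable at x" for i x
        by (intro differentiable_mult differentiable_const smooth_differentiable sq)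
      show "iter_partial is \<phi> differentiable at x" for x
        by (intro smooth_differentiable smooth_iter_partial schwartz_smooth phi)
      show "norm (partial l (\<lambda>x. d i * iter_partial is (q i) x) x) \<le> W i" for i x
        unfolding p using W(2)[rule_format, of "l # is" x i] by simp
    qed
    then show ?case unfolding p by simp
  qed
  obtain C K L where C: "0 \<le> C" "\<And>\<psi>. schwartz \<psi> \<Longrightarrow> norm (f \<psi>) \<le> C * schwartz_norm K L \<psi>"
    using tempered_seminorm_bound[OF f] by metis
  obtain W where W: "W summable_on UNIV" "\<And>i is x. length is \<le> L
      \<Longrightarrow> (1 + norm x) ^ K * norm (d i * iter_partial is (q i) x) \<le> W i"
    using assms(5) by blast
  define T where "T = infsum W UNIV"
  have T: "(W has_sum T) UNIV" unfolding T_def by (rule has_sum_infsum[OF W(1)])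
  let ?n = "real (card {is :: 'n list. length is \<le> L})"
  let ?S = "\<lambda>A x. \<Sum>i\<in>A. d i * q i x"
  let ?R = "\<lambda>A x. \<phi> x - ?S A x"
  have sS: "schwartz (?S A)" for A by (intro schwartz_sum schwartz_cmult q)
  have tail: "norm (f \<phi> - (\<Sum>i\<in>A. d i * f (q i))) \<le> C * (?n * (T - sum W A))" if A: "finite A" for A
  proof -
    have sd: "schwartz (?R A)" by (rule schwartz_diff[OF phi sS])
    have it: "iter_partial is (?R A) x = iter_partial is \<phi> x - (\<Sum>i\<in>A. d i * iter_partial is (q i) x)" for "is" x
      by (simp add: iter_partial_diff schwartz_smooth phi sS iter_partial_sum schwartz_cmult q iter_partial_cmult)
    have one: "(1 + norm x) ^ K * norm (iter_partial is (?R A) x) \<le> T - sum W A" if "length is \<le> L" for "is" x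
    proof -
      let ?w = "complex_of_real ((1 + norm x) ^ K)"
      have w: "norm ?w = (1 + norm x) ^ K" by (simp only: norm_of_real abs_of_nonneg zero_le_power add_nonneg_nonneg zero_le_one norm_ge_zero)
      have "norm (?w * iter_partial is \<phi> x - (\<Sum>i\<in>A. ?w * (d i * iter_partial is (q i) x))) \<le> T - sum W A"
        by (rule norm_has_sum_tail_le[OF has_sum_cmult_right[OF der] T _ A]) (simp only: norm_mult[of ?w] w W(2)[OF that])
      then show ?thesis unfolding it by (simp only: sum_distrib_left[symmetric] right_diff_distrib[symmetric] norm_mult[of ?w] w)
    qed
    have "schwartz_norm K L (?R A) \<le> ?n * (T - sum W A)"
    proof (rule schwartz_norm_least)
      fix x
      show "(1 + norm x) ^ K * (\<Sum>is | length is \<le> L. norm (iter_partial is (?R A) x)) \<le> ?n * (T - sum W A)"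
        unfolding sum_distrib_left by (rule sum_bounded_above) (use one in simp)
    qed
    then have "norm (f (?R A)) \<le> C * (?n * (T - sum W A))"
      using C(2)[OF sd] C(1) by (meson mult_left_mono order_trans)
    moreover have "f (?R A) = f \<phi> - (\<Sum>i\<in>A. d i * f (q i))"
    proof -
      have "f \<phi> = f (\<lambda>x. (\<phi> x - ?S A x) + ?S A x)" by simp
      also have "\<dots> = f (?R A) + f (?S A)" using f sd sS unfolding tempered_def by blast
      finally show ?thesis using tempered_finite_sum[OF f q, where A=A and d=d] by simp
    qed
    ultimately show ?thesis by simp
  qed
  have "((\<lambda>A. (\<Sum>i\<in>A. d i * f (q i)) - f \<phi>) \<longlongrightarrow> 0) (finite_subsets_at_top UNIV)"
  proof (rule Lim_null_comparison)
    show "\<forall>\<^sub>F A in finite_subsets_at_top UNIV. norm ((\<Sum>i\<in>A. d i * f (q i)) - f \<phi>) \<le> C * (?n * (T - sum W A))"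
      by (rule eventually_finite_subsets_at_top_weakI) (use tail in \<open>simp add: norm_minus_commute\<close>)
    have "((\<lambda>A. C * (?n * (T - sum W A))) \<longlongrightarrow> C * (?n * (T - T))) (finite_subsets_at_top UNIV)"
      using T unfolding has_sum_def by (intro tendsto_intros)
    then show "((\<lambda>A. C * (?n * (T - sum W A))) \<longlongrightarrow> 0) (finite_subsets_at_top UNIV)" by simp
  qed
  then show ?thesis unfolding has_sum_def by (simp add: Lim_null[symmetric])
qed

text \<open>
  It remains to match the data: the coefficients of the quark expansion of \<open>\<phi>\<close> are the pairings of \<open>\<phi>\<close> with
  the wavelets, and applying \<open>f\<close> to that expansion exchanges the roles of quarks and wavelets.
\<close>

theorem theorem2p30:
  fixes J :: nat
    and k \<omega> \<phi>\<^sub>0 :: "real ^ 'n::finite \<Rightarrow> real"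
    and \<Phi>\<^sub>F \<Phi>\<^sub>M :: "nat ^ 'n \<Rightarrow> real ^ 'n \<Rightarrow> complex"
    and f :: "(real ^ 'n \<Rightarrow> complex) \<Rightarrow> complex"
  assumes "J \<ge> 1"
    and "smooth k" and "\<And>x. k x \<ge> 0"
    and "closure {x. k x \<noteq> 0} \<subseteq> {y. norm y < 2 ^ J \<and> (\<forall>l. y $ l > 0)}"
    and "\<And>x. ((\<lambda>m. k (x - lattice_point m)) has_sum 1) UNIV"
    and "smooth \<omega>"
    and "closure {x. \<omega> x \<noteq> 0} \<subseteq> {x. \<forall>l. - pi < x $ l \<and> x $ l < pi}"
    and "\<And>x. norm x \<le> 2 \<Longrightarrow> \<omega> x = 1"
    and "smooth \<phi>\<^sub>0" and "\<And>x. \<phi>\<^sub>0 x \<ge> 0"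
    and "\<And>x. norm x \<le> 1 \<Longrightarrow> \<phi>\<^sub>0 x = 1"
    and "\<And>x. norm x \<ge> 3 / 2 \<Longrightarrow> \<phi>\<^sub>0 x = 0"
    and "\<And>\<beta>. schwartz (\<Phi>\<^sub>F \<beta>)"
    and "\<And>\<beta> x. inverse_fourier (\<Phi>\<^sub>F \<beta>) x = complex_of_real (\<phi>\<^sub>0 x) * Omega_mi J \<omega> \<beta> x"
    and "\<And>\<beta>. schwartz (\<Phi>\<^sub>M \<beta>)"
    and "\<And>\<beta> x. inverse_fourier (\<Phi>\<^sub>M \<beta>) x =
           complex_of_real (\<phi>\<^sub>0 x - \<phi>\<^sub>0 (2 *\<^sub>R x)) * Omega_mi J \<omega> \<beta> x"
    and "tempered f"
  shows "tempered_has_sum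
           (\<lambda>(\<beta>, j, m) \<phi>. 2 ^ (j * CARD('n)) * f (quark_scaled J k \<beta> j m) *
              regular_distribution (wavelet_scaled \<Phi>\<^sub>F \<Phi>\<^sub>M \<beta> j m) \<phi>)
           f"
proof -
  have supp: "k x = 0" if "norm x > 2 ^ J" for x
  proof (rule ccontr)
    assume "k x \<noteq> 0"
    then have "x \<in> closure {x. k x \<noteq> 0}" by (intro subsetD[OF closure_subset]) simp
    then have "norm x < 2 ^ J" using subsetD[OF assms(4)] by simp
    then show False using that by simp
  qed
  show ?thesis unfolding tempered_has_sum_def
  proof (intro allI impI)
    fix \<phi> :: "real^'n \<Rightarrow> complex" assume phi: "schwartz \<phi>"
    let ?d = "\<lambda>(\<beta>, j, m). wavelet_coeff J \<phi>\<^sub>0 \<phi> \<beta> j m"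
    let ?q = "\<lambda>(\<beta>, j, m). quark_scaled J k \<beta> j m"
    have "((\<lambda>i. ?d i * f (?q i)) has_sum f \<phi>) UNIV"
    proof (rule tempered_has_sum_of_expansion[OF assms(17) _ phi])
      show "schwartz (?q i)" for i by (cases i) (simp add: schwartz_quark_scaled[OF assms(2) supp])
      show "((\<lambda>i. ?d i * ?q i x) has_sum \<phi> x) UNIV" for x
        using quark_expansion_pointwise[OF assms(2) supp assms(5) assms(9) assms(11) assms(12) phi, where x=x]
        by (simp add: case_prod_beta')
      show "\<exists>W. W summable_on UNIV \<and> (\<forall>i is x. length is
          \<le> L \<longrightarrow> (1 + norm x) ^ K * norm (?d i * iter_partial is (?q i) x) \<le> W i)" for K L
      proof -
        obtain W where "W summable_on UNIV" "\<And>\<beta> j m is x. length is \<le> L \<Longrightarrow>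
          (1 + norm x) ^ K * norm (wavelet_coeff J \<phi>\<^sub>0 \<phi> \<beta> j m * iter_partial is (quark_scaled J k \<beta> j m) x) \<le> W (\<beta>, j, m)"
          using weighted_summable[OF assms(2) supp assms(9) assms(11) assms(12) phi, where K=K and L=L] by metis
        then show ?thesis by (intro exI[of _ W]) auto
      qed
    qed
    moreover have t: "2 ^ (j * CARD('n)) * f (quark_scaled J k \<beta> j m)
        * regular_distribution (wavelet_scaled \<Phi>\<^sub>F \<Phi>\<^sub>M \<beta> j m) \<phi>
       = wavelet_coeff J \<phi>\<^sub>0 \<phi> \<beta> j m * f (quark_scaled J k \<beta> j m)" for \<beta> j m
      using wavelet_pairing[where \<Phi>\<^sub>F=\<Phi>\<^sub>F and \<Phi>\<^sub>M=\<Phi>\<^sub>M and \<beta>=\<beta> and j=j and m=m,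
          OF assms(6) assms(7) assms(8) assms(12) assms(13) assms(14) assms(15) assms(16) phi, symmetric]
      by (simp only: mult_ac)
    ultimately show "((\<lambda>i. (\<lambda>(\<beta>, j, m) \<phi>. 2 ^ (j * CARD('n)) * f (quark_scaled J k \<beta> j m) *
              regular_distribution (wavelet_scaled \<Phi>\<^sub>F \<Phi>\<^sub>M \<beta> j m) \<phi>) i \<phi>) has_sum f \<phi>) UNIV"
      by (simp only: case_prod_beta' t)
  qed
qed

end
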